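(* Let $p\ge 1$, let $\mathbb H=\mathbb H^+$ or $\mathbb H^-$, and let $K:\mathbb H\to\mathbb D$ be the Cayley transformation. Then the push-forward $K_*$, $K_*(\Phi)=\Phi\circ K^{-1}$, is a Banach space isomorphism (a bounded linear bijection with bounded inverse) from $\widehat{\mathcal B}_p(\mathbb H)$ onto $\widehat{\mathcal B}_p(\mathbb D)$.
   Context: $\mathbb H^{\pm}$ are the upper/lower half-planes, $\mathbb D$ is the unit disk, $z=x+iy$. The Cayley transformation is $K(z)=(z-i)/(z+i)$ on $\mathbb H^+$ and $K(z)=(-z-i)/(-z+i)$ on $\mathbb H^-$. For $p\ge1$ and a holomorphic function $\Phi$ on $\mathbb H$ put $\Vert \Phi \Vert_{\mathcal B_p^{\#}}=\bigl(\int_{\mathbb H} |({\rm Im}\,z)^2\Phi''(z)|^p \frac{dx\,dy}{|{\rm Im}\,z|^2}\bigr)^{1/p}$ and $\Vert \Phi \Vert_{\rm BMOA}=\bigl(\sup_{I} \frac{1}{|I|}\int_{\widehat I} |({\rm Im}\,z)\Phi'(z)|^2\frac{dx\,dy}{|{\rm Im}\,z|}\bigr)^{1/2}$, where $I$ ranges over all bounded intervals of $\mathbb R$ and $\widehat I\subset\mathbb H$ is the Carleson box (the square in $\mathbb H$ of side length $|I|$ with side $I$). On $\mathbb D$ these are defined analogously, replacing the hyperbolic density $1/|{\rm Im}\,z|$ by $2/(1-|z|^2)$: $\Vert \Phi \Vert_{\mathcal B_p^{\#}}=\bigl(\int_{\mathbb D} |(\frac{1-|z|^2}{2})^2\Phi''(z)|^p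 \frac{4\,dx\,dy}{(1-|z|^2)^2}\bigr)^{1/p}$, and $\Vert \Phi \Vert_{\rm BMOA}^2$ is the supremum over arcs $I$ of the unit circle of $\frac1{|I|}\int_{\widehat I}\frac{1-|z|^2}{2}|\Phi'(z)|^2dx\,dy$, with $\widehat I=\{re^{i\theta}: e^{i\theta}\in I,\ 1-|I|/(2\pi)\le r<1\}$ the Carleson box in $\mathbb D$ over $I$ (the precise normalization of boxes is irrelevant up to equivalence). For $X=\mathbb H$ or $\mathbb D$, $\widehat{\mathcal B}_p(X)$ is the set of holomorphic functions $\Phi$ on $X$ with $\Vert \Phi \Vert_{\widehat{\mathcal B}_p}=\Vert \Phi \Vert_{\mathcal B_p^{\#}}+\Vert \Phi\Vert_{\rm BMOA}<\infty$, where functions differing by a constant are identified; it is a complex Banach space with this norm. *)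

theory Defs
  imports "HOL-Complex_Analysis.Complex_Analysis"
begin

definition upper_halfplane :: "complex set" where
  "upper_halfplane = {z. Im z > 0}"

definition lower_halfplane :: "complex set" where
  "lower_halfplane = {z. Im z < 0}"

text \<open>The value on the real axis is irrelevant.\<close>

definition cayley :: "complex \<Rightarrow> complex" where
  "cayley z = (if Im z > 0 then (z - \<i>) / (z + \<i>) else (- z - \<i>) / (- z + \<i>))"

text \<open>
  A domain together with its hyperbolic density and its Carleson boxes. The boundary intervals (or
  arcs) over which the boxes stand are given by real intervals \<open>J\<close> of positive length; in the disc,
  \<open>J\<close> is the interval of angles of the arc, so that \<open>measure lborel J\<close> is the length of the arc as
  long as it is at most \<open>2 * pi\<close>.
\<close>

record hyp_domain =
  pts :: "complex set"
  density :: "complex \<Rightarrow> real"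
  bases :: "real set set"
  box :: "real set \<Rightarrow> complex set"

definition halfplane_domain :: "complex set \<Rightarrow> hyp_domain" where
  "halfplane_domain H =
    \<lparr> pts = H,
      density = (\<lambda>z. 1 / \<bar>Im z\<bar>),
      bases = {J. is_interval J \<and> bounded J \<and> 0 < measure lborel J},
      box = (\<lambda>J. {z \<in> H. Re z \<in> J \<and> \<bar>Im z\<bar> \<le> measure lborel J}) \<rparr>"

definition disc_domain :: hyp_domain where
  "disc_domain =
    \<lparr> pts = ball 0 1,
      density = (\<lambda>z. 2 / (1 - (norm z)\<^sup>2)),
      bases = {J. is_interval J \<and> bounded J \<and> 0 < measure lborel J \<and> measure lborel J \<le> 2 * pi},
      box = (\<lambda>J. {of_real r * cis \<theta> | r \<theta>.
                    \<theta> \<in> J \<and> 1 - measure lborel J / (2 * pi) \<le> r \<and> r < 1}) \<rparr>"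

text \<open>
  The \<open>p\<close>-th power of the Besov seminorm and the square of the BMOA seminorm, as possibly infinite
  quantities.
\<close>

definition besov_integral :: "hyp_domain \<Rightarrow> real \<Rightarrow> (complex \<Rightarrow> complex) \<Rightarrow> ennreal" where
  "besov_integral X p \<Phi> =
    (\<integral>\<^sup>+ z \<in> pts X. ennreal ((norm (deriv (deriv \<Phi>) z) / (density X z)\<^sup>2) powr p * (density X z)\<^sup>2)
       \<partial>lborel)"

definition bmoa_sup :: "hyp_domain \<Rightarrow> (complex \<Rightarrow> complex) \<Rightarrow> ennreal" where
  "bmoa_sup X \<Phi> =
    (SUP J \<in> bases X. ennreal (1 / measure lborel J) *
       (\<integral>\<^sup>+ z \<in> box X J. ennreal ((norm (deriv \<Phi> z) / density X z)\<^sup>2 * density X z) \<partial>lborel))"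

definition besov_functions :: "hyp_domain \<Rightarrow> real \<Rightarrow> (complex \<Rightarrow> complex) set" where
  "besov_functions X p =
    {\<Phi>. \<Phi> holomorphic_on pts X \<and> besov_integral X p \<Phi> < \<infinity> \<and> bmoa_sup X \<Phi> < \<infinity>}"

definition besov_norm :: "hyp_domain \<Rightarrow> real \<Rightarrow> (complex \<Rightarrow> complex) \<Rightarrow> real" where
  "besov_norm X p \<Phi> = enn2real (besov_integral X p \<Phi>) powr (1 / p) + sqrt (enn2real (bmoa_sup X \<Phi>))"

text \<open>
  Functions on the domain are represented by total functions; this relation identifies functions
  whose restrictions to the domain differ by a constant, and thus also disregards the values outside
  the domain.
\<close>

definition diff_const :: "hyp_domain \<Rightarrow> ((complex \<Rightarrow> complex) \<times> (complex \<Rightarrow> complex)) set" where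
  "diff_const X = {(\<Phi>, \<Psi>). \<exists>c. \<forall>z \<in> pts X. \<Phi> z - \<Psi> z = c}"

record 'v complex_normed =
  vectors :: "'v set"
  vadd :: "'v \<Rightarrow> 'v \<Rightarrow> 'v"
  vscale :: "complex \<Rightarrow> 'v \<Rightarrow> 'v"
  vnorm :: "'v \<Rightarrow> real"

definition besov_space :: "hyp_domain \<Rightarrow> real \<Rightarrow> (complex \<Rightarrow> complex) set complex_normed" where
  "besov_space X p =
    \<lparr> vectors = besov_functions X p // diff_const X,
      vadd = (\<lambda>A B. \<Union>\<Phi>\<in>A. \<Union>\<Psi>\<in>B. diff_const X `` {\<lambda>z. \<Phi> z + \<Psi> z}),
      vscale = (\<lambda>c A. \<Union>\<Phi>\<in>A. diff_const X `` {\<lambda>z. c * \<Phi> z}),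
      vnorm = (\<lambda>A. the_elem (besov_norm X p ` A)) \<rparr>"

definition push_forward ::
    "complex set \<Rightarrow> (complex \<Rightarrow> complex) set \<Rightarrow> (complex \<Rightarrow> complex) set" where
  "push_forward H A = (\<Union>\<Phi>\<in>A. diff_const disc_domain `` {\<Phi> \<circ> inv_into H cayley})"

definition bounded_linear_map ::
    "'v complex_normed \<Rightarrow> 'w complex_normed \<Rightarrow> ('v \<Rightarrow> 'w) \<Rightarrow> bool" where
  "bounded_linear_map V W T \<longleftrightarrow>
     T ` vectors V \<subseteq> vectors W \<and>
     (\<forall>x \<in> vectors V. \<forall>y \<in> vectors V. T (vadd V x y) = vadd W (T x) (T y)) \<and>
     (\<forall>c. \<forall>x \<in> vectors V. T (vscale V c x) = vscale W c (T x)) \<and>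
     (\<exists>C. \<forall>x \<in> vectors V. vnorm W (T x) \<le> C * vnorm V x)"

text \<open>
  Isomorphism of normed spaces; between Banach spaces, this is Banach space isomorphism.
\<close>

definition normed_space_iso ::
    "'v complex_normed \<Rightarrow> 'w complex_normed \<Rightarrow> ('v \<Rightarrow> 'w) \<Rightarrow> bool" where
  "normed_space_iso V W T \<longleftrightarrow>
     bounded_linear_map V W T \<and> bij_betw T (vectors V) (vectors W) \<and>
     bounded_linear_map W V (inv_into (vectors V) T)"

end

theory Submission
  imports Defs
begin

text \<open>
  The push-forward is an isomorphism because the two seminorms of a function \<open>\<Phi>\<close> on the half-plane and
  of \<open>\<Psi> = \<Phi> \<circ> K\<inverse>\<close> on the disc control each other, with constants that depend only on \<open>p\<close>. Write
  \<open>z = x + \<i>y\<close>, and take the upper half-plane; the lower one follows by the reflection \<open>z \<mapsto> - z\<close>.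

  The BMOA seminorm measures how the measure \<open>y |\<Phi>'|\<^sup>2 dx dy\<close>, or its analogue on the disc, is
  distributed over Carleson boxes. The map \<open>K\<close> takes \<open>|K'|\<close> times the first measure to the second and does
  not take boxes to boxes, so the box conditions are not invariant. Either of them, however, is equivalent
  to a uniform bound on the integrals of the measure against all Poisson kernels, and these integrals are
  invariant (\<open>poisson_cayley\<close>). Boxes control Poisson integrals by summing over dyadic boxes
  (\<open>halfplane_poisson_le\<close>, \<open>disc_poisson_le\<close>); conversely, the kernel with pole at height \<open>|I|\<close> above the
  centre of \<open>I\<close> is at least a constant times \<open>1 / |I|\<close> on the box over \<open>I\<close> (\<open>halfplane_bmoa_le\<close>,
  \<open>disc_bmoa_le\<close>).

  The Besov seminorm is built from the second derivative, which is not covariant: since \<open>K'' / K' = - 2 / (z + \<i>)\<close>,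
  \<open>(\<Psi>'' \<circ> K) K'\<^sup>2 = \<Phi>'' + 2 \<Phi>' / (z + \<i>)\<close>. The hyperbolic density is covariant, so the \<open>p\<close>-th powers of the
  seminorms are the integrals of \<open>|\<Phi>''|\<^sup>p\<close> and \<open>|\<Phi>'' + 2 \<Phi>' / (z + \<i>)|\<^sup>p\<close> over the half-plane with the weight
  \<open>y\<^bsup>2p-2\<^esup>\<close>, and it remains to bound the integral of \<open>|\<Phi>' / (z + \<i>)|\<^sup>p\<close> by either of them. The bound
  \<open>y |\<Phi>'| \<le> C\<close>, which comes from BMOA, does not suffice: it leaves a logarithmic divergence at infinity.
  Instead, a Hardy inequality is used (\<open>dilation_averages_contract\<close>): if a homothety of ratio \<open>s\<close> multiplies
  heights by at least \<open>s\<close>, then composition with it, multiplied by \<open>s\<^sup>2\<close>, is a contraction of the weighted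
  \<open>L\<^sup>p\<close> space, and so are averages of such operators.

  From the half-plane to the disc (\<open>power_integral_first_order_le\<close>), \<open>\<Phi>'\<close> is, up to its sign, the integral of \<open>\<Phi>''\<close> along
  the ray from \<open>z\<close> to infinity that points away from \<open>- \<i>\<close>, since BMOA forces \<open>\<Phi>'\<close> to vanish at the end of
  this ray. From the disc to the half-plane (\<open>power_integral_first_order_le_disc\<close>), the function
  \<open>(z + \<i>)\<^sup>2 \<Phi>'\<close>, whose derivative is \<open>(z + \<i>)\<^sup>2 (\<Phi>'' + 2 \<Phi>' / (z + \<i>))\<close>, is integrated along the segment from
  \<open>z\<close> towards \<open>\<i>\<close>. The segment is stopped near \<open>\<i>\<close>, where BMOA bounds the function itself; because of this
  boundary term, the bound for the Besov seminorm on the half-plane contains the BMOA seminorm.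
\<close>

section \<open>Holomorphic changes of variables\<close>

lemma nn_integral_eq_iff_has_integral:
  fixes u :: "'a::euclidean_space \<Rightarrow> real"
  assumes "set_borel_measurable borel A u" and "\<And>x. x \<in> A \<Longrightarrow> 0 \<le> u x" and "0 \<le> r"
  shows "(\<integral>\<^sup>+x\<in>A. ennreal (u x) \<partial>lborel) = ennreal r \<longleftrightarrow> (u has_integral r) A"
proof
  assume "(u has_integral r) A"
  then show "(\<integral>\<^sup>+x\<in>A. ennreal (u x) \<partial>lborel) = ennreal r"
    using assms by (intro nn_integral_has_integral_lebesgue') auto
next
  assume r: "(\<integral>\<^sup>+x\<in>A. ennreal (u x) \<partial>lborel) = ennreal r"
  have "(\<integral>\<^sup>+x. ennreal (indicat_real A x *\<^sub>R u x) \<partial>lborel) = ennreal r"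
    unfolding r[symmetric] by (intro nn_integral_cong) (auto simp: indicator_def)
  then have "((\<lambda>x. indicat_real A x *\<^sub>R u x) has_integral r) UNIV"
    using assms by (intro nn_integral_has_integral) (auto simp: set_borel_measurable_def indicator_def)
  moreover have "(\<lambda>x. indicat_real A x *\<^sub>R u x) = (\<lambda>x. if x \<in> A then u x else 0)"
    by (auto simp: indicator_def)
  ultimately show "(u has_integral r) A"
    by (simp add: has_integral_restrict_UNIV)
qed

text \<open>
  Both sides are also equal when they are infinite, because the change of variables for absolutely
  integrable functions is an equivalence: each side takes the finite value \<open>r\<close> exactly when the other does.
\<close>

lemma nn_integral_change_of_variables:
  fixes g :: "real^'m::{finite,wellorder} \<Rightarrow> real^'m::_" and f :: "real^'m::_ \<Rightarrow> real"
  assumes S: "S \<in> sets borel"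
    and der: "\<And>x. x \<in> S \<Longrightarrow> (g has_derivative g' x) (at x within S)"
    and inj: "inj_on g S"
    and f: "set_borel_measurable borel (g ` S) f" "\<And>y. y \<in> g ` S \<Longrightarrow> 0 \<le> f y"
    and fg: "set_borel_measurable borel S (\<lambda>x. \<bar>det (matrix (g' x))\<bar> * f (g x))"
  shows "(\<integral>\<^sup>+y\<in>g ` S. ennreal (f y) \<partial>lborel)
       = (\<integral>\<^sup>+x\<in>S. ennreal (\<bar>det (matrix (g' x))\<bar> * f (g x)) \<partial>lborel)" (is "?L = ?R")
proof -
  let ?u = "\<lambda>x. \<bar>det (matrix (g' x))\<bar> * f (g x)"
  have iff: "(f has_integral r) (g ` S) \<longleftrightarrow> (?u has_integral r) S" for r
  proof -
    have eq1: "((\<lambda>x. vec (f x) :: real^1) absolutely_integrable_on g ` S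
        \<and> integral (g ` S) (\<lambda>x. vec (f x) :: real^1) = vec r)
           \<longleftrightarrow> (f has_integral r) (g ` S)"
      using f unfolding absolutely_integrable_on_1_iff integral_on_1_eq 
      by (auto simp: has_integral_iff absolutely_integrable_on_iff_nonneg vec_eq_iff)
    have *: "(\<lambda>x. \<bar>det (matrix (g' x))\<bar> *\<^sub>R (vec (f (g x)) :: real^1)) = (\<lambda>x. vec (?u x))"
      by (auto simp: vec_eq_iff)
    have nonneg: "0 \<le> ?u x" if "x \<in> S" for x
      using f(2)[of "g x"] that by simp
    have eq2: "((\<lambda>x. \<bar>det (matrix (g' x))\<bar> *\<^sub>R (vec (f (g x)) :: real^1)) absolutely_integrable_on S \<and>
        integral S (\<lambda>x. \<bar>det (matrix (g' x))\<bar> *\<^sub>R (vec (f (g x)) :: real^1)) = vec r) \<longleftrightarrow> (?u has_integral r) S"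
      unfolding * unfolding absolutely_integrable_on_1_iff integral_on_1_eq 
      using absolutely_integrable_on_iff_nonneg[of S ?u] nonneg
      by (auto simp: has_integral_iff vec_eq_iff)
    \<comment> \<open>real functions are regarded as functions with values in the one-dimensional space\<close>
    show ?thesis
      using has_absolute_integral_change_of_variables[OF _ der inj, of "\<lambda>x. vec (f x) :: real^1" "vec r"] S
      unfolding eq1 eq2 by auto
  qed
  have eqiff: "?L = ennreal r \<longleftrightarrow> ?R = ennreal r" if "0 \<le> r" for r
  proof -
    have "?L = ennreal r \<longleftrightarrow> (f has_integral r) (g ` S)"
      by (rule nn_integral_eq_iff_has_integral[OF f that])
    moreover have "?R = ennreal r \<longleftrightarrow> (?u has_integral r) S"
      using f(2) by (intro nn_integral_eq_iff_has_integral[OF fg _ that]) simp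
    ultimately show ?thesis using iff by simp
  qed
  show ?thesis
  proof (cases ?L rule: ennreal_cases)
    case (real r)
    show ?thesis
      unfolding real(2) by (rule eqiff[THEN iffD1, OF real(1) real(2), symmetric])
  next
    case top
    show ?thesis
    proof (cases ?R rule: ennreal_cases)
      case (real r)
      show ?thesis
        unfolding real(2) by (rule eqiff[THEN iffD2, OF real(1) real(2)])
    next
      case t: top
      show ?thesis unfolding top t ..
    qed
  qed
qed

text \<open>
  The isometry between the coordinate plane and the complex numbers carries the substitution rule, whose
  Jacobian is a determinant, over to holomorphic maps.
\<close>

definition plane :: "real^2 \<Rightarrow> complex" where "plane v = Complex (v $ 1) (v $ 2)"
definition coords :: "complex \<Rightarrow> real^2" where "coords z = (\<chi> i. if i = 1 then Re z else Im z)"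

lemma plane_coords [simp]: "plane (coords z) = z" "coords (plane v) = v"
  by (auto simp: plane_def coords_def vec_eq_iff forall_2)

lemma plane_coords_linear: "bounded_linear plane" "bounded_linear coords"
  by (auto simp: plane_def coords_def vec_eq_iff complex_eq_iff forall_2 linear_conv_bounded_linear[symmetric]
    intro!: linearI)

lemma plane_measurable [measurable]: "plane \<in> borel_measurable borel" "coords \<in> borel_measurable borel"
  using plane_coords_linear by (auto intro!: borel_measurable_continuous_onI linear_continuous_on)

lemma lborel_plane: "distr lborel borel plane = lborel"
proof (rule lborel_eqI[symmetric])
  fix l u :: complex assume lu: "\<And>b. b \<in> Basis \<Longrightarrow> l \<bullet> b \<le> u \<bullet> b"
  have "plane -` Topology_Euclidean_Space.box l u = Topology_Euclidean_Space.box (coords l) (coords u)"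
    by (simp add: plane_def coords_def Topology_Euclidean_Space.box_def Basis_complex_def Basis_vec_def
        UNIV_2 inner_axis vimage_def conj_ac)
  then have "emeasure (distr lborel borel plane) (Topology_Euclidean_Space.box l u)
      = emeasure lborel (Topology_Euclidean_Space.box (coords l) (coords u))"
    by (subst emeasure_distr) auto
  also have "\<dots> = ennreal (\<Prod>b\<in>Basis. (coords u - coords l) \<bullet> b)"
    using lu[of 1] lu[of \<i>] by (intro emeasure_lborel_box)
      (auto simp: coords_def Basis_complex_def Basis_vec_def inner_axis UNIV_2)
  also have "(\<Prod>b\<in>Basis. (coords u - coords l) \<bullet> b) = (\<Prod>b\<in>Basis. (u - l) \<bullet> b)"
  proof -
    have "(Basis :: (real^2) set) = {axis 1 1, axis 2 1}"
      by (simp add: Basis_vec_def UNIV_2 insert_commute)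
    show ?thesis
      unfolding \<open>(Basis :: (real^2) set) = _\<close>
      by (simp add: Basis_complex_def coords_def inner_axis axis_eq_axis)
  qed
  finally show "emeasure (distr lborel borel plane) (Topology_Euclidean_Space.box l u)
      = (\<Prod>b\<in>Basis. (u - l) \<bullet> b)" .
qed simp

lemma nn_integral_plane:
  assumes "f \<in> borel_measurable borel"
  shows "(\<integral>\<^sup>+z. f z \<partial>lborel) = (\<integral>\<^sup>+v. f (plane v) \<partial>lborel)"
  using assms by (subst lborel_plane[symmetric]) (simp add: nn_integral_distr)

text \<open>
  The Cauchy--Riemann equations in the form that the substitution rule needs: as a real linear map of the
  plane, multiplication by \<open>a\<close> has determinant \<open>|a|\<^sup>2\<close>.
\<close>

lemma det_complex_mult: "det (matrix (coords \<circ> (*) a \<circ> plane)) = (norm a)\<^sup>2"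
  by (simp add: det_2 matrix_def coords_def plane_def axis_def cmod_power2 flip: power2_eq_square)

lemma nn_integral_holomorphic_substitution:
  fixes g :: "complex \<Rightarrow> complex" and f :: "complex \<Rightarrow> real"
  assumes S: "open S" and g: "g holomorphic_on S" and inj: "inj_on g S"
    and f: "set_borel_measurable borel (g ` S) f" "\<And>w. w \<in> g ` S \<Longrightarrow> 0 \<le> f w"
  shows "(\<integral>\<^sup>+w\<in>g ` S. ennreal (f w) \<partial>lborel)
       = (\<integral>\<^sup>+z\<in>S. ennreal (f (g z) * (norm (deriv g z))\<^sup>2) \<partial>lborel)"
proof -
  let ?h = "\<lambda>z. f (g z) * (norm (deriv g z))\<^sup>2"
  let ?S = "coords ` S" and ?g = "coords \<circ> g \<circ> plane"
  let ?g' = "\<lambda>v. coords \<circ> (*) (deriv g (plane v)) \<circ> plane"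
  have S': "?S = plane -` S"
  proof (intro set_eqI iffI)
    fix v assume "v \<in> plane -` S"
    then show "v \<in> ?S" by (metis image_eqI plane_coords(2) vimageE)
  qed auto
  have gS: "?g ` ?S = plane -` (g ` S)"
  proof (intro set_eqI iffI)
    fix v assume "v \<in> plane -` (g ` S)"
    then obtain z where z: "z \<in> S" "plane v = g z" by auto
    then have "?g (coords z) = v" by (simp flip: z(2))
    then show "v \<in> ?g ` ?S" using z(1) by (metis imageI)
  qed auto
  have opS: "open ?S"
    unfolding S' using S plane_coords_linear(1)
    by (intro continuous_open_vimage) (auto intro: linear_continuous_on continuous_on_subset linear_continuous_at)
  have ogS: "open (g ` S)"
    using open_mapping_thm3[OF g S inj] .
  have fb: "(\<lambda>w. indicat_real (g ` S) w * f w) \<in> borel_measurable borel"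
    using f(1) by (simp add: set_borel_measurable_def)
  have gb: "(\<lambda>z. if z \<in> S then g z else 0) \<in> borel_measurable borel"
    using g S by (intro borel_measurable_continuous_on_if) (auto intro: holomorphic_on_imp_continuous_on)
  have db: "(\<lambda>z. if z \<in> S then deriv g z else 0) \<in> borel_measurable borel"
    using holomorphic_deriv[OF g S] S
        by (intro borel_measurable_continuous_on_if) (auto intro: holomorphic_on_imp_continuous_on)
  have fgb: "(\<lambda>z. indicat_real S z * ?h z) \<in> borel_measurable borel"
  proof -
    have "(\<lambda>z. indicat_real S z * ?h z)
      = (\<lambda>z. indicat_real S z * (indicat_real (g ` S) (if z \<in> S then g z else 0)
          * f (if z \<in> S then g z else 0))
             * (norm (if z \<in> S then deriv g z else 0))\<^sup>2)"
      by (auto simp: indicator_def)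
    also have "\<dots> \<in> borel_measurable borel"
      using measurable_compose[OF gb fb] db S
      by (intro borel_measurable_times[OF borel_measurable_times] borel_measurable_power
          borel_measurable_indicator borel_measurable_norm) auto
    finally show ?thesis .
  qed
  have "(\<integral>\<^sup>+w\<in>g ` S. ennreal (f w) \<partial>lborel) = (\<integral>\<^sup>+w. ennreal (indicat_real (g ` S) w * f w) \<partial>lborel)"
    by (intro nn_integral_cong) (auto simp: indicator_def)
  also have "\<dots> = (\<integral>\<^sup>+v. ennreal (indicat_real (g ` S) (plane v) * f (plane v)) \<partial>lborel)"
    using fb by (intro nn_integral_plane) auto
  also have "\<dots> = (\<integral>\<^sup>+v\<in>?g ` ?S. ennreal (f (plane v)) \<partial>lborel)"
    unfolding gS by (intro nn_integral_cong) (auto simp: indicator_def)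
  also have "\<dots> = (\<integral>\<^sup>+v\<in>?S. ennreal (\<bar>det (matrix (?g' v))\<bar> * f (plane (?g v))) \<partial>lborel)"
  proof (rule nn_integral_change_of_variables)
    show "?S \<in> sets borel" using opS by simp
    fix v assume v: "v \<in> ?S"
    then have "(g has_derivative (*) (deriv g (plane v))) (at (plane v))"
      using g S holomorphic_derivI[OF g S, of "plane v"] by (auto simp: has_field_derivative_def)
    from diff_chain_at[OF bounded_linear_imp_has_derivative[OF plane_coords_linear(1)] this]
    have "(g \<circ> plane has_derivative (*) (deriv g (plane v)) \<circ> plane) (at v)" .
    from diff_chain_at[OF this bounded_linear_imp_has_derivative[OF plane_coords_linear(2)]]
    show "(?g has_derivative ?g' v) (at v within ?S)"
      by (simp add: comp_assoc has_derivative_at_withinI)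
  next
    show "inj_on ?g ?S"
    proof (rule inj_onI)
      fix v w assume "v \<in> ?S" "w \<in> ?S" and eq: "?g v = ?g w"
      then have "plane v \<in> S" "plane w \<in> S" by auto
      moreover have "g (plane v) = g (plane w)"
        using arg_cong[OF eq, of plane] by simp
      ultimately have "plane v = plane w" using inj by (simp add: inj_on_def)
      then show "v = w" by (metis plane_coords(2))
    qed
  next
    have "(\<lambda>v. indicat_real (g ` S) (plane v) * f (plane v)) \<in> borel_measurable borel"
      using measurable_compose[OF plane_measurable(1) fb] .
    moreover have "(\<lambda>v. indicat_real (g ` S) (plane v) * f (plane v))
        = (\<lambda>v. indicat_real (?g ` ?S) v *\<^sub>R f (plane v))"
      unfolding gS by (auto simp: indicator_def)
    ultimately show "set_borel_measurable borel (?g ` ?S) (\<lambda>v. f (plane v))"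
      unfolding set_borel_measurable_def by simp
  next
    have "(\<lambda>v. indicat_real S (plane v) * ?h (plane v)) \<in> borel_measurable borel"
      using measurable_compose[OF plane_measurable(1) fgb] .
    moreover have "(\<lambda>v. indicat_real S (plane v) * ?h (plane v))
       = (\<lambda>v. indicat_real ?S v *\<^sub>R (\<bar>det (matrix (?g' v))\<bar> * f (plane (?g v))))"
      unfolding S' det_complex_mult by (auto simp: indicator_def)
    ultimately show "set_borel_measurable borel ?S (\<lambda>v. \<bar>det (matrix (?g' v))\<bar> * f (plane (?g v)))"
      unfolding set_borel_measurable_def by simp
  next
    fix v assume "v \<in> ?g ` ?S"
    then show "0 \<le> f (plane v)"
      unfolding gS by (intro f(2)) simp
  qed
  also have "\<dots> = (\<integral>\<^sup>+v. ennreal (indicat_real S (plane v) * ?h (plane v)) \<partial>lborel)"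
    unfolding S' det_complex_mult by (intro nn_integral_cong) (simp add: indicator_def mult.commute)
  also have "\<dots> = (\<integral>\<^sup>+z. ennreal (indicat_real S z * ?h z) \<partial>lborel)"
    by (rule nn_integral_plane[of "\<lambda>z. ennreal (indicat_real S z * ?h z)", symmetric])
      (use fgb in simp)
  also have "\<dots> = (\<integral>\<^sup>+z\<in>S. ennreal (?h z) \<partial>lborel)"
    by (intro nn_integral_cong) (auto simp: indicator_def)
  finally show ?thesis .
qed

section \<open>The area mean value inequality\<close>

lemma circle_mean_value:
  fixes g :: "complex \<Rightarrow> complex"
  assumes "g holomorphic_on S" "open S" "cball 0 1 \<subseteq> S"
  shows "ennreal (norm (g 0)) \<le> (\<integral>\<^sup>+t\<in>{0..1}. ennreal (norm (g (cis (2 * pi * t)))) \<partial>lborel)"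
proof -
  have cont: "continuous_on (cball 0 1) g"
    using assms by (meson continuous_on_subset holomorphic_on_imp_continuous_on)
  have "((\<lambda>u. g u / (u - 0)) has_contour_integral (2 * of_real pi * \<i> * g 0)) (circlepath 0 1)"
  proof (rule Cauchy_integral_circlepath)
    show "g holomorphic_on ball 0 1"
      using assms ball_subset_cball by (meson holomorphic_on_subset)
  qed (use cont in auto)
  then have "((\<lambda>t. g (circlepath 0 1 t) / circlepath 0 1 t *
      (2 * of_real pi * \<i> * exp (2 * of_real pi * \<i> * of_real t))) has_integral (2 * of_real pi * \<i>
          * g 0)) {0..1}"
    by (simp add: has_contour_integral vector_derivative_circlepath01 vector_derivative_circlepath cong: has_integral_cong)
  moreover have cp: "circlepath 0 1 t = cis (2 * pi * t)" "exp (2 * of_real pi * \<i> * of_real t)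
      = cis (2 * pi * t)" for t
    by (simp_all add: circlepath cis_conv_exp mult_ac)
  ultimately have "((\<lambda>t. (2 * of_real pi * \<i>) * g (cis (2 * pi * t))) has_integral (2 * of_real pi * \<i>)
      * g 0) {0..1}"
    by (simp add: mult_ac)
  from has_integral_mult_right[OF this, of "1 / (2 * of_real pi * \<i>)"]
  have I: "((\<lambda>t. g (cis (2 * pi * t))) has_integral g 0) {0..1}"
    by simp
  have contt: "continuous_on {0..1} (\<lambda>t::real. norm (g (cis (2 * pi * t))))"
    by (intro continuous_intros continuous_on_compose2[OF cont]) auto
  then have N: "(\<lambda>t::real. norm (g (cis (2 * pi * t)))) integrable_on {0..1}"
    by (rule integrable_continuous_real)
  have "norm (g 0) \<le> integral {0..1} (\<lambda>t. norm (g (cis (2 * pi * t))))"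
    using I N integral_norm_bound_integral[of "\<lambda>t. g (cis (2 * pi * t))" "{0..1}"]
    by (metis has_integral_iff order_refl)
  also have "ennreal \<dots> = (\<integral>\<^sup>+t\<in>{0..1}. ennreal (norm (g (cis (2 * pi * t)))) \<partial>lborel)"
    using nn_integral_has_integral_lebesgue'[OF _ integrable_integral[OF N]] by simp
  finally show ?thesis by (simp add: ennreal_leI)
qed

text \<open>
  Lebesgue measure on the ball does not change if \<open>w\<close> is replaced by \<open>e\<^bsup>\<i>t\<^esup> w\<close>. Averaging over \<open>t\<close> and
  exchanging the integrals reduces the inequality to the mean value over circles, applied to \<open>f\<^sup>2\<close>.
\<close>

lemma area_mean_value:
  fixes f :: "complex \<Rightarrow> complex"
  assumes f: "f holomorphic_on ball c r" and r: "0 < r"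
  shows "ennreal (pi * r\<^sup>2 * (norm (f c))\<^sup>2) \<le> (\<integral>\<^sup>+z\<in>ball c r. ennreal ((norm (f z))\<^sup>2) \<partial>lborel)"
proof -
  \<comment> \<open>extension by zero, which makes the integrand measurable on the whole plane\<close>
  define k where "k z = (if z \<in> ball c r then f z else 0)" for z
  have k [measurable]: "k \<in> borel_measurable borel"
    unfolding k_def using f
    by (intro borel_measurable_continuous_on_if) (auto intro: holomorphic_on_imp_continuous_on)
  have [measurable]: "ball (0::complex) r \<in> sets borel" by simp
  have cis [measurable]: "(\<lambda>t::real. cis (2 * pi * t)) \<in> borel_measurable borel"
    by (intro borel_measurable_continuous_onI continuous_intros)
  have mv: "ennreal ((norm (f c))\<^sup>2) \<le> (\<integral>\<^sup>+t\<in>{0..1}. ennreal ((norm (k (c + cis (2 * pi * t) * w)))\<^sup>2)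
      \<partial>lborel)"
    if w: "w \<in> ball 0 r" for w
  proof -
    let ?S = "(\<lambda>u. c + u * w) -` ball c r"
    have "(\<lambda>u. (f (c + u * w))\<^sup>2) holomorphic_on ?S"
      by (intro holomorphic_intros holomorphic_on_compose_gen[OF _ f, of "\<lambda>u. c + u
          * w", unfolded o_def]) auto
    moreover have "open ?S"
      by (intro continuous_open_vimage continuous_intros) auto
    moreover have "cball 0 1 \<subseteq> ?S"
    proof
      fix u :: complex assume "u \<in> cball 0 1"
      then have "norm u * norm w < r"
        using w mult_left_le_one_le[of "norm w" "norm u"] by auto
      then show "u \<in> ?S" by (simp add: dist_norm norm_mult)
    qed
    ultimately have "ennreal ((norm (f c))\<^sup>2)
        \<le> (\<integral>\<^sup>+t\<in>{0..1}. ennreal ((norm (f (c + cis (2 * pi * t) * w)))\<^sup>2) \<partial>lborel)"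
      using circle_mean_value[of "\<lambda>u. (f (c + u * w))\<^sup>2" ?S] by (simp add: norm_power)
    also have "\<dots> = (\<integral>\<^sup>+t\<in>{0..1}. ennreal ((norm (k (c + cis (2 * pi * t) * w)))\<^sup>2) \<partial>lborel)"
      using w by (intro nn_integral_cong) (simp add: k_def dist_norm norm_mult)
    finally show ?thesis .
  qed
  have rot: "(\<integral>\<^sup>+w\<in>ball 0 r. ennreal ((norm (k (c + cis (2 * pi * t) * w)))\<^sup>2) \<partial>lborel)
      = (\<integral>\<^sup>+z\<in>ball c r. ennreal ((norm (f z))\<^sup>2) \<partial>lborel)" for t
  proof -
    let ?g = "\<lambda>w. c + cis (2 * pi * t) * w"
    have im: "?g ` ball 0 r = ball c r"
    proof (intro set_eqI iffI)
      fix z assume "z \<in> ball c r"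
      then have "z = ?g (cis (- (2 * pi * t)) * (z - c))" "cis (- (2 * pi * t)) * (z - c) \<in> ball 0 r"
        by (simp_all add: mult.assoc[symmetric] cis_mult dist_norm norm_mult norm_minus_commute)
      then show "z \<in> ?g ` ball 0 r" by (rule image_eqI)
    qed (auto simp: dist_norm norm_mult)
    have deriv: "deriv ?g w = cis (2 * pi * t)" for w
      by (intro DERIV_imp_deriv) (auto intro!: derivative_eq_intros)
    have "(\<integral>\<^sup>+z\<in>?g ` ball 0 r. ennreal ((norm (k z))\<^sup>2) \<partial>lborel) =
        (\<integral>\<^sup>+w\<in>ball 0 r. ennreal ((norm (k (?g w)))\<^sup>2 * (norm (deriv ?g w))\<^sup>2) \<partial>lborel)"
    proof (rule nn_integral_holomorphic_substitution)
      show "inj_on ?g (ball 0 r)" by (auto intro!: inj_onI)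
      show "set_borel_measurable borel (?g ` ball 0 r) (\<lambda>z. (norm (k z))\<^sup>2)"
        unfolding im set_borel_measurable_def real_scaleR_def
        by (intro borel_measurable_times borel_measurable_indicator borel_measurable_power borel_measurable_norm k) auto
    qed (auto intro!: holomorphic_intros)
    also have "\<dots> = (\<integral>\<^sup>+w\<in>ball 0 r. ennreal ((norm (k (?g w)))\<^sup>2) \<partial>lborel)"
      unfolding deriv by simp
    finally have "(\<integral>\<^sup>+w\<in>ball 0 r. ennreal ((norm (k (?g w)))\<^sup>2) \<partial>lborel)
      = (\<integral>\<^sup>+z\<in>ball c r. ennreal ((norm (k z))\<^sup>2) \<partial>lborel)"
      unfolding im ..
    also have "\<dots> = (\<integral>\<^sup>+z\<in>ball c r. ennreal ((norm (f z))\<^sup>2) \<partial>lborel)"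
      by (intro nn_integral_cong) (simp add: k_def indicator_def)
    finally show ?thesis .
  qed
  have "ennreal (pi * r\<^sup>2 * (norm (f c))\<^sup>2) = (\<integral>\<^sup>+w\<in>ball (0::complex) r. ennreal ((norm (f c))\<^sup>2) \<partial>lborel)"
    using r by (subst nn_integral_cmult_indicator)
      (simp_all add: emeasure_ball unit_ball_vol_2 mult.commute flip: ennreal_mult)
  also have "\<dots> \<le> (\<integral>\<^sup>+w\<in>ball 0 r. (\<integral>\<^sup>+t\<in>{0..1}. ennreal ((norm (k (c + cis (2 * pi * t) * w)))\<^sup>2) \<partial>lborel)
      \<partial>lborel)"
    using mv by (intro nn_integral_mono) (simp add: indicator_def)
  also have "\<dots> = (\<integral>\<^sup>+w. (\<integral>\<^sup>+t. ennreal ((norm (k (c + cis (2 * pi * t) * w)))\<^sup>2) * indicator {0..1} t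
      * indicator (ball 0 r) w \<partial>lborel) \<partial>lborel)"
    by (intro nn_integral_cong nn_integral_multc[symmetric]) measurable
  also have "\<dots> = (\<integral>\<^sup>+t. (\<integral>\<^sup>+w. ennreal ((norm (k (c + cis (2 * pi * t) * w)))\<^sup>2) * indicator {0..1} t
      * indicator (ball 0 r) w \<partial>lborel) \<partial>lborel)"
    by (intro lborel_pair.Fubini') measurable
  also have "\<dots> = (\<integral>\<^sup>+t\<in>{0..1}. (\<integral>\<^sup>+w\<in>ball 0 r. ennreal ((norm (k (c + cis (2 * pi * t) * w)))\<^sup>2) \<partial>lborel)
      \<partial>(lborel :: real measure))"
    by (subst nn_integral_multc[symmetric], measurable, intro nn_integral_cong) (simp add: mult_ac)
  also have "\<dots> = (\<integral>\<^sup>+z\<in>ball c r. ennreal ((norm (f z))\<^sup>2) \<partial>lborel)"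
    unfolding rot by (simp add: nn_integral_cmult_indicator)
  finally show ?thesis .
qed

section \<open>Jensen's inequality, dyadic shells and the Hardy inequality\<close>

text \<open>
  The graph of the convex function \<open>t \<mapsto> t\<^sup>p\<close> lies above its tangent at \<open>c\<close>.
\<close>

lemma powr_tangent_line:
  fixes p c t :: real
  assumes "1 \<le> p" "0 < c" "0 \<le> t"
  shows "p * c powr (p - 1) * t \<le> t powr p + (p - 1) * c powr p"
proof (cases "p = 1")
  case False
  then have p: "1 < p" using assms by simp
  have "t * c powr (p - 1) \<le> t powr p / p + (c powr (p - 1)) powr (p / (p - 1)) / (p / (p - 1))"
    using p assms by (intro Youngs_inequality) (auto simp: field_simps)
  also have "(c powr (p - 1)) powr (p / (p - 1)) = c powr p"
    using p by (simp add: powr_powr)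
  finally show ?thesis using p by (simp add: field_simps)
qed (use assms in auto)

text \<open>
  Jensen's inequality for a power, obtained by integrating the tangent line at \<open>c\<close>. A lower bound \<open>c\<close> in the
  place of the mean lets the statement cover functions of infinite mean.
\<close>

lemma nn_integral_Jensen_powr:
  fixes f :: "'a \<Rightarrow> real" and p c :: real
  assumes M: "emeasure M (space M) = 1" and f [measurable]: "f \<in> borel_measurable M"
    and nonneg: "AE x in M. 0 \<le> f x" and p: "1 \<le> p"
    and c: "0 \<le> c" "ennreal c \<le> (\<integral>\<^sup>+x. ennreal (f x) \<partial>M)"
  shows "ennreal (c powr p) \<le> (\<integral>\<^sup>+x. ennreal (f x powr p) \<partial>M)" (is "_ \<le> ?I")
proof (cases "c = 0")
  case False
  then have c0: "0 < c" using c by simp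
  have "ennreal (p * c powr p) = ennreal (p * c powr (p - 1)) * ennreal c"
    using p c0 by (simp add: powr_mult_base mult.assoc flip: ennreal_mult) (simp add: mult.commute powr_mult_base)
  also have "\<dots> \<le> ennreal (p * c powr (p - 1)) * (\<integral>\<^sup>+x. ennreal (f x) \<partial>M)"
    using c by (intro mult_left_mono) auto
  also have "\<dots> = (\<integral>\<^sup>+x. ennreal (p * c powr (p - 1)) * ennreal (f x) \<partial>M)"
    by (rule nn_integral_cmult[symmetric]) measurable
  also have "\<dots> \<le> (\<integral>\<^sup>+x. ennreal (f x powr p) + ennreal ((p - 1) * c powr p) \<partial>M)"
  proof (intro nn_integral_mono_AE AE_mp[OF nonneg AE_I2] impI)
    fix x assume "0 \<le> f x"
    then show "ennreal (p * c powr (p - 1)) * ennreal (f x)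
        \<le> ennreal (f x powr p) + ennreal ((p - 1) * c powr p)"
      using powr_tangent_line[OF p c0, of "f x"] p
      by (simp flip: ennreal_mult ennreal_plus add: ennreal_leI)
  qed
  also have "\<dots> = ?I + ennreal ((p - 1) * c powr p)"
    using M by (subst nn_integral_add) auto
  finally have *: "ennreal (p * c powr p) \<le> ?I + ennreal ((p - 1) * c powr p)" .
  show ?thesis
  proof (cases ?I rule: ennreal_cases)
    case (real r)
    have "ennreal (p * c powr p) \<le> ennreal (r + (p - 1) * c powr p)"
      using * p real by (subst ennreal_plus) auto
    then have "p * c powr p \<le> r + (p - 1) * c powr p"
      using real p by (subst (asm) ennreal_le_iff) auto
    then have "c powr p \<le> r" by (simp add: algebra_simps)
    then show ?thesis using real by (simp add: ennreal_leI)
  qed simp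
qed auto

lemma ex_dyadic_shell:
  fixes x :: real
  assumes "1 \<le> x"
  obtains k :: nat where "2 ^ k \<le> x" "x < 2 ^ (k + 1)"
proof -
  define n where "n = (LEAST n. x < 2 ^ n)"
  have ex: "\<exists>n. x < 2 ^ n" by (simp add: real_arch_pow)
  then have n: "x < 2 ^ n" unfolding n_def by (rule LeastI_ex)
  then obtain k where k: "n = Suc k" using assms by (cases n) auto
  have "\<not> x < 2 ^ k" using not_less_Least[of k "\<lambda>n. x < 2 ^ n"] k n_def by simp
  then show thesis using that[of k] n k by simp
qed

text \<open>
  Cut the domain into the shells \<open>2\<^sup>k \<le> q < 2\<^bsup>k+1\<^esup>\<close>. If the bound \<open>C k\<close> of the kernel on a shell times
  the mass of the sublevel set decays like \<open>2\<^bsup>-k\<^esup>\<close>, the shells sum to twice the first bound.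
\<close>

lemma nn_integral_dyadic_shells:
  fixes q :: "'a \<Rightarrow> real" and w \<kappa> :: "'a \<Rightarrow> ennreal"
  assumes [measurable]: "q \<in> borel_measurable M" "w \<in> borel_measurable M"
    and q: "\<And>x. x \<in> space M \<Longrightarrow> w x \<noteq> 0 \<Longrightarrow> 1 \<le> q x"
    and \<kappa>: "\<And>x k. x \<in> space M \<Longrightarrow> w x \<noteq> 0 \<Longrightarrow> 2 ^ k \<le> q x \<Longrightarrow> \<kappa> x \<le> C k"
    and B: "\<And>k. C k * (\<integral>\<^sup>+x. w x * indicator {x \<in> space M. q x < 2 ^ (k + 1)} x \<partial>M)
        \<le> B * ennreal ((1 / 2) ^ k)"
  shows "(\<integral>\<^sup>+x. \<kappa> x * w x \<partial>M) \<le> B * 2"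
proof -
  let ?f = "\<lambda>k x. C k * (w x * indicator {x \<in> space M. q x < 2 ^ (k + 1)} x)"
  have "(\<integral>\<^sup>+x. \<kappa> x * w x \<partial>M) \<le> (\<integral>\<^sup>+x. (\<Sum>k. ?f k x) \<partial>M)"
  proof (rule nn_integral_mono)
    fix x assume x: "x \<in> space M"
    show "\<kappa> x * w x \<le> (\<Sum>k. ?f k x)"
    proof (cases "w x = 0")
      case False
      obtain k where k: "2 ^ k \<le> q x" "q x < 2 ^ (k + 1)"
        using ex_dyadic_shell q[OF x False] by blast
      have "\<kappa> x * w x \<le> ?f k x"
        using \<kappa>[OF x False k(1)] k(2) x by (simp add: mult_right_mono)
      also have "\<dots> = (\<Sum>k\<in>{k}. ?f k x)" by simp
      also have "\<dots> \<le> (\<Sum>k. ?f k x)" by (rule sum_le_suminf) auto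
      finally show ?thesis .
    qed simp
  qed
  also have "\<dots> = (\<Sum>k. \<integral>\<^sup>+x. ?f k x \<partial>M)"
    by (rule nn_integral_suminf) measurable
  also have "\<dots> = (\<Sum>k. C k * (\<integral>\<^sup>+x. w x * indicator {x \<in> space M. q x < 2 ^ (k + 1)} x \<partial>M))"
    by (intro suminf_cong nn_integral_cmult) measurable
  also have "\<dots> \<le> (\<Sum>k. B * ennreal ((1 / 2) ^ k))"
    using B by (intro suminf_le) auto
  also have "\<dots> = B * (\<Sum>k. ennreal ((1 / 2) ^ k))"
    by (rule ennreal_suminf_cmult)
  also have "(\<Sum>k. ennreal ((1 / 2) ^ k)) = 2"
  proof -
    have "(\<Sum>k. ennreal ((1 / 2) ^ k)) = ennreal (\<Sum>k. (1 / 2) ^ k)"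
      by (rule suminf_ennreal2) (auto intro: summable_geometric)
    also have "(\<Sum>k. (1 / 2 :: real) ^ k) = 2"
      using suminf_geometric[of "1 / 2 :: real"] by simp
    finally show ?thesis by simp
  qed
  finally show ?thesis .
qed

text \<open>
  The case of a kernel that decays like \<open>q\<^bsup>-2\<^esup>\<close> against a measure whose sublevel sets have linear growth, as
  the Poisson kernel against a Carleson measure.
\<close>

lemma nn_integral_inverse_square_kernel:
  fixes q :: "'a \<Rightarrow> real" and w \<kappa> :: "'a \<Rightarrow> ennreal" and \<delta> l :: real
  assumes [measurable]: "q \<in> borel_measurable M" "w \<in> borel_measurable M"
    and q: "\<And>x. x \<in> space M \<Longrightarrow> w x \<noteq> 0 \<Longrightarrow> 1 \<le> q x"
    and \<kappa>: "\<And>x. x \<in> space M \<Longrightarrow> w x \<noteq> 0 \<Longrightarrow> \<kappa> x \<le> ennreal (1 / (\<delta> * (q x)\<^sup>2))"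
    and \<delta>: "0 < \<delta>" "0 \<le> l"
    and mass: "\<And>k. (\<integral>\<^sup>+x. w x * indicator {x \<in> space M. q x < 2 ^ (k + 1)} x \<partial>M) \<le> ennreal (l * 2 ^ k) * S"
  shows "(\<integral>\<^sup>+x. \<kappa> x * w x \<partial>M) \<le> ennreal (2 * l / \<delta>) * S"
proof -
  have "(\<integral>\<^sup>+x. \<kappa> x * w x \<partial>M) \<le> (ennreal (l / \<delta>) * S) * 2"
  proof (rule nn_integral_dyadic_shells[where q = q and C = "\<lambda>k. ennreal ((1 / 4) ^ k / \<delta>)"])
    fix x k assume x: "x \<in> space M" "w x \<noteq> 0" and "2 ^ k \<le> q x"
    then have "(2 ^ k)\<^sup>2 \<le> (q x)\<^sup>2" by (intro power_mono) auto
    moreover have "(2 ^ k)\<^sup>2 = (4 :: real) ^ k" by (simp add: power2_eq_square flip: power_mult_distrib)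
    ultimately have "1 / (\<delta> * (q x)\<^sup>2) \<le> 1 / (\<delta> * 4 ^ k)" using \<delta> by (intro frac_le mult_left_mono) auto
    also have "\<dots> = (1 / 4) ^ k / \<delta>" by (simp add: power_one_over)
    finally show "\<kappa> x \<le> ennreal ((1 / 4) ^ k / \<delta>)"
      using \<kappa>[OF x] ennreal_leI order_trans by blast
  next
    fix k :: nat
    have "ennreal ((1 / 4) ^ k / \<delta>) * (\<integral>\<^sup>+x. w x * indicator {x \<in> space M. q x < 2 ^ (k + 1)} x \<partial>M)
      \<le> ennreal ((1 / 4) ^ k / \<delta>) * (ennreal (l * 2 ^ k) * S)"
      by (rule mult_left_mono[OF mass]) simp
    also have "\<dots> = ennreal (l / \<delta> * (1 / 2) ^ k) * S"
    proof -
      have "(1 / 4) ^ k * 2 ^ k = (1 / 2 :: real) ^ k" by (simp flip: power_mult_distrib)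
      then have eq: "(1 / 4) ^ k / \<delta> * (l * 2 ^ k) = l / \<delta> * (1 / 2) ^ k" by (simp add: mult_ac)
      have "ennreal x * (ennreal y * S) = ennreal (x * y) * S" if "0 \<le> x" "0 \<le> y" for x y
        using that by (simp add: ennreal_mult mult.assoc)
      then show ?thesis unfolding eq[symmetric] using \<delta> by simp
    qed
    also have "\<dots> = ennreal (l / \<delta>) * S * ennreal ((1 / 2) ^ k)"
      using \<delta> by (subst ennreal_mult) (auto simp: mult_ac)
    finally show "ennreal ((1 / 4) ^ k / \<delta>) * (\<integral>\<^sup>+x. w x * indicator {x \<in> space M. q x < 2 ^ (k + 1)} x \<partial>M)
      \<le> ennreal (l / \<delta>) * S * ennreal ((1 / 2) ^ k)" .
  qed (use q in auto)
  also have "\<dots> = ennreal (2 * l / \<delta>) * S"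
  proof -
    have "ennreal (2 * l / \<delta>) = 2 * ennreal (l / \<delta>)" using \<delta> by (simp flip: ennreal_numeral ennreal_mult)
    then show ?thesis by (simp only: mult_ac)
  qed
  finally show ?thesis .
qed

lemma Im_dilation_pos:
  assumes "0 < s" "0 \<le> (1 - s) * Im c" "0 < Im z"
  shows "0 < Im (c + of_real s * (z - c))"
proof -
  have "0 < s * Im z" using assms by simp
  moreover have "Im (c + of_real s * (z - c)) = s * Im z + (1 - s) * Im c" by (simp add: algebra_simps)
  ultimately show ?thesis using assms(2) by linarith
qed

text \<open>
  This is a Hardy inequality. By Jensen and Tonelli it is enough to treat one homothety
  \<open>T\<^sub>s z = c + s (z - c)\<close>. The sign condition says that \<open>Im (T\<^sub>s z) \<ge> s Im z\<close>, so
  \<open>y\<^bsup>2p-2\<^esup> (s\<^sup>2 g (T\<^sub>s z))\<^sup>p = s\<^sup>2 (s y)\<^bsup>2p-2\<^esup> g (T\<^sub>s z)\<^sup>p \<le> s\<^sup>2 (Im (T\<^sub>s z))\<^bsup>2p-2\<^esup> g (T\<^sub>s z)\<^sup>p\<close>,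
  and \<open>s\<^sup>2\<close> is the Jacobian of \<open>T\<^sub>s\<close>.
\<close>

lemma dilation_averages_contract:
  fixes g u :: "complex \<Rightarrow> real" and c :: complex and \<mu> :: "real measure" and p :: real
  assumes \<mu>: "sets \<mu> = sets borel" "emeasure \<mu> (space \<mu>) = 1" and p: "1 \<le> p"
    and s: "AE s in \<mu>. 0 < s \<and> 0 \<le> (1 - s) * Im c"
    and g [measurable]: "g \<in> borel_measurable borel" and g0: "\<And>z. 0 \<le> g z"
    and u: "\<And>z. 0 < Im z \<Longrightarrow> 0 \<le> u z"
      "\<And>z. 0 < Im z \<Longrightarrow> ennreal (u z) \<le> (\<integral>\<^sup>+s. ennreal (s\<^sup>2 * g (c + of_real s * (z - c))) \<partial>\<mu>)"
  shows "(\<integral>\<^sup>+z\<in>upper_halfplane. ennreal (Im z powr (2 * p - 2) * u z powr p) \<partial>lborel)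
       \<le> (\<integral>\<^sup>+z\<in>upper_halfplane. ennreal (Im z powr (2 * p - 2) * g z powr p) \<partial>lborel)"
proof -
  define U where "U = upper_halfplane"
  have U: "z \<in> U \<longleftrightarrow> 0 < Im z" for z by (simp add: U_def upper_halfplane_def)
  have [measurable]: "U \<in> sets borel"
    unfolding U_def upper_halfplane_def by (intro borel_open open_halfspace_Im_gt)
  have [measurable_cong]: "sets \<mu> = sets borel" by fact
  have [measurable]: "(\<lambda>s::real. complex_of_real s) \<in> borel_measurable borel"
    by (intro borel_measurable_continuous_onI continuous_intros)
  interpret finite_measure \<mu> by (rule finite_measureI) (simp add: \<mu>)
  interpret pair_sigma_finite \<mu> "lborel :: complex measure" ..
  define k where "k z = ennreal (Im z powr (2 * p - 2) * g z powr p) * indicator U z" for z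
  have [measurable]: "k \<in> borel_measurable borel" unfolding k_def by measurable
  let ?T = "\<lambda>s z. c + of_real s * (z - c)"
  have "(\<integral>\<^sup>+z\<in>U. ennreal (Im z powr (2 * p - 2) * u z powr p) \<partial>lborel)
     \<le> (\<integral>\<^sup>+z. (\<integral>\<^sup>+s. ennreal (Im z powr (2 * p - 2) * (s\<^sup>2 * g (?T s z)) powr p) * indicator U z \<partial>\<mu>) \<partial>lborel)"
  proof (rule nn_integral_mono)
    fix z
    have "ennreal (Im z powr (2 * p - 2)) * ennreal (u z powr p)
      \<le> ennreal (Im z powr (2 * p - 2)) * (\<integral>\<^sup>+s. ennreal ((s\<^sup>2 * g (?T s z)) powr p) \<partial>\<mu>)" if "0 < Im z"
      using that u g0 \<mu> p by (intro mult_left_mono nn_integral_Jensen_powr) auto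
    then show "ennreal (Im z powr (2 * p - 2) * u z powr p) * indicator U z
      \<le> (\<integral>\<^sup>+s. ennreal (Im z powr (2 * p - 2) * (s\<^sup>2 * g (?T s z)) powr p) * indicator U z \<partial>\<mu>)"
      by (cases "0 < Im z") (simp_all add: U ennreal_mult nn_integral_cmult)
  qed
  also have "\<dots> = (\<integral>\<^sup>+s. (\<integral>\<^sup>+z. ennreal (Im z powr (2 * p - 2) * (s\<^sup>2 * g (?T s z)) powr p) * indicator U z
      \<partial>lborel) \<partial>\<mu>)"
    by (rule Fubini') measurable
  also have "\<dots> \<le> (\<integral>\<^sup>+s. (\<integral>\<^sup>+z. k z \<partial>lborel) \<partial>\<mu>)"
  proof (rule nn_integral_mono_AE, rule AE_mp[OF s AE_I2], rule impI)
    fix s assume "0 < s \<and> 0 \<le> (1 - s) * Im c"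
    then have s: "0 < s" "0 \<le> (1 - s) * Im c" by auto
    have "(\<integral>\<^sup>+z. ennreal (Im z powr (2 * p - 2) * (s\<^sup>2 * g (?T s z)) powr p) * indicator U z \<partial>lborel)
       \<le> (\<integral>\<^sup>+z. ennreal (s\<^sup>2) * k (?T s z) \<partial>lborel)"
    proof (rule nn_integral_mono)
      fix z
      show "ennreal (Im z powr (2 * p - 2) * (s\<^sup>2 * g (?T s z)) powr p) * indicator U z
          \<le> ennreal (s\<^sup>2) * k (?T s z)"
      proof (cases "0 < Im z")
        case True
        then have im: "s * Im z \<le> Im (?T s z)" using s by (simp add: algebra_simps)
        moreover have "0 < s * Im z" using True s by simp
        ultimately have TU: "0 < Im (?T s z)" by linarith
        \<comment> \<open>one factor \<open>s\<^sup>2\<close> is kept as the Jacobian, the rest goes into the weight\<close>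
        have "(s\<^sup>2) powr p = s\<^sup>2 * s powr (2 * p - 2)"
          using s by (simp add: powr_powr powr_diff flip: powr_numeral)
        then have "Im z powr (2 * p - 2) * (s\<^sup>2 * g (?T s z)) powr p
          = s\<^sup>2 * ((s * Im z) powr (2 * p - 2) * g (?T s z) powr p)"
          using s g0 True by (simp add: powr_mult mult_ac)
        also have "\<dots> \<le> s\<^sup>2 * (Im (?T s z) powr (2 * p - 2) * g (?T s z) powr p)"
          using im \<open>0 < s * Im z\<close> p by (intro mult_left_mono mult_right_mono powr_mono2) auto
        finally show ?thesis
          using True TU by (simp add: k_def U ennreal_leI flip: ennreal_mult)
      qed (simp add: U)
    qed
    also have "\<dots> = (\<integral>\<^sup>+z. k z \<partial>lborel)"
    proof -
      have "(\<integral>\<^sup>+z. k z \<partial>lborel) = (\<integral>\<^sup>+z. ennreal (s\<^sup>2) * k ((c - of_real s * c) + s *\<^sub>R z) \<partial>lborel)"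
        using s by (subst lborel_affine[of s "c - of_real s * c"])
          (simp_all add: nn_integral_density nn_integral_distr)
      then show ?thesis by (simp add: algebra_simps scaleR_conv_of_real)
    qed
    finally show "(\<integral>\<^sup>+z. ennreal (Im z powr (2 * p - 2) * (s\<^sup>2 * g (?T s z)) powr p) * indicator U z \<partial>lborel)
       \<le> (\<integral>\<^sup>+z. k z \<partial>lborel)" .
  qed
  also have "\<dots> = (\<integral>\<^sup>+z. k z \<partial>lborel)" by (simp add: \<mu>)
  finally show ?thesis by (simp add: k_def U_def)
qed

section \<open>Carleson boxes and Poisson integrals in the half-plane\<close>

lemma mem_upper_halfplane [simp]: "z \<in> upper_halfplane \<longleftrightarrow> 0 < Im z"
  by (simp add: upper_halfplane_def)

lemma open_upper_halfplane [simp]: "open upper_halfplane"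
  unfolding upper_halfplane_def by (rule open_halfspace_Im_gt)

lemma upper_halfplane_borel [measurable]: "upper_halfplane \<in> sets borel"
  by simp

text \<open>
  The density of the measure whose mass on Carleson boxes defines the BMOA seminorm.
\<close>

definition energy :: "hyp_domain \<Rightarrow> (complex \<Rightarrow> complex) \<Rightarrow> complex \<Rightarrow> ennreal" where
  "energy X \<Phi> z = ennreal ((norm (deriv \<Phi> z) / hyp_domain.density X z)\<^sup>2 * hyp_domain.density X z)"

lemma bmoa_sup_upperI:
  assumes "\<And>J. J \<in> bases X \<Longrightarrow> 0 < measure lborel J"
    and "\<And>J. J \<in> bases X \<Longrightarrow> (\<integral>\<^sup>+z\<in>hyp_domain.box X J. energy X \<Phi> z \<partial>lborel) \<le> ennreal (measure lborel J) * S"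
  shows "bmoa_sup X \<Phi> \<le> S"
  unfolding bmoa_sup_def energy_def[symmetric]
proof (rule SUP_least)
  fix J assume J: "J \<in> bases X"
  have "ennreal (1 / measure lborel J) * (\<integral>\<^sup>+z\<in>hyp_domain.box X J. energy X \<Phi> z \<partial>lborel)
    \<le> ennreal (1 / measure lborel J) * (ennreal (measure lborel J) * S)"
    by (intro mult_left_mono assms J) simp
  also have "\<dots> = S"
    using assms(1)[OF J] by (simp add: mult.assoc[symmetric] flip: ennreal_mult)
  finally show "ennreal (1 / measure lborel J) * (\<integral>\<^sup>+z\<in>hyp_domain.box X J. energy X \<Phi> z \<partial>lborel) \<le> S" .
qed

text \<open>
  The form in which BMOA is used. Passing to a subset \<open>B\<close> of the box allows sets that are given by the size
  of the kernel and are therefore measurable, as required for summing integrals over them.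
\<close>

lemma box_energy_le:
  assumes "J \<in> bases X" "0 < measure lborel J" "measure lborel J \<le> l" "B \<subseteq> hyp_domain.box X J"
  shows "(\<integral>\<^sup>+z\<in>B. energy X \<Phi> z \<partial>lborel) \<le> ennreal l * bmoa_sup X \<Phi>"
proof -
  have "(\<integral>\<^sup>+z\<in>B. energy X \<Phi> z \<partial>lborel) \<le> (\<integral>\<^sup>+z\<in>hyp_domain.box X J. energy X \<Phi> z \<partial>lborel)"
    using assms(4) by (intro nn_integral_mono) (auto simp: indicator_def)
  also have "\<dots> = ennreal (measure lborel J) *
      (ennreal (1 / measure lborel J) * (\<integral>\<^sup>+z\<in>hyp_domain.box X J. energy X \<Phi> z \<partial>lborel))"
    using assms(2) by (simp add: mult.assoc[symmetric] flip: ennreal_mult)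
  also have "\<dots> \<le> ennreal (measure lborel J) * bmoa_sup X \<Phi>"
    unfolding bmoa_sup_def energy_def using assms(1) by (intro mult_left_mono SUP_upper) auto
  also have "\<dots> \<le> ennreal l * bmoa_sup X \<Phi>"
    using assms(3) by (intro mult_right_mono ennreal_leI) auto
  finally show ?thesis .
qed

abbreviation halfplane_mass :: "(complex \<Rightarrow> complex) \<Rightarrow> complex \<Rightarrow> real" where
  "halfplane_mass \<Phi> z \<equiv> Im z * (norm (deriv \<Phi> z))\<^sup>2"

abbreviation disc_mass :: "(complex \<Rightarrow> complex) \<Rightarrow> complex \<Rightarrow> real" where
  "disc_mass \<Psi> w \<equiv> (1 - (norm w)\<^sup>2) / 2 * (norm (deriv \<Psi> w))\<^sup>2"

text \<open>
  The kernel is, up to a constant, the Poisson kernel with pole \<open>a\<close>, extended from the boundary to the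
  half-plane; on the disc it is the corresponding extension with pole \<open>\<alpha>\<close>. In terms of the pseudohyperbolic
  distance \<open>d\<close> of \<open>z\<close> and \<open>a\<close>, the kernel times \<open>4y\<close> is the conformally invariant \<open>1 - d\<^sup>2\<close>.
\<close>

abbreviation halfplane_kernel :: "complex \<Rightarrow> complex \<Rightarrow> real" where
  "halfplane_kernel a z \<equiv> Im a / (norm (z - cnj a))\<^sup>2"

abbreviation disc_kernel :: "complex \<Rightarrow> complex \<Rightarrow> real" where
  "disc_kernel \<alpha> w \<equiv> (1 - (norm \<alpha>)\<^sup>2) / (2 * (norm (1 - cnj \<alpha> * w))\<^sup>2)"

lemma halfplane_energy:
  assumes "0 < Im z"
  shows "energy (halfplane_domain upper_halfplane) \<Phi> z = ennreal (halfplane_mass \<Phi> z)"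
  using assms by (simp add: energy_def halfplane_domain_def power2_eq_square)

lemma disc_energy:
  assumes "norm w < 1"
  shows "energy disc_domain \<Psi> w = ennreal (disc_mass \<Psi> w)"
proof -
  have "(norm w)\<^sup>2 < 1" using assms by (simp add: abs_square_less_1)
  moreover have "(n / (2 / d))\<^sup>2 * (2 / d) = d / 2 * n\<^sup>2" if "0 < d" for n d :: real
    using that by (simp add: power2_eq_square)
  ultimately show ?thesis by (simp add: energy_def disc_domain_def)
qed

text \<open>
  The bases of the boxes are intervals with or without their endpoints.
\<close>

lemma bounded_interval_sandwich:
  fixes J :: "real set"
  assumes "is_interval J" "bounded J" "0 < measure lborel J"
  obtains a b where "a < b" "J \<subseteq> {a..b}" "measure lborel J = b - a"
proof -
  have ne: "J \<noteq> {}" using assms(3) by auto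
  have bdd: "bdd_above J" "bdd_below J"
    using assms(2) by (auto simp: bounded_imp_bdd_above bounded_imp_bdd_below)
  define a b where "a = Inf J" and "b = Sup J"
  have sub: "J \<subseteq> {a..b}"
    using bdd by (auto simp: a_def b_def intro: cInf_lower cSup_upper)
  have sup: "{a<..<b} \<subseteq> J"
  proof
    fix x assume x: "x \<in> {a<..<b}"
    obtain u where u: "u \<in> J" "u < x"
      using x ne bdd by (auto simp: a_def cInf_less_iff)
    obtain v where v: "v \<in> J" "x < v"
      using x ne bdd by (auto simp: b_def less_cSup_iff)
    show "x \<in> J"
      using assms(1) u v by (meson is_interval_1 less_imp_le)
  qed
  have ab: "a \<le> b" using sub ne by auto
  have Jb: "J \<in> sets borel"
    using assms(1) by (rule real_interval_borel_measurable)
  have fin: "{a..b} \<in> fmeasurable lborel"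
    using fmeasurable_cbox[of a b] by (simp add: cbox_interval)
  have Jfin: "J \<in> fmeasurable lborel"
    using Jb sub by (intro fmeasurableI2[OF fin]) auto
  have "measure lborel J \<le> measure lborel {a..b}"
    by (rule measure_mono_fmeasurable[OF sub _ fin]) (simp add: Jb)
  moreover have "measure lborel {a<..<b} \<le> measure lborel J"
    by (rule measure_mono_fmeasurable[OF sup _ Jfin]) simp
  ultimately have "measure lborel J = b - a" using ab by simp
  then show thesis using that[of a b] assms(3) sub by simp
qed

definition halfplane_poisson :: "(complex \<Rightarrow> complex) \<Rightarrow> complex \<Rightarrow> ennreal" where
  "halfplane_poisson \<Phi> a = (\<integral>\<^sup>+z\<in>upper_halfplane. ennreal (halfplane_kernel a z * halfplane_mass \<Phi> z)
      \<partial>lborel)"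

definition disc_poisson :: "(complex \<Rightarrow> complex) \<Rightarrow> complex \<Rightarrow> ennreal" where
  "disc_poisson \<Psi> \<alpha> = (\<integral>\<^sup>+w\<in>ball 0 1. ennreal (disc_kernel \<alpha> w * disc_mass \<Psi> w) \<partial>lborel)"

lemma borel_measurable_times_indicator:
  fixes f h :: "complex \<Rightarrow> 'b :: {semiring_1, topological_space}"
  assumes "h \<in> borel_measurable borel" "A \<in> sets borel" "\<And>z. z \<in> A \<Longrightarrow> f z = h z"
  shows "(\<lambda>z. f z * indicator A z) \<in> borel_measurable borel"
proof -
  have "(\<lambda>z. if z \<in> A then h z else 0) \<in> borel_measurable borel"
    using assms by (intro measurable_If_set) auto
  also have "(\<lambda>z. if z \<in> A then h z else 0) = (\<lambda>z. f z * indicator A z)"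
    using assms(3) by (auto simp: indicator_def)
  finally show ?thesis .
qed

lemma deriv_measurable_on:
  assumes "f holomorphic_on S" "open S"
  shows "(\<lambda>z. norm (deriv f z) * indicator S z) \<in> borel_measurable borel"
proof -
  have "(\<lambda>z. norm (if z \<in> S then deriv f z else 0)) \<in> borel_measurable borel"
    using holomorphic_deriv[OF assms] assms(2)
    by (intro measurable_compose[OF _ borel_measurable_norm] borel_measurable_continuous_on_if)
      (auto intro: holomorphic_on_imp_continuous_on)
  then show ?thesis by (rule borel_measurable_times_indicator) (use assms(2) in simp_all)
qed

text \<open>
  The set where \<open>|z - cnj a| < 2\<^bsup>k+1\<^esup> Im a\<close> lies in the box over an interval of length \<open>4 \<cdot> 2\<^sup>k Im a\<close>
  centred at \<open>Re a\<close>, and outside the preceding set the kernel is at most \<open>4\<^bsup>-k\<^esup> / Im a\<close>.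
\<close>

lemma halfplane_poisson_le:
  assumes \<Phi>: "\<Phi> holomorphic_on upper_halfplane" and a: "0 < Im a"
  shows "halfplane_poisson \<Phi> a \<le> 8 * bmoa_sup (halfplane_domain upper_halfplane) \<Phi>"
proof -
  define y0 where "y0 = Im a"
  let ?X = "halfplane_domain upper_halfplane"
  let ?q = "\<lambda>z. norm (z - cnj a) / y0"
  let ?w = "\<lambda>z. ennreal (Im z * (norm (deriv \<Phi> z) * indicator upper_halfplane z)\<^sup>2)"
  let ?\<kappa> = "\<lambda>z. ennreal (y0 / (norm (z - cnj a))\<^sup>2)"
  let ?M = "bmoa_sup ?X \<Phi>"
  have y0: "0 < y0" using a by (simp add: y0_def)
  note [measurable] = deriv_measurable_on[OF \<Phi> open_upper_halfplane]
  have q1: "y0 \<le> norm (z - cnj a)" if "0 < Im z" for z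
    using that abs_Im_le_cmod[of "z - cnj a"] by (simp add: y0_def)
  have "halfplane_poisson \<Phi> a = (\<integral>\<^sup>+z. ?\<kappa> z * ?w z \<partial>lborel)"
    unfolding halfplane_poisson_def using y0
    by (intro nn_integral_cong) (auto simp: indicator_def y0_def ennreal_mult'[symmetric])
  also have "\<dots> \<le> ennreal (2 * (4 * y0) / y0) * ?M"
  proof (rule nn_integral_inverse_square_kernel[where q = ?q])
    show "1 \<le> ?q z" if "?w z \<noteq> 0" for z
      using that q1[of z] y0 by (auto simp: indicator_def split: if_splits)
    show "?\<kappa> z \<le> ennreal (1 / (y0 * (?q z)\<^sup>2))" for z
      using y0 by (simp add: power_divide power2_eq_square)
  next
    fix k :: nat
    let ?I = "\<integral>\<^sup>+z. ?w z * indicator {z \<in> space lborel. ?q z < 2 ^ (k + 1)} z \<partial>lborel"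
    define d where "d = 2 ^ (k + 1) * y0"
    have d: "0 < d" using y0 by (simp add: d_def)
    let ?J = "{Re a - d..Re a + d}"
    let ?B = "{z \<in> upper_halfplane. ?q z < 2 ^ (k + 1)}"
    have "?I = (\<integral>\<^sup>+z\<in>?B. energy ?X \<Phi> z \<partial>lborel)"
      by (intro nn_integral_cong) (auto simp: indicator_def halfplane_energy)
    also have "\<dots> \<le> ennreal (4 * y0 * 2 ^ k) * ?M"
    proof (rule box_energy_le[where J = ?J])
      show "?J \<in> bases ?X"
        using d by (simp add: halfplane_domain_def is_interval_cc)
      show "?B \<subseteq> hyp_domain.box ?X ?J"
      proof
        fix z assume "z \<in> ?B"
        then have z: "0 < Im z" "norm (z - cnj a) < d" using y0 by (auto simp: d_def field_simps)
        then have "\<bar>Re z - Re a\<bar> < d" "Im z + Im a < d"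
          using abs_Re_le_cmod[of "z - cnj a"] abs_Im_le_cmod[of "z - cnj a"] by auto
        then show "z \<in> hyp_domain.box ?X ?J"
          using z y0 d by (auto simp: halfplane_domain_def y0_def)
      qed
    qed (use d in \<open>auto simp: d_def\<close>)
    finally show "?I \<le> ennreal (4 * y0 * 2 ^ k) * ?M" .
  next
    show "0 < y0" "0 \<le> 4 * y0" using y0 by auto
  qed measurable
  also have "2 * (4 * y0) / y0 = 8" using y0 by simp
  finally show ?thesis by simp
qed

lemma halfplane_poisson_measurable:
  assumes "\<Phi> holomorphic_on upper_halfplane"
  shows "(\<lambda>z. ennreal (halfplane_kernel a z * halfplane_mass \<Phi> z) * indicator upper_halfplane z)
    \<in> borel_measurable lborel"
proof -
  note [measurable] = deriv_measurable_on[OF assms open_upper_halfplane]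
  show ?thesis
    unfolding measurable_lborel2
    by (rule borel_measurable_times_indicator[where h = "\<lambda>z. ennreal (halfplane_kernel a z *
        (Im z * (norm (deriv \<Phi> z) * indicator upper_halfplane z)\<^sup>2))"]; (measurable | simp))
qed

text \<open>
  For an interval of length \<open>l\<close>, choose the pole at height \<open>l\<close> above its centre: all points of the box are
  within \<open>\<surd>5 l\<close> of the conjugate of the pole, so the kernel is at least \<open>1 / (5 l)\<close> there.
\<close>

lemma halfplane_bmoa_le:
  assumes \<Phi>: "\<Phi> holomorphic_on upper_halfplane"
    and P: "\<And>a. 0 < Im a \<Longrightarrow> halfplane_poisson \<Phi> a \<le> P"
  shows "bmoa_sup (halfplane_domain upper_halfplane) \<Phi> \<le> 5 * P"
proof (rule bmoa_sup_upperI)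
  let ?X = "halfplane_domain upper_halfplane"
  fix J assume "J \<in> bases ?X"
  then have J: "is_interval J" "bounded J" "0 < measure lborel J"
    by (auto simp: halfplane_domain_def)
  then show "0 < measure lborel J" by simp
  obtain u v where uv: "u < v" "J \<subseteq> {u..v}" "measure lborel J = v - u"
    using bounded_interval_sandwich[OF J] .
  define l where "l = v - u"
  have l: "0 < l" using uv by (simp add: l_def)
  define a where "a = Complex ((u + v) / 2) l"
  have "(\<integral>\<^sup>+z\<in>hyp_domain.box ?X J. energy ?X \<Phi> z \<partial>lborel)
    \<le> (\<integral>\<^sup>+z. ennreal (5 * l) * (ennreal (halfplane_kernel a z * halfplane_mass \<Phi> z)
        * indicator upper_halfplane z) \<partial>lborel)"
  proof (rule nn_integral_mono)
    fix z
    show "energy ?X \<Phi> z * indicator (hyp_domain.box ?X J) z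
     \<le> ennreal (5 * l) * (ennreal (halfplane_kernel a z * halfplane_mass \<Phi> z) * indicator upper_halfplane z)"
    proof (cases "z \<in> hyp_domain.box ?X J")
      case True
      then have z: "0 < Im z" "Re z \<in> {u..v}" "Im z \<le> l"
        using uv by (auto simp: halfplane_domain_def l_def)
      have "(norm (z - cnj a))\<^sup>2 = (Re z - (u + v) / 2)\<^sup>2 + (Im z + l)\<^sup>2"
        by (simp add: cmod_power2 a_def)
      also have "\<dots> \<le> (l / 2)\<^sup>2 + (2 * l)\<^sup>2"
        using z l unfolding l_def
        by (intro add_mono power2_le_iff_abs_le[THEN iffD2]) (auto simp: abs_le_iff field_simps)
      also have "\<dots> \<le> 5 * l\<^sup>2" by (simp add: power2_eq_square)
      finally have le: "(norm (z - cnj a))\<^sup>2 \<le> 5 * l\<^sup>2" .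
      have "z \<noteq> cnj a" using z l by (auto simp: a_def complex_eq_iff)
      then have pos: "0 < (norm (z - cnj a))\<^sup>2" by simp
      have "1 \<le> 5 * l * (halfplane_kernel a z)"
        using le pos by (simp add: a_def field_simps power2_eq_square)
      then have "Im z * (norm (deriv \<Phi> z))\<^sup>2 * 1
          \<le> Im z * (norm (deriv \<Phi> z))\<^sup>2 * (5 * l * (halfplane_kernel a z))"
        using z by (intro mult_left_mono) auto
      then show ?thesis
        using z l True by (simp add: halfplane_energy ennreal_leI a_def mult_ac flip: ennreal_mult)
    qed simp
  qed
  also have "\<dots> \<le> ennreal (5 * l) * halfplane_poisson \<Phi> a"
    unfolding halfplane_poisson_def
    by (intro eq_refl nn_integral_cmult halfplane_poisson_measurable \<Phi>)
  also have "\<dots> \<le> ennreal (5 * l) * P"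
    using P[of a] l by (intro mult_left_mono) (auto simp: a_def)
  also have "\<dots> = ennreal (measure lborel J) * (5 * P)"
  proof -
    have "ennreal (5 * l) = 5 * ennreal l" using l by (subst ennreal_mult) auto
    then show ?thesis unfolding uv(3) l_def by (simp only: mult_ac)
  qed
  finally show "(\<integral>\<^sup>+z\<in>hyp_domain.box ?X J. energy ?X \<Phi> z \<partial>lborel) \<le> ennreal (measure lborel J) * (5 * P)" .
qed

section \<open>Carleson boxes and Poisson integrals in the disc\<close>

text \<open>
  A lower bound for the sine that is linear up to the right angle; Taylor's formula gives the factor
  \<open>1/3 \<ge> 1/\<pi>\<close>, which suffices.
\<close>

lemma abs_le_pi_abs_sin:
  fixes x :: real
  assumes "\<bar>x\<bar> \<le> pi / 2"
  shows "\<bar>x\<bar> \<le> pi * \<bar>sin x\<bar>"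
proof -
  have "\<bar>x\<bar> \<le> 2" using assms pi_half_less_two by linarith
  then have "\<bar>x\<bar>\<^sup>2 \<le> 2\<^sup>2" by (intro power_mono) auto
  then have "\<bar>x\<bar> * \<bar>x\<bar>\<^sup>2 \<le> \<bar>x\<bar> * 4" by (intro mult_left_mono) auto
  moreover have "\<bar>sin x - x\<bar> \<le> \<bar>x\<bar> ^ 3 / 6"
    using Maclaurin_sin_bound[of x 3] by (simp add: sin_coeff_def eval_nat_numeral)
  moreover have "\<bar>x\<bar> ^ 3 = \<bar>x\<bar> * \<bar>x\<bar>\<^sup>2" by (simp add: power2_eq_square power3_eq_cube)
  ultimately have "\<bar>x\<bar> \<le> 3 * \<bar>sin x\<bar>" by linarith
  also have "\<dots> \<le> pi * \<bar>sin x\<bar>" using pi_gt3 by (intro mult_right_mono) auto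
  finally show ?thesis .
qed

text \<open>
  A point near 1 has a small argument: its distance to 1 is at least the distance from 1 to the line
  through 0 and the point, which is the sine of the argument.
\<close>

lemma angle_le_of_near_one:
  fixes t \<phi> \<eta> :: real
  assumes "0 \<le> t" "\<bar>\<phi>\<bar> \<le> pi" "\<eta> \<le> 1" "norm (1 - of_real t * cis \<phi>) < \<eta>"
  shows "\<bar>\<phi>\<bar> \<le> pi * \<eta>"
proof -
  have "\<bar>1 - t * cos \<phi>\<bar> < 1"
    using abs_Re_le_cmod[of "1 - of_real t * cis \<phi>"] assms by simp
  then have "0 < t * cos \<phi>" by linarith
  then have cos: "0 < cos \<phi>" using assms(1) by (simp add: zero_less_mult_iff)
  have half: "\<bar>\<phi>\<bar> \<le> pi / 2"
  proof (rule ccontr)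
    assume "\<not> \<bar>\<phi>\<bar> \<le> pi / 2"
    then have "cos \<bar>\<phi>\<bar> < cos (pi / 2)"
      using assms(2) by (intro cos_monotone_0_pi) auto
    then show False using cos by simp
  qed
  have "(norm (1 - of_real t * cis \<phi>))\<^sup>2 = (1 - t * cos \<phi>)\<^sup>2 + (t * sin \<phi>)\<^sup>2"
    by (simp add: cmod_power2)
  also have "\<dots> = (sin \<phi>)\<^sup>2 + (t - cos \<phi>)\<^sup>2"
    using sin_cos_squared_add[of \<phi>] by algebra
  finally have "\<bar>sin \<phi>\<bar>\<^sup>2 \<le> (norm (1 - of_real t * cis \<phi>))\<^sup>2" by simp
  then have "\<bar>sin \<phi>\<bar> \<le> norm (1 - of_real t * cis \<phi>)"
    by (rule power2_le_imp_le) simp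
  then have "pi * \<bar>sin \<phi>\<bar> \<le> pi * \<eta>" using assms(4) by (intro mult_left_mono) auto
  then show ?thesis using abs_le_pi_abs_sin[OF half] by linarith
qed

lemma norm_one_minus_cis_le: "norm (1 - cis \<phi>) \<le> \<bar>\<phi>\<bar>"
proof -
  have "(norm (1 - cis \<phi>))\<^sup>2 = (1 - cos \<phi>)\<^sup>2 + (sin \<phi>)\<^sup>2" by (simp add: cmod_power2)
  also have "\<dots> = (2 * sin (\<phi> / 2))\<^sup>2"
    using cos_double_sin[of "\<phi> / 2"] sin_cos_squared_add[of \<phi>] by (simp add: power2_eq_square algebra_simps)
  also have "\<dots> \<le> \<bar>\<phi>\<bar>\<^sup>2"
    using abs_sin_x_le_abs_x[of "\<phi> / 2"] by (intro power2_le_iff_abs_le[THEN iffD2]) auto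
  finally show ?thesis by (rule power2_le_imp_le) simp
qed

lemma disc_boxI:
  assumes "norm w < 1" "1 - measure lborel J / (2 * pi) \<le> norm w" "\<theta> \<in> J" "w = of_real (norm w) * cis \<theta>"
  shows "w \<in> hyp_domain.box disc_domain J"
  using assms by (auto simp: disc_domain_def)

text \<open>
  As in the half-plane, with \<open>\<delta> = 1 - |\<alpha>|\<close> in the role of the height and the sets where
  \<open>|1 - cnj \<alpha> w| < \<eta> = 2\<^bsup>k+1\<^esup> \<delta>\<close>. Such a set lies in the box over the arc of length \<open>2 \<pi> min \<eta> 1\<close> centred
  at the direction of \<open>\<alpha>\<close>; once \<open>\<eta> \<ge> 1\<close>, this box is the whole disc.
\<close>

lemma disc_poisson_le:
  assumes \<Psi>: "\<Psi> holomorphic_on ball 0 1" and \<alpha>: "norm \<alpha> < 1"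
  shows "disc_poisson \<Psi> \<alpha> \<le> ennreal (8 * pi) * bmoa_sup disc_domain \<Psi>"
proof -
  define \<delta> where "\<delta> = 1 - norm \<alpha>"
  define \<theta>0 where "\<theta>0 = Arg \<alpha>"
  have \<alpha>_eq: "\<alpha> = of_real (norm \<alpha>) * cis \<theta>0"
    using rcis_cmod_Arg[of \<alpha>] by (simp add: rcis_def \<theta>0_def)
  let ?q = "\<lambda>w. norm (1 - cnj \<alpha> * w) / \<delta>"
  let ?w = "\<lambda>w. ennreal ((1 - (norm w)\<^sup>2) / 2 * (norm (deriv \<Psi> w) * indicator (ball 0 1) w)\<^sup>2)"
  let ?\<kappa> = "\<lambda>w. ennreal (disc_kernel \<alpha> w)"
  let ?M = "bmoa_sup disc_domain \<Psi>"
  have \<delta>: "0 < \<delta>" using \<alpha> by (simp add: \<delta>_def)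
  note [measurable] = deriv_measurable_on[OF \<Psi> open_ball]
  have q1: "\<delta> \<le> norm (1 - cnj \<alpha> * w)" "1 - norm w \<le> norm (1 - cnj \<alpha> * w)" if "norm w < 1" for w
  proof -
    have "1 - norm \<alpha> * norm w \<le> norm (1 - cnj \<alpha> * w)"
      using norm_triangle_ineq2[of 1 "cnj \<alpha> * w"] by (simp add: norm_mult)
    moreover have "norm \<alpha> * norm w \<le> norm \<alpha>" "norm \<alpha> * norm w \<le> norm w"
      using that \<alpha> by (auto intro: mult_left_le mult_right_le_one_le mult_left_le_one_le)
    ultimately show "\<delta> \<le> norm (1 - cnj \<alpha> * w)" "1 - norm w \<le> norm (1 - cnj \<alpha> * w)"
      by (auto simp: \<delta>_def)
  qed
  have "disc_poisson \<Psi> \<alpha> = (\<integral>\<^sup>+w. ?\<kappa> w * ?w w \<partial>lborel)"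
    unfolding disc_poisson_def
  proof (rule nn_integral_cong)
    fix w
    have "0 \<le> 1 - (norm \<alpha>)\<^sup>2" using \<alpha> by (simp add: abs_square_le_1)
    then show "ennreal (disc_kernel \<alpha> w * disc_mass \<Psi> w) * indicator (ball 0 1) w
      = ?\<kappa> w * ?w w"
      by (cases "norm w < 1") (auto simp: ennreal_mult'[symmetric] simp del: times_divide_eq_left times_divide_eq_right)
  qed
  also have "\<dots> \<le> ennreal (2 * (4 * pi * \<delta>) / \<delta>) * ?M"
  proof (rule nn_integral_inverse_square_kernel[where q = ?q])
    fix w assume "?w w \<noteq> 0"
    then have "norm w < 1" by (cases "norm w < 1") auto
    then show "1 \<le> ?q w" using q1[of w] \<delta> by simp
  next
    fix w
    have "1 - (norm \<alpha>)\<^sup>2 = \<delta> * (1 + norm \<alpha>)" by (simp add: \<delta>_def power2_eq_square algebra_simps)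
    also have "\<dots> \<le> \<delta> * 2" using \<alpha> \<delta> by (intro mult_left_mono) auto
    finally have "disc_kernel \<alpha> w \<le> (2 * \<delta>) / (2 * (norm (1 - cnj \<alpha> * w))\<^sup>2)"
      by (intro divide_right_mono) auto
    also have "\<dots> = 1 / (\<delta> * (?q w)\<^sup>2)" using \<delta> by (simp add: power_divide power2_eq_square)
    finally show "?\<kappa> w \<le> ennreal (1 / (\<delta> * (?q w)\<^sup>2))" by (rule ennreal_leI)
  next
    fix k :: nat
    let ?I = "\<integral>\<^sup>+w. ?w w * indicator {w \<in> space lborel. ?q w < 2 ^ (k + 1)} w \<partial>lborel"
    define \<eta> where "\<eta> = 2 ^ (k + 1) * \<delta>"
    \<comment> \<open>the arc cannot be longer than the whole circle\<close>
    define \<eta>' where "\<eta>' = min \<eta> 1"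
    have \<eta>: "0 < \<eta>" "0 < \<eta>'" "\<eta>' \<le> \<eta>" "\<eta>' \<le> 1" using \<delta> by (auto simp: \<eta>_def \<eta>'_def)
    let ?J = "{\<theta>0 - pi * \<eta>'..\<theta>0 + pi * \<eta>'}"
    have mJ: "measure lborel ?J = 2 * pi * \<eta>'" using \<eta> by simp
    let ?B = "{w \<in> ball 0 1. ?q w < 2 ^ (k + 1)}"
    have "?I = (\<integral>\<^sup>+w\<in>?B. energy disc_domain \<Psi> w \<partial>lborel)"
      by (intro nn_integral_cong) (auto simp: indicator_def disc_energy)
    also have "\<dots> \<le> ennreal (4 * pi * \<delta> * 2 ^ k) * ?M"
    proof (rule box_energy_le[where J = ?J])
      show "?J \<in> bases disc_domain"
        using \<eta> by (simp add: disc_domain_def is_interval_cc)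
      show "?B \<subseteq> hyp_domain.box disc_domain ?J"
      proof
        fix w assume "w \<in> ?B"
        then have w: "norm w < 1" "norm (1 - cnj \<alpha> * w) < \<eta>" using \<delta> by (auto simp: \<eta>_def field_simps)
        define \<phi> where "\<phi> = Arg (w * cis (- \<theta>0))"
        have w\<phi>: "w = of_real (norm w) * cis (\<theta>0 + \<phi>)"
        proof -
          have "w * cis (- \<theta>0) = of_real (norm w) * cis \<phi>"
            using rcis_cmod_Arg[of "w * cis (- \<theta>0)"] by (simp add: rcis_def \<phi>_def norm_mult)
          then have "w * cis (- \<theta>0) * cis \<theta>0 = of_real (norm w) * cis \<phi> * cis \<theta>0" by simp
          then show ?thesis by (simp add: mult.assoc cis_mult add.commute)
        qed
        have \<phi>: "\<bar>\<phi>\<bar> \<le> pi" using Arg_bounded[of "w * cis (- \<theta>0)"] by (auto simp: \<phi>_def)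
        have "cnj \<alpha> * w = of_real (norm \<alpha> * norm w) * cis \<phi>"
          by (subst \<alpha>_eq, subst w\<phi>) (simp add: cis_cnj cis_mult mult_ac)
        then have near: "norm (1 - of_real (norm \<alpha> * norm w) * cis \<phi>) < \<eta>" using w by simp
        have "\<bar>\<phi>\<bar> \<le> pi * \<eta>'"
        proof (cases "\<eta> \<le> 1")
          case True
          then show ?thesis
            using angle_le_of_near_one[OF _ \<phi> True near] by (simp add: \<eta>'_def min_def)
        qed (use \<phi> in \<open>simp add: \<eta>'_def min_def\<close>)
        then have "\<theta>0 + \<phi> \<in> ?J" by auto
        moreover have "1 - measure lborel ?J / (2 * pi) \<le> norm w"
          unfolding mJ using q1(2)[OF w(1)] w by (auto simp: \<eta>'_def min_def)
        ultimately show "w \<in> hyp_domain.box disc_domain ?J"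
          using w w\<phi> by (intro disc_boxI)
      qed
    next
      have "2 * pi * \<eta>' \<le> 2 * pi * \<eta>" using \<eta> by (intro mult_left_mono) auto
      then show "measure lborel ?J \<le> 4 * pi * \<delta> * 2 ^ k" unfolding mJ by (simp add: \<eta>_def mult_ac)
    qed (use \<eta> mJ in auto)
    finally show "?I \<le> ennreal (4 * pi * \<delta> * 2 ^ k) * ?M" .
  next
    show "0 < \<delta>" "0 \<le> 4 * pi * \<delta>" using \<delta> by auto
  qed measurable
  also have "2 * (4 * pi * \<delta>) / \<delta> = 8 * pi" using \<delta> by simp
  finally show ?thesis .
qed

lemma disc_poisson_measurable:
  assumes "\<Psi> holomorphic_on ball 0 1"
  shows "(\<lambda>w. ennreal (disc_kernel \<alpha> w * disc_mass \<Psi> w) * indicator (ball 0 1) w)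
    \<in> borel_measurable lborel"
proof -
  note [measurable] = deriv_measurable_on[OF assms open_ball]
  show ?thesis
    unfolding measurable_lborel2
    by (rule borel_measurable_times_indicator[where h = "\<lambda>w. ennreal (disc_kernel \<alpha> w *
        ((1 - (norm w)\<^sup>2) / 2 * (norm (deriv \<Psi> w) * indicator (ball 0 1) w)\<^sup>2))"]; (measurable | simp))
qed

text \<open>
  For an arc of length \<open>l\<close>, the pole is placed over its centre at distance \<open>l / (4 \<pi>)\<close> from the circle, so
  that it stays in the disc even if the arc is the whole circle.
\<close>

lemma disc_bmoa_le:
  assumes \<Psi>: "\<Psi> holomorphic_on ball 0 1"
    and P: "\<And>\<alpha>. norm \<alpha> < 1 \<Longrightarrow> disc_poisson \<Psi> \<alpha> \<le> P"
  shows "bmoa_sup disc_domain \<Psi> \<le> ennreal (8 * pi) * P"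
proof (rule bmoa_sup_upperI)
  fix J assume "J \<in> bases disc_domain"
  then have J: "is_interval J" "bounded J" "0 < measure lborel J" and J2: "measure lborel J \<le> 2 * pi"
    by (auto simp: disc_domain_def)
  then show "0 < measure lborel J" by simp
  obtain u v where uv: "u < v" "J \<subseteq> {u..v}" "measure lborel J = v - u"
    using bounded_interval_sandwich[OF J] .
  define l where "l = v - u"
  have l: "0 < l" "l \<le> 2 * pi" using uv J2 by (auto simp: l_def)
  \<comment> \<open>the distance of the pole to the circle is half the depth of the box\<close>
  define \<rho> where "\<rho> = 1 - l / (4 * pi)"
  have \<rho>: "0 \<le> \<rho>" "\<rho> < 1" using l by (auto simp: \<rho>_def field_simps)
  define \<theta>0 where "\<theta>0 = (u + v) / 2"
  define \<alpha> where "\<alpha> = of_real \<rho> * cis \<theta>0"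
  have n\<alpha>: "norm \<alpha> = \<rho>" using \<rho> by (simp add: \<alpha>_def norm_mult)
  have "(\<integral>\<^sup>+w\<in>hyp_domain.box disc_domain J. energy disc_domain \<Psi> w \<partial>lborel)
    \<le> (\<integral>\<^sup>+w. ennreal (8 * pi * l) * (ennreal (disc_kernel \<alpha> w * disc_mass \<Psi> w) * indicator (ball 0 1) w)
        \<partial>lborel)"
  proof (rule nn_integral_mono)
    fix w
    let ?e = "(1 - (norm w)\<^sup>2) / 2 * (norm (deriv \<Psi> w))\<^sup>2"
    let ?k = "disc_kernel \<alpha> w"
    show "energy disc_domain \<Psi> w * indicator (hyp_domain.box disc_domain J) w
     \<le> ennreal (8 * pi * l) * (ennreal (?k * ?e) * indicator (ball 0 1) w)"
    proof (cases "w \<in> hyp_domain.box disc_domain J")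
      case True
      then obtain r \<theta> where r: "w = of_real r * cis \<theta>" "\<theta> \<in> {u..v}" "1 - l / (2 * pi) \<le> r" "r < 1"
        using uv by (auto simp: disc_domain_def l_def)
      have "l / (2 * pi) \<le> 1" using l by simp
      then have r0: "0 \<le> r" using r by linarith
      then have nw: "norm w < 1" using r by (simp add: norm_mult)
      have e0: "0 \<le> ?e" using nw by (simp add: abs_square_le_1)
      have \<phi>: "\<bar>\<theta> - \<theta>0\<bar> \<le> l / 2" using r by (auto simp: \<theta>0_def l_def abs_le_iff field_simps)
      have "cnj \<alpha> * w = of_real (\<rho> * r) * cis (\<theta> - \<theta>0)"
        unfolding \<alpha>_def r(1) by (simp add: cis_cnj cis_mult mult_ac)
      then have "1 - cnj \<alpha> * w = of_real (1 - \<rho> * r) + of_real (\<rho> * r) * (1 - cis (\<theta> - \<theta>0))"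
        by (simp add: algebra_simps)
      then have "norm (1 - cnj \<alpha> * w) \<le> \<bar>1 - \<rho> * r\<bar> + \<rho> * r * norm (1 - cis (\<theta> - \<theta>0))"
        using norm_triangle_ineq[of "of_real (1 - \<rho> * r)" "of_real (\<rho> * r) * (1 - cis (\<theta> - \<theta>0))"] \<rho> r0
        by (simp add: norm_mult del: of_real_diff of_real_mult)
      also have "\<dots> \<le> ((1 - \<rho>) + (1 - r)) + 1 * \<bar>\<theta> - \<theta>0\<bar>"
      proof (intro add_mono mult_mono norm_one_minus_cis_le)
        have "\<rho> * r \<le> 1 * 1" using \<rho> r r0 by (intro mult_mono) auto
        moreover have "0 \<le> (1 - \<rho>) * (1 - r)" using \<rho> r by (intro mult_nonneg_nonneg) auto
        ultimately show "\<rho> * r \<le> 1" "\<bar>1 - \<rho> * r\<bar> \<le> (1 - \<rho>) + (1 - r)"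
          by (simp_all add: algebra_simps)
      qed auto
      also have "\<dots> \<le> l / (4 * pi) + l / (2 * pi) + l / 2"
        using r \<phi> by (simp add: \<rho>_def)
      also have "\<dots> = l * (3 / (4 * pi) + 1 / 2)" by (simp add: field_simps)
      also have "\<dots> \<le> l * 1"
        using l pi_gt3 by (intro mult_left_mono) (auto simp: field_simps)
      finally have "(norm (1 - cnj \<alpha> * w))\<^sup>2 \<le> l\<^sup>2" by (intro power_mono) auto
      moreover have "0 < norm (1 - cnj \<alpha> * w)"
      proof -
        have "norm (cnj \<alpha> * w) < 1"
          using nw n\<alpha> \<rho> mult_le_less_imp_less[of "norm \<alpha>" 1 "norm w" 1] by (simp add: norm_mult)
            (metis mult_left_le_one_le norm_ge_zero le_less_trans less_imp_le)
        then show ?thesis by auto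
      qed
      moreover have "\<rho>\<^sup>2 \<le> \<rho>" using \<rho> by (simp add: power2_eq_square mult_left_le)
      ultimately have "(1 - \<rho>) / (2 * l\<^sup>2) \<le> ?k"
        unfolding n\<alpha> using \<rho> by (intro frac_le) auto
      then have "8 * pi * l * ((1 - \<rho>) / (2 * l\<^sup>2)) \<le> 8 * pi * l * ?k"
        using l by (intro mult_left_mono) auto
      moreover have "8 * pi * l * ((1 - \<rho>) / (2 * l\<^sup>2)) = 1"
        using l by (simp add: \<rho>_def power2_eq_square field_simps)
      ultimately have "1 \<le> 8 * pi * l * ?k" by linarith
      then have "1 * ?e \<le> 8 * pi * l * ?k * ?e"
        using e0 by (rule mult_right_mono)
      then have "ennreal ?e \<le> ennreal (8 * pi * l * (?k * ?e))"
          by (intro ennreal_leI) (simp only: mult_ac mult_1)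
      also have "\<dots> = ennreal (8 * pi * l) * ennreal (?k * ?e)"
        using l by (intro ennreal_mult') simp
      finally show ?thesis
        using nw True by (simp add: disc_energy)
    qed simp
  qed
  also have "\<dots> = ennreal (8 * pi * l) * disc_poisson \<Psi> \<alpha>"
    unfolding disc_poisson_def
    by (intro nn_integral_cmult disc_poisson_measurable \<Psi>)
  also have "\<dots> \<le> ennreal (8 * pi * l) * P"
    using P[of \<alpha>] n\<alpha> \<rho> by (intro mult_left_mono) auto
  also have "\<dots> = ennreal (measure lborel J) * (ennreal (8 * pi) * P)"
  proof -
    have "ennreal (8 * pi * l) = ennreal (8 * pi) * ennreal l" using l by (intro ennreal_mult) auto
    then show ?thesis unfolding uv(3) l_def by (simp only: mult_ac)
  qed
  finally show "(\<integral>\<^sup>+w\<in>hyp_domain.box disc_domain J. energy disc_domain \<Psi> w \<partial>lborel)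
      \<le> ennreal (measure lborel J) * (ennreal (8 * pi) * P)" .
qed

section \<open>The Cayley transformation\<close>

lemma add_ii_nonzero: "0 < Im z \<Longrightarrow> z + \<i> \<noteq> 0"
  by (auto simp: complex_eq_iff)

lemma norm_diff_add_ii: "(norm (z + \<i>))\<^sup>2 - (norm (z - \<i>))\<^sup>2 = 4 * Im z"
  unfolding cmod_power2 by (simp add: power2_eq_square algebra_simps)

lemma cayley_upper: "0 < Im z \<Longrightarrow> cayley z = (z - \<i>) / (z + \<i>)"
  by (simp add: cayley_def)

text \<open>
  Together with \<open>|K'(z)| = 2 / |z + \<i>|\<^sup>2\<close> this says that \<open>K\<close> is an isometry for the hyperbolic metrics.
\<close>

lemma one_minus_norm_cayley:
  assumes "0 < Im z"
  shows "1 - (norm (cayley z))\<^sup>2 = 4 * Im z / (norm (z + \<i>))\<^sup>2"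
proof -
  have "(norm (z + \<i>))\<^sup>2 \<noteq> 0" using add_ii_nonzero[OF assms] by simp
  moreover have "1 - n / N = (N - n) / N" if "N \<noteq> 0" for n N :: real
    using that by (simp add: field_simps)
  ultimately have "1 - (norm (cayley z))\<^sup>2 = ((norm (z + \<i>))\<^sup>2 - (norm (z - \<i>))\<^sup>2) / (norm (z + \<i>))\<^sup>2"
    by (simp only: cayley_upper[OF assms] norm_divide power_divide)
  then show ?thesis by (simp only: norm_diff_add_ii)
qed

lemma bij_betw_cayley: "bij_betw cayley upper_halfplane (ball 0 1)"
proof (rule bij_betw_byWitness[where f' = "\<lambda>w. \<i> * (1 + w) / (1 - w)"])
  show "\<forall>z\<in>upper_halfplane. \<i> * (1 + cayley z) / (1 - cayley z) = z"
  proof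
    fix z assume "z \<in> upper_halfplane"
    then have z: "0 < Im z" by simp
    have "1 - cayley z = 2 * \<i> / (z + \<i>)" "1 + cayley z = 2 * z / (z + \<i>)"
      using add_ii_nonzero[OF z] by (simp_all add: cayley_upper[OF z] field_simps)
    then show "\<i> * (1 + cayley z) / (1 - cayley z) = z"
      using add_ii_nonzero[OF z] by simp
  qed
  have *: "0 < Im (\<i> * (1 + w) / (1 - w))" "cayley (\<i> * (1 + w) / (1 - w)) = w" if w: "norm w < 1" for w
  proof -
    have w1: "1 - w \<noteq> 0" using w by auto
    have "\<i> * (1 + w) / (1 - w) = \<i> * (1 + w) * cnj (1 - w) / of_real ((norm (1 - w))\<^sup>2)"
      by (rule complex_div_cnj)
    moreover have "Im (\<i> * (1 + w) * cnj (1 - w)) = 1 - (norm w)\<^sup>2"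
      unfolding cmod_power2 by (simp add: algebra_simps power2_eq_square)
    ultimately have "Im (\<i> * (1 + w) / (1 - w)) = (1 - (norm w)\<^sup>2) / (norm (1 - w))\<^sup>2"
      by (metis Im_divide_of_real)
    moreover have "(norm w)\<^sup>2 < 1" using w by (simp add: abs_square_less_1)
    ultimately show pos: "0 < Im (\<i> * (1 + w) / (1 - w))" using w1 by simp
    have "\<i> * (1 + w) / (1 - w) - \<i> = 2 * \<i> * w / (1 - w)" "\<i> * (1 + w) / (1 - w) + \<i> = 2 * \<i> / (1 - w)"
      using w1 by (simp_all add: field_simps)
    then show "cayley (\<i> * (1 + w) / (1 - w)) = w"
      using w1 by (simp add: cayley_upper[OF pos])
  qed
  show "\<forall>w\<in>ball 0 1. cayley (\<i> * (1 + w) / (1 - w)) = w" using * by simp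
  show "(\<lambda>w. \<i> * (1 + w) / (1 - w)) ` ball 0 1 \<subseteq> upper_halfplane" using *(1) by auto
  show "cayley ` upper_halfplane \<subseteq> ball 0 1"
  proof
    fix w assume "w \<in> cayley ` upper_halfplane"
    then obtain z where z: "0 < Im z" "w = cayley z" by auto
    have "0 < 1 - (norm w)\<^sup>2"
      unfolding z(2) one_minus_norm_cayley[OF z(1)] using z add_ii_nonzero[of z] by simp
    then show "w \<in> ball 0 1" by (simp add: abs_square_less_1)
  qed
qed

lemma cayley_in_disc: "0 < Im z \<Longrightarrow> norm (cayley z) < 1"
  using bij_betw_cayley by (force simp: bij_betw_def)

lemma cayley_has_derivative:
  assumes "0 < Im z"
  shows "(cayley has_field_derivative (2 * \<i> / (z + \<i>)\<^sup>2)) (at z)"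
proof -
  have "((\<lambda>z. (z - \<i>) / (z + \<i>)) has_field_derivative (2 * \<i> / (z + \<i>)\<^sup>2)) (at z)"
    using add_ii_nonzero[OF assms]
    by (auto intro!: derivative_eq_intros simp: power2_eq_square field_simps)
  then show ?thesis
  proof (rule has_field_derivative_transform_within_open)
    show "(w - \<i>) / (w + \<i>) = cayley w" if "w \<in> upper_halfplane" for w
      using that cayley_upper by simp
  qed (use assms in auto)
qed

lemma cayley_holomorphic: "cayley holomorphic_on upper_halfplane"
  unfolding holomorphic_on_open[OF open_upper_halfplane]
  using cayley_has_derivative mem_upper_halfplane by blast

lemma nn_integral_cayley_substitution:
  assumes "set_borel_measurable borel (ball 0 1) F" "\<And>w. norm w < 1 \<Longrightarrow> 0 \<le> F w"
  shows "(\<integral>\<^sup>+w\<in>ball 0 1. ennreal (F w) \<partial>lborel)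
    = (\<integral>\<^sup>+z\<in>upper_halfplane. ennreal (F (cayley z) * (4 / (norm (z + \<i>)) ^ 4)) \<partial>lborel)"
proof -
  have im: "cayley ` upper_halfplane = ball 0 1"
    using bij_betw_cayley by (simp add: bij_betw_def)
  have "(\<integral>\<^sup>+w\<in>cayley ` upper_halfplane. ennreal (F w) \<partial>lborel)
    = (\<integral>\<^sup>+z\<in>upper_halfplane. ennreal (F (cayley z) * (norm (deriv cayley z))\<^sup>2) \<partial>lborel)"
    using bij_betw_cayley assms
    by (intro nn_integral_holomorphic_substitution cayley_holomorphic) (auto simp: bij_betw_def)
  also have "\<dots> = (\<integral>\<^sup>+z\<in>upper_halfplane. ennreal (F (cayley z) * (4 / (norm (z + \<i>)) ^ 4)) \<partial>lborel)"
    by (intro nn_integral_cong)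
      (auto simp: indicator_def DERIV_imp_deriv[OF cayley_has_derivative] norm_divide norm_mult norm_power
        power_divide power_mult_distrib power_mult[symmetric])
  finally show ?thesis by (simp only: im)
qed

text \<open>
  The function on the upper half-plane and its push-forward to the disc, treated symmetrically: either one
  determines the other.
\<close>

locale cayley_pair =
  fixes \<Phi> \<Psi> :: "complex \<Rightarrow> complex"
  assumes \<Phi>: "\<Phi> holomorphic_on upper_halfplane" and \<Psi>: "\<Psi> holomorphic_on ball 0 1"
    and \<Phi>\<Psi>: "\<And>z. 0 < Im z \<Longrightarrow> \<Phi> z = \<Psi> (cayley z)"
begin

abbreviation bmoa :: ennreal where
  "bmoa \<equiv> bmoa_sup (halfplane_domain upper_halfplane) \<Phi>"

lemma deriv_eq:
  assumes "0 < Im z"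
  shows "deriv \<Phi> z = deriv \<Psi> (cayley z) * (2 * \<i> / (z + \<i>)\<^sup>2)"
proof -
  have "((\<lambda>z. \<Psi> (cayley z)) has_field_derivative deriv \<Psi> (cayley z) * (2 * \<i> / (z + \<i>)\<^sup>2)) (at z)"
    using assms cayley_in_disc[OF assms]
    by (intro DERIV_chain2[OF holomorphic_derivI[OF \<Psi> open_ball] cayley_has_derivative]) auto
  then have "(\<Phi> has_field_derivative deriv \<Psi> (cayley z) * (2 * \<i> / (z + \<i>)\<^sup>2)) (at z)"
    by (rule has_field_derivative_transform_within_open[OF _ open_upper_halfplane]) (use assms \<Phi>\<Psi> in auto)
  then show ?thesis by (rule DERIV_imp_deriv)
qed

text \<open>
  The term \<open>2 \<Phi>' / (z + \<i>)\<close> is \<open>- \<Phi>' K'' / K'\<close>; it turns the second derivative on the half-plane into the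
  one on the disc.
\<close>

definition disc_deriv2 :: "complex \<Rightarrow> complex" where
  "disc_deriv2 z = deriv (deriv \<Phi>) z + 2 * deriv \<Phi> z / (z + \<i>)"

lemma disc_deriv2_eq:
  assumes "0 < Im z"
  shows "disc_deriv2 z = deriv (deriv \<Psi>) (cayley z) * (2 * \<i> / (z + \<i>)\<^sup>2)\<^sup>2"
proof -
  have d: "deriv \<Psi> holomorphic_on ball 0 1" by (intro holomorphic_deriv \<Psi> open_ball)
  let ?k = "\<lambda>z. 2 * \<i> / (z + \<i>)\<^sup>2"
  have k: "(?k has_field_derivative - 2 * ?k z / (z + \<i>)) (at z)"
    using add_ii_nonzero[OF assms]
    by (auto intro!: derivative_eq_intros simp: power2_eq_square divide_simps)
  have h: "((\<lambda>z. deriv \<Psi> (cayley z)) has_field_derivative deriv (deriv \<Psi>) (cayley z) * ?k z) (at z)"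
    using assms cayley_in_disc[OF assms]
    by (intro DERIV_chain2[OF holomorphic_derivI[OF d open_ball] cayley_has_derivative]) auto
  have "((\<lambda>z. deriv \<Psi> (cayley z) * ?k z) has_field_derivative
      deriv (deriv \<Psi>) (cayley z) * ?k z * ?k z + (- 2 * ?k z / (z + \<i>)) * deriv \<Psi> (cayley z)) (at z)"
    by (rule DERIV_mult[OF h k])
  then have "(deriv \<Phi> has_field_derivative
      deriv (deriv \<Psi>) (cayley z) * ?k z * ?k z + (- 2 * ?k z / (z + \<i>)) * deriv \<Psi> (cayley z)) (at z)"
    by (rule has_field_derivative_transform_within_open[OF _ open_upper_halfplane]) (use assms deriv_eq in auto)
  then have "deriv (deriv \<Phi>) z = deriv (deriv \<Psi>) (cayley z) * ?k z * ?k z + (- 2 * ?k z / (z + \<i>))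
      * deriv \<Psi> (cayley z)"
    by (rule DERIV_imp_deriv)
  moreover have "deriv \<Phi> z = deriv \<Psi> (cayley z) * ?k z" by (rule deriv_eq[OF assms])
  ultimately show ?thesis by (simp add: disc_deriv2_def power2_eq_square)
qed

text \<open>
  The identity \<open>|1 - cnj (K a) K z|\<^sup>2 = |z - cnj a|\<^sup>2 |K' a| |K' z|\<close> makes the kernel on the disc equal to the
  kernel on the half-plane divided by \<open>|K' z|\<close>, which compensates the factor by which the two measures
  differ.
\<close>

lemma poisson_cayley:
  assumes a: "0 < Im a"
  shows "disc_poisson \<Psi> (cayley a) = halfplane_poisson \<Phi> a"
proof -
  let ?F = "\<lambda>w. disc_kernel (cayley a) w * disc_mass \<Psi> w"
  note [measurable] = deriv_measurable_on[OF \<Psi> open_ball]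
  have "(\<lambda>w. ?F w * indicator (ball 0 1) w) \<in> borel_measurable borel"
    by (rule borel_measurable_times_indicator[where h = "\<lambda>w. disc_kernel (cayley a) w
        * ((1 - (norm w)\<^sup>2) / 2 * (norm (deriv \<Psi> w) * indicator (ball 0 1) w)\<^sup>2)"]; (measurable | simp))
  then have meas: "set_borel_measurable borel (ball 0 1) ?F"
    by (simp add: set_borel_measurable_def mult.commute)
  have "disc_poisson \<Psi> (cayley a) = (\<integral>\<^sup>+z\<in>upper_halfplane. ennreal (?F (cayley z)
      * (4 / (norm (z + \<i>)) ^ 4)) \<partial>lborel)"
    unfolding disc_poisson_def
  proof (rule nn_integral_cayley_substitution[OF meas])
    fix w :: complex assume "norm w < 1"
    then have "0 \<le> 1 - (norm w)\<^sup>2" "0 \<le> 1 - (norm (cayley a))\<^sup>2"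
      using cayley_in_disc[OF a] by (simp_all add: abs_square_le_1)
    then show "0 \<le> ?F w" by (intro mult_nonneg_nonneg divide_nonneg_nonneg) auto
  qed
  also have "\<dots> = halfplane_poisson \<Phi> a"
    unfolding halfplane_poisson_def
  proof (rule nn_integral_cong)
    fix z
    show "ennreal (?F (cayley z) * (4 / (norm (z + \<i>)) ^ 4)) * indicator upper_halfplane z
      = ennreal (halfplane_kernel a z * halfplane_mass \<Phi> z) * indicator upper_halfplane z"
    proof (cases "0 < Im z")
      case z: True
      define A Z m where "A = norm (a + \<i>)" and "Z = norm (z + \<i>)" and "m = norm (z - cnj a)"
      have pos: "0 < A" "0 < Z" using a z add_ii_nonzero by (auto simp: A_def Z_def)
      have "z - cnj a \<noteq> 0" using a z by (auto simp: complex_eq_iff)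
      then have m: "0 < m" by (simp add: m_def)
      have "cnj (a + \<i>) \<noteq> 0" using add_ii_nonzero[OF a] by (simp only: complex_cnj_zero_iff) simp
      then have "1 - cnj (cayley a) * cayley z = - 2 * \<i> * (z - cnj a) / (cnj (a + \<i>) * (z + \<i>))"
      proof -
        have eq: "1 - A / B * (C / D) = (B * D - A * C) / (B * D)" if "B \<noteq> 0" "D \<noteq> 0" for A B C D :: complex
          using that by (simp add: field_simps)
        have "cnj (cayley a) = cnj (a - \<i>) / cnj (a + \<i>)"
            by (simp only: cayley_upper[OF a] complex_cnj_divide)
        then have "1 - cnj (cayley a) * cayley z
            = (cnj (a + \<i>) * (z + \<i>) - cnj (a - \<i>) * (z - \<i>)) / (cnj (a + \<i>) * (z + \<i>))"
          by (simp only: cayley_upper[OF z] eq[OF \<open>cnj (a + \<i>) \<noteq> 0\<close> add_ii_nonzero[OF z]])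
        also have "cnj (a + \<i>) * (z + \<i>) - cnj (a - \<i>) * (z - \<i>) = - 2 * \<i> * (z - cnj a)"
          by (simp add: algebra_simps)
        finally show ?thesis .
      qed
      then have k: "norm (1 - cnj (cayley a) * cayley z) = 2 * m / (A * Z)"
        by (simp add: norm_mult norm_divide A_def Z_def m_def del: complex_cnj_add)
      have d: "norm (deriv \<Phi> z) = norm (deriv \<Psi> (cayley z)) * (2 / Z\<^sup>2)"
        using deriv_eq[OF z] by (simp add: norm_mult norm_divide norm_power Z_def)
      have "?F (cayley z) * (4 / Z ^ 4) = Im a / m\<^sup>2 * halfplane_mass \<Phi> z"
        unfolding k d one_minus_norm_cayley[OF a] one_minus_norm_cayley[OF z] A_def[symmetric] Z_def[symmetric]
        using pos m by (simp add: field_simps power2_eq_square power4_eq_xxxx)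
      then show ?thesis by (simp add: Z_def m_def)
    qed simp
  qed
  finally show ?thesis .
qed

lemma bmoa_disc_le: "bmoa_sup disc_domain \<Psi> \<le> ennreal (8 * pi) * (8 * bmoa)"
proof (rule disc_bmoa_le[OF \<Psi>])
  fix \<alpha> :: complex assume "norm \<alpha> < 1"
  then obtain a where "0 < Im a" "\<alpha> = cayley a"
    using bij_betw_cayley by (force simp: bij_betw_def)
  then show "disc_poisson \<Psi> \<alpha> \<le> 8 * bmoa"
    using poisson_cayley halfplane_poisson_le[OF \<Phi>] by simp
qed

lemma bmoa_halfplane_le: "bmoa \<le> 5 * (ennreal (8 * pi) * bmoa_sup disc_domain \<Psi>)"
proof (rule halfplane_bmoa_le[OF \<Phi>])
  fix a assume a: "0 < Im a"
  show "halfplane_poisson \<Phi> a \<le> ennreal (8 * pi) * bmoa_sup disc_domain \<Psi>"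
    using disc_poisson_le[OF \<Psi> cayley_in_disc[OF a]] by (simp only: poisson_cayley[OF a])
qed

end

section \<open>Growth of the derivative\<close>

text \<open>
  Functions of bounded mean oscillation are Bloch functions: the area mean value inequality on the ball of
  radius \<open>y / 2\<close> about \<open>z\<close>, which lies in a box over an interval of length \<open>2 y\<close>.
\<close>

lemma halfplane_deriv_bound:
  assumes \<Phi>: "\<Phi> holomorphic_on upper_halfplane" and z: "0 < Im z"
  shows "ennreal ((Im z * norm (deriv \<Phi> z))\<^sup>2) \<le> 6 * bmoa_sup (halfplane_domain upper_halfplane) \<Phi>"
proof -
  let ?X = "halfplane_domain upper_halfplane"
  let ?M = "bmoa_sup ?X \<Phi>"
  define y where "y = Im z"
  have y: "0 < y" using z by (simp add: y_def)
  let ?J = "{Re z - y..Re z + y}" and ?B = "ball z (y / 2)"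
  have B: "y / 2 < Im w" "Im w < 2 * y" "\<bar>Re w - Re z\<bar> < y" if "w \<in> ?B" for w
  proof -
    have "\<bar>Re w - Re z\<bar> < y / 2" "\<bar>Im w - y\<bar> < y / 2"
      using that abs_Re_le_cmod[of "w - z"] abs_Im_le_cmod[of "w - z"]
      by (auto simp: dist_norm norm_minus_commute y_def)
    then show "y / 2 < Im w" "Im w < 2 * y" "\<bar>Re w - Re z\<bar> < y" using y by linarith+
  qed
  have sub: "?B \<subseteq> upper_halfplane" using B y by (force dest: B(1))
  have "ennreal (y / 2) * ennreal (pi * (y / 2)\<^sup>2 * (norm (deriv \<Phi> z))\<^sup>2)
    \<le> ennreal (y / 2) * (\<integral>\<^sup>+w\<in>?B. ennreal ((norm (deriv \<Phi> w))\<^sup>2) \<partial>lborel)"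
    using y sub holomorphic_deriv[OF \<Phi> open_upper_halfplane]
    by (intro mult_left_mono area_mean_value) (auto intro: holomorphic_on_subset)
  also have "\<dots> = (\<integral>\<^sup>+w. ennreal (y / 2) * (ennreal ((norm (deriv \<Phi> w))\<^sup>2) * indicator ?B w) \<partial>lborel)"
  proof (rule nn_integral_cmult[symmetric])
    have "deriv \<Phi> holomorphic_on ?B"
      using holomorphic_deriv[OF \<Phi> open_upper_halfplane] sub by (rule holomorphic_on_subset)
    then have [measurable]: "(\<lambda>w. if w \<in> ?B then deriv \<Phi> w else 0) \<in> borel_measurable borel"
      by (intro borel_measurable_continuous_on_if) (auto intro: holomorphic_on_imp_continuous_on)
    have "(\<lambda>w. ennreal ((norm (if w \<in> ?B then deriv \<Phi> w else 0))\<^sup>2)) \<in> borel_measurable lborel"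
      by measurable
    also have "(\<lambda>w. ennreal ((norm (if w \<in> ?B then deriv \<Phi> w else 0))\<^sup>2))
        = (\<lambda>w. ennreal ((norm (deriv \<Phi> w))\<^sup>2) * indicator ?B w)"
      by (auto simp: indicator_def)
    finally show "(\<lambda>w. ennreal ((norm (deriv \<Phi> w))\<^sup>2) * indicator ?B w) \<in> borel_measurable lborel" .
  qed
  also have "\<dots> \<le> (\<integral>\<^sup>+w\<in>?B. energy ?X \<Phi> w \<partial>lborel)"
  proof (rule nn_integral_mono)
    fix w
    show "ennreal (y / 2) * (ennreal ((norm (deriv \<Phi> w))\<^sup>2) * indicator ?B w)
        \<le> energy ?X \<Phi> w * indicator ?B w"
    proof (cases "w \<in> ?B")
      case True
      then have "y / 2 * (norm (deriv \<Phi> w))\<^sup>2 \<le> Im w * (norm (deriv \<Phi> w))\<^sup>2"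
        using B(1)[OF True] by (intro mult_right_mono) auto
      moreover have "0 < Im w" using B(1)[OF True] y by simp
      ultimately show ?thesis
        using True y by (simp add: halfplane_energy ennreal_leI flip: ennreal_mult)
    qed simp
  qed
  also have "\<dots> \<le> ennreal (2 * y) * ?M"
  proof (rule box_energy_le[where J = ?J])
    show "?J \<in> bases ?X" using y by (simp add: halfplane_domain_def is_interval_cc)
    show "?B \<subseteq> hyp_domain.box ?X ?J"
    proof
      fix w assume w: "w \<in> ?B"
      show "w \<in> hyp_domain.box ?X ?J"
        using B[OF w] y by (auto simp: halfplane_domain_def abs_less_iff)
    qed
  qed (use y in auto)
  finally have *: "ennreal (y / 2) * ennreal (pi * (y / 2)\<^sup>2 * (norm (deriv \<Phi> z))\<^sup>2) \<le> ennreal (2 * y) * ?M" .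
  have "ennreal ((y * norm (deriv \<Phi> z))\<^sup>2)
      = ennreal (8 / (pi * y)) * (ennreal (y / 2) * ennreal (pi * (y / 2)\<^sup>2 * (norm (deriv \<Phi> z))\<^sup>2))"
    using y by (simp add: power2_eq_square field_simps flip: ennreal_mult)
  also have "\<dots> \<le> ennreal (8 / (pi * y)) * (ennreal (2 * y) * ?M)"
    by (rule mult_left_mono[OF *]) simp
  also have "\<dots> = ennreal (16 / pi) * ?M"
    using y by (simp add: mult.assoc[symmetric] flip: ennreal_mult)
  also have "\<dots> \<le> ennreal 6 * ?M"
    using pi_gt3 by (intro mult_right_mono ennreal_leI) (auto simp: field_simps)
  finally show ?thesis by (simp add: y_def)
qed

lemma norm_increment_le_segment:
  fixes F :: "complex \<Rightarrow> complex"
  assumes F: "F holomorphic_on S" "open S" and ab: "a \<le> b"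
    and seg: "\<And>s. a \<le> s \<Longrightarrow> s \<le> b \<Longrightarrow> c + of_real s * d \<in> S"
  shows "ennreal (norm (F (c + of_real b * d) - F (c + of_real a * d)))
    \<le> (\<integral>\<^sup>+s\<in>{a..b}. ennreal (norm (deriv F (c + of_real s * d)) * norm d) \<partial>lborel)"
proof -
  let ?\<gamma> = "\<lambda>s. c + of_real s * d"
  have I: "((\<lambda>s. deriv F (?\<gamma> s) * d) has_integral (F (?\<gamma> b) - F (?\<gamma> a))) {a..b}"
  proof (rule fundamental_theorem_of_calculus[OF ab])
    fix s assume s: "s \<in> {a..b}"
    have "((\<lambda>w. c + w * d) has_field_derivative d) (at (of_real s))"
      by (auto intro!: derivative_eq_intros)
    then have "((\<lambda>w. F (c + w * d)) has_field_derivative deriv F (?\<gamma> s) * d) (at (of_real s))"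
      using s seg by (intro DERIV_chain2[OF holomorphic_derivI[OF F]]) auto
    then show "((\<lambda>s. F (?\<gamma> s)) has_vector_derivative deriv F (?\<gamma> s) * d) (at s within {a..b})"
      by (rule has_vector_derivative_real_field)
  qed
  have "continuous_on {a..b} (\<lambda>s. deriv F (?\<gamma> s))"
    using holomorphic_on_imp_continuous_on[OF holomorphic_deriv[OF F]] seg
    by (intro continuous_on_compose2[of S "deriv F" "{a..b}" ?\<gamma>] continuous_intros) auto
  then have N: "(\<lambda>s. norm (deriv F (?\<gamma> s)) * norm d) integrable_on {a..b}"
    by (intro integrable_continuous_real continuous_intros)
  have "norm (F (?\<gamma> b) - F (?\<gamma> a)) \<le> integral {a..b} (\<lambda>s. norm (deriv F (?\<gamma> s)) * norm d)"
    using I N integral_norm_bound_integral[of "\<lambda>s. deriv F (?\<gamma> s) * d" "{a..b}" "\<lambda>s. norm (deriv F (?\<gamma> s))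
        * norm d"]
    by (simp add: has_integral_iff norm_mult)
  also have "ennreal \<dots> = (\<integral>\<^sup>+s\<in>{a..b}. ennreal (norm (deriv F (?\<gamma> s)) * norm d) \<partial>lborel)"
    using nn_integral_has_integral_lebesgue'[OF _ integrable_integral[OF N]] by simp
  finally show ?thesis by (simp add: ennreal_leI)
qed

lemma powr_add_le:
  fixes a b p :: real
  assumes "0 \<le> a" "0 \<le> b" "0 \<le> p"
  shows "(a + b) powr p \<le> 2 powr p * (a powr p + b powr p)"
proof -
  have "(a + b) powr p \<le> (2 * max a b) powr p" using assms by (intro powr_mono2) auto
  also have "\<dots> = 2 powr p * max a b powr p" using assms by (simp add: powr_mult)
  also have "\<dots> \<le> 2 powr p * (a powr p + b powr p)"
    by (intro mult_left_mono) (auto simp: max_def)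
  finally show ?thesis .
qed

text \<open>
  The shell \<open>2\<^sup>k \<le> |z + \<i>| < 2\<^bsup>k+1\<^esup>\<close> has area at most \<open>4 \<pi> 4\<^sup>k\<close>, and the integrand is at most \<open>8\<^bsup>-k\<^esup>\<close> there.
\<close>

lemma nn_integral_halfplane_decay:
  "(\<integral>\<^sup>+z\<in>upper_halfplane. ennreal (1 / norm (z + \<i>) ^ 3) \<partial>lborel) \<le> ennreal (8 * pi)"
proof -
  have "(\<integral>\<^sup>+z\<in>upper_halfplane. ennreal (1 / norm (z + \<i>) ^ 3) \<partial>lborel) \<le> ennreal (4 * pi) * 2"
  proof (rule nn_integral_dyadic_shells[where q = "\<lambda>z. norm (z + \<i>)" and C = "\<lambda>k. ennreal ((1 / 8) ^ k)"])
    show "1 \<le> norm (z + \<i>)" if "(indicator upper_halfplane z :: ennreal) \<noteq> 0" for z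
      using that abs_Im_le_cmod[of "z + \<i>"] by (auto simp: indicator_def split: if_splits)
  next
    fix z k assume "2 ^ k \<le> norm (z + \<i>)"
    then have "(2 ^ k) ^ 3 \<le> norm (z + \<i>) ^ 3" by (intro power_mono) auto
    moreover have "(2 ^ k) ^ 3 = (8 :: real) ^ k" 
      using power_mult[of "2 :: real" k 3] power_mult[of "2 :: real" 3 k] by (simp add: mult.commute)
    ultimately have "1 / norm (z + \<i>) ^ 3 \<le> 1 / 8 ^ k" by (intro frac_le) auto
    then show "ennreal (1 / norm (z + \<i>) ^ 3) \<le> ennreal ((1 / 8) ^ k)"
      by (intro ennreal_leI) (simp add: power_one_over)
  next
    fix k :: nat
    let ?I = "\<integral>\<^sup>+z. indicator upper_halfplane z
        * indicator {z \<in> space lborel. norm (z + \<i>) < 2 ^ (k + 1)} z \<partial>lborel"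
    have "?I \<le> (\<integral>\<^sup>+z. indicator (ball (- \<i>) (2 ^ (k + 1))) z \<partial>lborel)"
      by (intro nn_integral_mono) (auto simp: indicator_def dist_norm norm_minus_commute add.commute)
    also have "\<dots> = ennreal (pi * (2 ^ (k + 1))\<^sup>2)"
      by (simp add: emeasure_ball unit_ball_vol_2)
    finally have "ennreal ((1 / 8) ^ k) * ?I
      \<le> ennreal ((1 / 8) ^ k) * ennreal (pi * (2 ^ (k + 1))\<^sup>2)"
      by (rule mult_left_mono) simp
    also have "\<dots> = ennreal (4 * pi) * ennreal ((1 / 2) ^ k)"
    proof -
      have "(1 / 8) ^ k * (pi * (2 ^ (k + 1))\<^sup>2) = 4 * pi * (1 / 2 :: real) ^ k"
        by (simp add: power2_eq_square field_simps flip: power_mult_distrib)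
      then show ?thesis by (simp flip: ennreal_mult)
    qed
    finally show "ennreal ((1 / 8) ^ k) * ?I
      \<le> ennreal (4 * pi) * ennreal ((1 / 2) ^ k)" .
  qed measurable
  also have "\<dots> = ennreal (8 * pi)" by (simp flip: ennreal_numeral ennreal_mult)
  finally show ?thesis .
qed

section \<open>From the half-plane to the disc\<close>

text \<open>
  The weight is the hyperbolic area \<open>dx dy / y\<^sup>2\<close> times the factor \<open>y\<^bsup>2p\<^esup>\<close> that makes the second derivative
  invariant.
\<close>

definition power_integral :: "real \<Rightarrow> (complex \<Rightarrow> real) \<Rightarrow> ennreal" where
  "power_integral p f = (\<integral>\<^sup>+z\<in>upper_halfplane. ennreal (Im z powr (2 * p - 2) * f z powr p) \<partial>lborel)"

lemma power_integral_measurable: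
  assumes "(\<lambda>z. f z * indicator upper_halfplane z) \<in> borel_measurable borel"
  shows "(\<lambda>z. ennreal (Im z powr (2 * p - 2) * f z powr p) * indicator upper_halfplane z)
      \<in> borel_measurable lborel"
proof -
  note assms [measurable]
  show ?thesis
    unfolding measurable_lborel2
    by (rule borel_measurable_times_indicator[where h = "\<lambda>z. ennreal (Im z powr (2 * p - 2) *
        (f z * indicator upper_halfplane z) powr p)"]; (measurable | simp))
qed

lemma power_integral_add_le:
  assumes "(\<lambda>z. g z * indicator upper_halfplane z) \<in> borel_measurable borel"
    and "(\<lambda>z. h z * indicator upper_halfplane z) \<in> borel_measurable borel"
    and f: "\<And>z. 0 < Im z \<Longrightarrow> 0 \<le> f z \<and> 0 \<le> g z \<and> 0 \<le> h z \<and> f z \<le> c * (g z + h z)"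
    and "0 \<le> c" "0 \<le> p"
  shows "power_integral p f \<le> ennreal ((2 * c) powr p) * (power_integral p g + power_integral p h)"
proof -
  let ?W = "\<lambda>f z. ennreal (Im z powr (2 * p - 2) * f z powr p) * indicator upper_halfplane z"
  note meas = power_integral_measurable[OF assms(1)] power_integral_measurable[OF assms(2)]
  have "power_integral p f \<le> (\<integral>\<^sup>+z. ennreal ((2 * c) powr p) * (?W g z + ?W h z) \<partial>lborel)"
    unfolding power_integral_def
  proof (rule nn_integral_mono)
    fix z
    show "?W f z \<le> ennreal ((2 * c) powr p) * (?W g z + ?W h z)"
    proof (cases "0 < Im z")
      case True
      have "f z powr p \<le> (c * (g z + h z)) powr p" using f[OF True] assms by (intro powr_mono2) auto
      also have "\<dots> = c powr p * (g z + h z) powr p" using f[OF True] assms by (intro powr_mult)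
      also have "\<dots> \<le> c powr p * (2 powr p * (g z powr p + h z powr p))"
        using f[OF True] assms by (intro mult_left_mono powr_add_le) auto
      also have "\<dots> = (2 * c) powr p * (g z powr p + h z powr p)"
        using assms by (simp add: powr_mult)
      finally have "Im z powr (2 * p - 2) * f z powr p
          \<le> Im z powr (2 * p - 2) * ((2 * c) powr p * (g z powr p + h z powr p))"
        by (rule mult_left_mono) simp
      then show ?thesis
        using True by (simp add: algebra_simps ennreal_leI flip: ennreal_mult ennreal_plus)
    qed simp
  qed
  also have "\<dots> = ennreal ((2 * c) powr p) * (power_integral p g + power_integral p h)"
    unfolding power_integral_def
    by (subst nn_integral_cmult) (use meas in \<open>auto simp: nn_integral_add\<close>)
  finally show ?thesis .
qed

lemma hyperbolic_weight:
  fixes y n p :: real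
  assumes "0 < y" "0 \<le> n"
  shows "(n * y\<^sup>2) powr p / y\<^sup>2 = y powr (2 * p - 2) * n powr p"
proof -
  have "(y\<^sup>2) powr p = y powr (2 * p)" using assms by (simp add: powr_powr flip: powr_numeral)
  moreover have "y powr (2 * p - 2) = y powr (2 * p) / y\<^sup>2" using assms by (simp add: powr_diff)
  ultimately show ?thesis using assms by (simp add: powr_mult)
qed

lemma besov_integral_halfplane:
  "besov_integral (halfplane_domain upper_halfplane) p \<Phi> = power_integral p (\<lambda>z. norm (deriv (deriv \<Phi>) z))"
proof -
  have "(norm (deriv (deriv \<Phi>) z) / (1 / \<bar>Im z\<bar>)\<^sup>2) powr p * (1 / \<bar>Im z\<bar>)\<^sup>2
     = Im z powr (2 * p - 2) * norm (deriv (deriv \<Phi>) z) powr p" if "0 < Im z" for z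
    using hyperbolic_weight[OF that, of "norm (deriv (deriv \<Phi>) z)" p] that by (simp add: power_one_over)
  then show ?thesis
    unfolding besov_integral_def power_integral_def halfplane_domain_def
    by (intro nn_integral_cong) (simp add: indicator_def)
qed

text \<open>
  The probability measure \<open>ds / s\<^sup>2\<close> on \<open>[1, \<infinity>)\<close> for averages along rays to infinity; its density cancels
  the factor \<open>s\<^sup>2\<close> of the Hardy inequality.
\<close>

lemma inverse_square_measure:
  fixes f :: "real \<Rightarrow> ennreal"
  defines "\<mu> \<equiv> Nonnegative_Lebesgue_Integration.density lborel (\<lambda>s::real. ennreal (1 / s\<^sup>2)
      * indicator {1..} s)"
  shows "sets \<mu> = sets borel" "emeasure \<mu> (space \<mu>) = 1" "AE s in \<mu>. 1 \<le> s"
    "f \<in> borel_measurable borel \<Longrightarrow> (\<integral>\<^sup>+s. ennreal (s\<^sup>2) * f s \<partial>\<mu>) = (\<integral>\<^sup>+s\<in>{1..}. f s \<partial>lborel)"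
proof -
  have [measurable]: "(\<lambda>s::real. ennreal (1 / s\<^sup>2) * indicator {1..} s) \<in> borel_measurable lborel"
      by measurable
  show "sets \<mu> = sets borel" by (simp add: \<mu>_def)
  have "((\<lambda>s::real. - (1 / s)) \<longlongrightarrow> - 0) at_top"
    by (intro tendsto_minus tendsto_divide_0[OF tendsto_const] filterlim_at_top_imp_at_infinity filterlim_ident)
  then have "(\<integral>\<^sup>+s. ennreal (1 / s\<^sup>2) * indicator {1..} s \<partial>lborel) = ennreal (- 0 - (- (1 / 1)))"
    by (intro nn_integral_FTC_atLeast) (auto intro!: derivative_eq_intros simp: power2_eq_square divide_simps)
  then show "emeasure \<mu> (space \<mu>) = 1"
    unfolding \<mu>_def by (subst emeasure_density) (auto simp: mult.assoc)
  show "AE s in \<mu>. 1 \<le> s"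
    unfolding \<mu>_def by (subst AE_density) (auto simp: indicator_def split: if_splits)
  assume [measurable]: "f \<in> borel_measurable borel"
  have "(\<integral>\<^sup>+s. ennreal (s\<^sup>2) * f s \<partial>\<mu>) = (\<integral>\<^sup>+s. (ennreal (1 / s\<^sup>2) * indicator {1..} s) *
      (ennreal (s\<^sup>2) * f s) \<partial>lborel)"
    unfolding \<mu>_def by (rule nn_integral_density) measurable
  also have "\<dots> = (\<integral>\<^sup>+s\<in>{1..}. f s \<partial>lborel)"
    by (intro nn_integral_cong)
      (auto simp: indicator_def mult.assoc[symmetric] simp flip: ennreal_mult)
  finally show "(\<integral>\<^sup>+s. ennreal (s\<^sup>2) * f s \<partial>\<mu>) = (\<integral>\<^sup>+s\<in>{1..}. f s \<partial>lborel)" .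
qed

lemma uniform_measure:
  fixes f :: "real \<Rightarrow> ennreal"
  defines "\<mu> \<equiv> Nonnegative_Lebesgue_Integration.density lborel (\<lambda>s::real. indicator {0<..1} s)"
  shows "sets \<mu> = sets borel" "emeasure \<mu> (space \<mu>) = 1" "AE s in \<mu>. 0 < s \<and> s \<le> 1"
    "f \<in> borel_measurable borel \<Longrightarrow> (\<integral>\<^sup>+s. f s \<partial>\<mu>) = (\<integral>\<^sup>+s\<in>{0<..1}. f s \<partial>lborel)"
proof -
  show "sets \<mu> = sets borel" by (simp add: \<mu>_def)
  show "emeasure \<mu> (space \<mu>) = 1"
    unfolding \<mu>_def by (subst emeasure_density) auto
  show "AE s in \<mu>. 0 < s \<and> s \<le> 1"
    unfolding \<mu>_def by (subst AE_density) (auto simp: indicator_def split: if_splits)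
  assume [measurable]: "f \<in> borel_measurable borel"
  show "(\<integral>\<^sup>+s. f s \<partial>\<mu>) = (\<integral>\<^sup>+s\<in>{0<..1}. f s \<partial>lborel)"
    unfolding \<mu>_def by (subst nn_integral_density) (auto simp: mult.commute)
qed

context cayley_pair
begin

text \<open>
  Since \<open>K\<close> is a hyperbolic isometry, the substitution \<open>w = K z\<close> turns the density, the area and the weight of
  the second derivative into those of the half-plane.
\<close>

lemma besov_integral_disc: "besov_integral disc_domain p \<Psi> = power_integral p (\<lambda>z. norm (disc_deriv2 z))"
proof -
  let ?d = "\<lambda>w. 2 / (1 - (norm w)\<^sup>2)"
  let ?F = "\<lambda>w. (norm (deriv (deriv \<Psi>) w) / (?d w)\<^sup>2) powr p * (?d w)\<^sup>2"
  note [measurable] = deriv_measurable_on[OF holomorphic_deriv[OF \<Psi> open_ball] open_ball]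
  have "(\<lambda>w. ?F w * indicator (ball 0 1) w) \<in> borel_measurable borel"
    by (rule borel_measurable_times_indicator[where h = "\<lambda>w. (norm (deriv (deriv \<Psi>) w)
        * indicator (ball 0 1) w / (?d w)\<^sup>2) powr p
        * (?d w)\<^sup>2"]; (measurable | simp))
  then have meas: "set_borel_measurable borel (ball 0 1) ?F"
      by (simp add: set_borel_measurable_def mult.commute)
  have "besov_integral disc_domain p \<Psi> = (\<integral>\<^sup>+w\<in>ball 0 1. ennreal (?F w) \<partial>lborel)"
    by (simp add: besov_integral_def disc_domain_def)
  also have "\<dots> = (\<integral>\<^sup>+z\<in>upper_halfplane. ennreal (?F (cayley z) * (4 / (norm (z + \<i>)) ^ 4)) \<partial>lborel)"
    by (rule nn_integral_cayley_substitution[OF meas]) simp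
  also have "\<dots> = power_integral p (\<lambda>z. norm (disc_deriv2 z))"
    unfolding power_integral_def
  proof (rule nn_integral_cong)
    fix z
    show "ennreal (?F (cayley z) * (4 / (norm (z + \<i>)) ^ 4)) * indicator upper_halfplane z
       = ennreal (Im z powr (2 * p - 2) * norm (disc_deriv2 z) powr p) * indicator upper_halfplane z"
    proof (cases "0 < Im z")
      case z: True
      define Z where "Z = norm (z + \<i>)"
      have Z: "0 < Z" using add_ii_nonzero[OF z] by (simp add: Z_def)
      have d: "?d (cayley z) = Z\<^sup>2 / (2 * Im z)"
        using one_minus_norm_cayley[OF z] by (simp add: Z_def)
      have g: "norm (deriv (deriv \<Psi>) (cayley z)) = norm (disc_deriv2 z) * Z ^ 4 / 4"
      proof -
        have "norm (disc_deriv2 z) = norm (deriv (deriv \<Psi>) (cayley z)) * (2 / Z\<^sup>2)\<^sup>2"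
          unfolding disc_deriv2_eq[OF z] by (simp add: norm_mult norm_power norm_divide Z_def)
        then show ?thesis using Z by (simp add: field_simps power2_eq_square power4_eq_xxxx)
      qed
      have 1: "norm (deriv (deriv \<Psi>) (cayley z)) / (?d (cayley z))\<^sup>2 = norm (disc_deriv2 z) * (Im z)\<^sup>2"
        unfolding d g using Z z by (simp add: field_simps power2_eq_square power4_eq_xxxx)
      have 2: "(?d (cayley z))\<^sup>2 * (4 / Z ^ 4) = 1 / (Im z)\<^sup>2"
        unfolding d using Z z by (simp add: field_simps power2_eq_square power4_eq_xxxx)
      have "?F (cayley z) * (4 / Z ^ 4) = (norm (deriv (deriv \<Psi>) (cayley z)) / (?d (cayley z))\<^sup>2) powr p
          * ((?d (cayley z))\<^sup>2 * (4 / Z ^ 4))"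
        by (simp only: mult.assoc)
      also have "\<dots> = (norm (disc_deriv2 z) * (Im z)\<^sup>2) powr p / (Im z)\<^sup>2"
        unfolding 1 2 by simp
      finally have "?F (cayley z) * (4 / Z ^ 4) = (norm (disc_deriv2 z) * (Im z)\<^sup>2) powr p / (Im z)\<^sup>2" .
      also have "\<dots> = Im z powr (2 * p - 2) * norm (disc_deriv2 z) powr p"
        by (rule hyperbolic_weight[OF z]) simp
      finally show ?thesis by (simp add: Z_def)
    qed simp
  qed
  finally show ?thesis .
qed

lemma deriv_holomorphic: "deriv \<Phi> holomorphic_on upper_halfplane"
    "deriv (deriv \<Phi>) holomorphic_on upper_halfplane"
  by (intro holomorphic_deriv \<Phi> open_upper_halfplane)+

lemma disc_deriv2_holomorphic: "disc_deriv2 holomorphic_on upper_halfplane"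
  unfolding disc_deriv2_def using add_ii_nonzero by (intro holomorphic_intros deriv_holomorphic) auto

lemma holomorphic_measurable:
  assumes "f holomorphic_on upper_halfplane"
  shows "(\<lambda>z. norm (f z) * indicator upper_halfplane z) \<in> borel_measurable borel"
proof -
  have "(\<lambda>z. norm (if z \<in> upper_halfplane then f z else 0)) \<in> borel_measurable borel"
    using assms by (intro measurable_compose[OF _ borel_measurable_norm] borel_measurable_continuous_on_if)
      (auto intro: holomorphic_on_imp_continuous_on)
  then show ?thesis by (rule borel_measurable_times_indicator) simp_all
qed

text \<open>
  Half of the modulus of the first order term by which the two second derivatives differ.
\<close>

definition first_order :: "complex \<Rightarrow> real" where "first_order z = norm (deriv \<Phi> z / (z + \<i>))"

lemma first_order_measurable: "(\<lambda>z. first_order z * indicator upper_halfplane z) \<in> borel_measurable borel"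
  unfolding first_order_def using add_ii_nonzero
      by (intro holomorphic_measurable holomorphic_intros deriv_holomorphic) auto

lemma deriv_le_of_bmoa:
  assumes fin: "bmoa < \<infinity>" and z: "0 < Im z"
  shows "Im z * norm (deriv \<Phi> z) \<le> sqrt 6 * sqrt (enn2real bmoa)"
proof -
  let ?M = "bmoa"
  have "ennreal ((Im z * norm (deriv \<Phi> z))\<^sup>2) \<le> 6 * ?M" by (rule halfplane_deriv_bound[OF \<Phi> z])
  also have "6 * ?M = ennreal (6 * enn2real ?M)"
    using fin by (subst ennreal_mult) auto
  finally have "(Im z * norm (deriv \<Phi> z))\<^sup>2 \<le> 6 * enn2real ?M"
    by (subst (asm) ennreal_le_iff) auto
  then show ?thesis by (simp add: real_le_rsqrt flip: real_sqrt_mult)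
qed

text \<open>
  Along the ray \<open>- \<i> + s (z + \<i>)\<close> the imaginary part tends to infinity, so the derivative vanishes in the
  limit by the Bloch bound.
\<close>

lemma deriv_le_ray_integral:
  assumes fin: "bmoa < \<infinity>" and z: "0 < Im z"
  shows "ennreal (norm (deriv \<Phi> z)) \<le> (\<integral>\<^sup>+s\<in>{1..}. ennreal (norm (deriv (deriv \<Phi>) (- \<i> + of_real s
      * (z + \<i>))) * norm (z + \<i>)) \<partial>lborel)"
    (is "_ \<le> ?I")
proof (rule ennreal_le_epsilon)
  fix e :: real assume e: "0 < e"
  define C where "C = sqrt 6 * sqrt (enn2real bmoa)"
  have C: "0 \<le> C" by (simp add: C_def)
  \<comment> \<open>so far out on the ray the Bloch bound is at most \<open>e\<close>\<close>
  define N where "N = max 1 (C / (e * Im z))"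
  let ?T = "\<lambda>s. - \<i> + of_real s * (z + \<i>)"
  have im: "s * Im z \<le> Im (?T s)" if "1 \<le> s" for s using that by (simp add: algebra_simps)
  have N: "1 \<le> N" "C \<le> e * (N * Im z)" using e z by (auto simp: N_def field_simps max_def)
  have pos: "0 < Im (?T s)" if "1 \<le> s" for s
    using im[OF that] z that by (meson less_le_trans mult_pos_pos zero_less_one)
  have "Im (?T N) * norm (deriv \<Phi> (?T N)) \<le> C"
    unfolding C_def by (rule deriv_le_of_bmoa[OF fin pos[OF N(1)]])
  also have "C \<le> e * Im (?T N)" using N(2) im[OF N(1)] e by (smt (verit) mult_left_mono)
  finally have small: "norm (deriv \<Phi> (?T N)) \<le> e" using pos[OF N(1)] by (simp add: mult.commute)
  have T1: "?T 1 = z" by simp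
  have "ennreal (norm (deriv \<Phi> (?T N) - deriv \<Phi> (?T 1)))
     \<le> (\<integral>\<^sup>+s\<in>{1..N}. ennreal (norm (deriv (deriv \<Phi>) (?T s)) * norm (z + \<i>)) \<partial>lborel)"
    using pos by (intro norm_increment_le_segment[OF deriv_holomorphic(1) open_upper_halfplane N(1)]) simp
  also have "\<dots> \<le> ?I" by (intro nn_integral_mono) (auto simp: indicator_def)
  finally have inc: "ennreal (norm (deriv \<Phi> (?T N) - deriv \<Phi> z)) \<le> ?I" unfolding T1 .
  have "norm (deriv \<Phi> z) \<le> norm (deriv \<Phi> (?T N) - deriv \<Phi> z) + e"
    using norm_triangle_ineq4[of "deriv \<Phi> (?T N)" "deriv \<Phi> (?T N) - deriv \<Phi> z"] small by simp
  then have "ennreal (norm (deriv \<Phi> z)) \<le> ennreal (norm (deriv \<Phi> (?T N) - deriv \<Phi> z)) + ennreal e"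
    using e by (simp add: ennreal_leI flip: ennreal_plus)
  also have "\<dots> \<le> ?I + ennreal e" by (intro add_right_mono inc)
  finally show "ennreal (norm (deriv \<Phi> z)) \<le> ?I + ennreal e" .
qed

text \<open>
  Dividing the integral of \<open>\<Phi>''\<close> along the ray by \<open>|z + \<i>|\<close> exhibits \<open>\<Phi>' / (z + \<i>)\<close> as bounded by an average
  of dilates of \<open>|\<Phi>''|\<close> about \<open>- \<i>\<close>. The ratios are at least 1 and the centre lies below the real line, so
  the Hardy inequality applies.
\<close>

lemma power_integral_first_order_le:
  assumes fin: "bmoa < \<infinity>" and p: "1 \<le> p"
  shows "power_integral p first_order \<le> power_integral p (\<lambda>z. norm (deriv (deriv \<Phi>) z))"
proof -
  define g where "g z = norm (deriv (deriv \<Phi>) z) * indicator upper_halfplane z" for z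
  have g [measurable]: "g \<in> borel_measurable borel"
    unfolding g_def by (rule holomorphic_measurable[OF deriv_holomorphic(2)])
  let ?\<mu> = "Nonnegative_Lebesgue_Integration.density lborel (\<lambda>s::real. ennreal (1 / s\<^sup>2) * indicator {1..} s)"
  have "power_integral p first_order \<le> power_integral p g"
    unfolding power_integral_def
  proof (rule dilation_averages_contract[where \<mu> = ?\<mu> and c = "- \<i>"])
    show "sets ?\<mu> = sets borel" "emeasure ?\<mu> (space ?\<mu>) = 1" by (rule inverse_square_measure)+
    show "AE s in ?\<mu>. 0 < s \<and> 0 \<le> (1 - s) * Im (- \<i>)"
      using inverse_square_measure(3) by eventually_elim simp
    fix z assume z: "0 < Im z"
    let ?T = "\<lambda>s. - \<i> + of_real s * (z - - \<i>)"
    have [measurable]: "(\<lambda>s::real. ?T s) \<in> borel_measurable borel"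
      by (intro borel_measurable_continuous_onI continuous_intros)
    have nz: "0 < norm (z + \<i>)" using add_ii_nonzero[OF z] by simp
    have T: "0 < Im (?T s)" if "1 \<le> s" for s
      using that z by (intro Im_dilation_pos) auto
    have "ennreal (norm (z + \<i>)) * ennreal (first_order z) = ennreal (norm (deriv \<Phi> z))"
      using nz by (simp add: first_order_def norm_divide flip: ennreal_mult)
    also have "\<dots> \<le> (\<integral>\<^sup>+s\<in>{1..}. ennreal (norm (deriv (deriv \<Phi>) (- \<i> + of_real s * (z + \<i>)))
        * norm (z + \<i>)) \<partial>lborel)"
      by (rule deriv_le_ray_integral[OF fin z])
    also have "\<dots> = (\<integral>\<^sup>+s. ennreal (norm (z + \<i>)) * (ennreal (g (?T s)) * indicator {1..} s) \<partial>lborel)"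
      using T by (intro nn_integral_cong) (simp add: g_def indicator_def mult.commute flip: ennreal_mult)
    also have "\<dots> = ennreal (norm (z + \<i>)) * (\<integral>\<^sup>+s\<in>{1..}. ennreal (g (?T s)) \<partial>lborel)"
      by (rule nn_integral_cmult) measurable
    also have "(\<integral>\<^sup>+s\<in>{1..}. ennreal (g (?T s)) \<partial>lborel) = (\<integral>\<^sup>+s. ennreal (s\<^sup>2) * ennreal (g (?T s)) \<partial>?\<mu>)"
      by (rule inverse_square_measure(4)[symmetric]) measurable
    finally have "ennreal (norm (z + \<i>)) * ennreal (first_order z)
        \<le> ennreal (norm (z + \<i>)) * (\<integral>\<^sup>+s. ennreal (s\<^sup>2) * ennreal (g (?T s)) \<partial>?\<mu>)" .
    then have "ennreal (first_order z) \<le> (\<integral>\<^sup>+s. ennreal (s\<^sup>2) * ennreal (g (?T s)) \<partial>?\<mu>)"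
      using nz by (subst (asm) ennreal_mult_le_mult_iff) auto
    then show "ennreal (first_order z) \<le> (\<integral>\<^sup>+s. ennreal (s\<^sup>2 * g (?T s)) \<partial>?\<mu>)"
      by (simp add: ennreal_mult g_def)
  next
    show "0 \<le> g z" for z by (simp add: g_def)
  qed (use p g in \<open>auto simp: first_order_def\<close>)
  also have "\<dots> = power_integral p (\<lambda>z. norm (deriv (deriv \<Phi>) z))"
    unfolding power_integral_def by (intro nn_integral_cong) (auto simp: g_def indicator_def)
  finally show ?thesis .
qed

lemma power_integral_up_to_first_order:
  assumes g: "g holomorphic_on upper_halfplane" and p: "0 \<le> p"
    and le: "\<And>z. norm (f z) \<le> norm (g z) + 2 * first_order z"
  shows "power_integral p (\<lambda>z. norm (f z))
      \<le> ennreal (4 powr p) * (power_integral p (\<lambda>z. norm (g z)) + power_integral p first_order)"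
proof -
  have "power_integral p (\<lambda>z. norm (f z))
      \<le> ennreal ((2 * 2) powr p) * (power_integral p (\<lambda>z. norm (g z)) + power_integral p first_order)"
  proof (rule power_integral_add_le[OF holomorphic_measurable[OF g] first_order_measurable])
    fix z
    have "x \<le> 2 * (d + v)" if "x \<le> d + 2 * v" "0 \<le> d" for x d v :: real using that by simp
    from this[OF le norm_ge_zero]
    show "0 \<le> norm (f z) \<and> 0 \<le> norm (g z) \<and> 0 \<le> first_order z \<and> norm (f z) \<le> 2 * (norm (g z) + first_order z)"
      by (simp add: first_order_def)
  qed (use p in auto)
  then show ?thesis by simp
qed

lemma besov_disc_le:
  assumes fin: "bmoa < \<infinity>" and p: "1 \<le> p"
  shows "besov_integral disc_domain p \<Psi> \<le> ennreal (2 * 4 powr p)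
      * besov_integral (halfplane_domain upper_halfplane) p \<Phi>"
proof -
  let ?B = "power_integral p (\<lambda>z. norm (deriv (deriv \<Phi>) z))"
  have "power_integral p (\<lambda>z. norm (disc_deriv2 z))
      \<le> ennreal (4 powr p) * (?B + power_integral p first_order)"
  proof (rule power_integral_up_to_first_order[OF deriv_holomorphic(2)])
    show "norm (disc_deriv2 z) \<le> norm (deriv (deriv \<Phi>) z) + 2 * first_order z" for z
      using norm_triangle_ineq[of "deriv (deriv \<Phi>) z" "2 * deriv \<Phi> z / (z + \<i>)"]
      by (simp add: disc_deriv2_def first_order_def norm_mult norm_divide)
  qed (use p in simp)
  also have "\<dots> \<le> ennreal (4 powr p) * (?B + ?B)"
    by (intro mult_left_mono add_left_mono power_integral_first_order_le fin p) simp
  also have "\<dots> = ennreal (2 * 4 powr p) * ?B"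
    by (simp add: ennreal_mult mult_2[symmetric] mult_ac)
  finally show ?thesis by (simp add: besov_integral_disc besov_integral_halfplane)
qed

end

section \<open>From the disc to the half-plane\<close>

context cayley_pair
begin

text \<open>
  This is \<open>2 \<i> (\<Psi>' \<circ> K)\<close>, the first derivative on the disc in the coordinate of the half-plane.
\<close>

definition disc_deriv1 :: "complex \<Rightarrow> complex" where "disc_deriv1 w = (w + \<i>)\<^sup>2 * deriv \<Phi> w"

lemma disc_deriv1_holomorphic: "disc_deriv1 holomorphic_on upper_halfplane"
  unfolding disc_deriv1_def by (intro holomorphic_intros deriv_holomorphic)

lemma deriv_disc_deriv1:
  assumes "0 < Im w"
  shows "deriv disc_deriv1 w = (w + \<i>)\<^sup>2 * disc_deriv2 w"
proof -
  have d: "(deriv \<Phi> has_field_derivative deriv (deriv \<Phi>) w) (at w)"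
    using assms by (intro holomorphic_derivI[OF deriv_holomorphic(1) open_upper_halfplane]) simp
  have "(disc_deriv1 has_field_derivative (2 * (w + \<i>) * deriv \<Phi> w + (w + \<i>)\<^sup>2 * deriv (deriv \<Phi>) w)) (at w)"
    unfolding disc_deriv1_def by (auto intro!: derivative_eq_intros d simp: power2_eq_square)
  also have "2 * (w + \<i>) * deriv \<Phi> w + (w + \<i>)\<^sup>2 * deriv (deriv \<Phi>) w = (w + \<i>)\<^sup>2 * disc_deriv2 w"
    using add_ii_nonzero[OF assms] by (simp add: disc_deriv2_def field_simps power2_eq_square)
  finally show ?thesis by (rule DERIV_imp_deriv)
qed

lemma first_order_eq:
  assumes "0 < Im z"
  shows "first_order z = norm (disc_deriv1 z) / norm (z + \<i>) ^ 3"
  using add_ii_nonzero[OF assms]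
  by (simp add: first_order_def disc_deriv1_def norm_mult norm_divide norm_power power2_eq_square power3_eq_cube)

text \<open>
  Near \<open>\<i>\<close>, the preimage of the centre of the disc, the Bloch bound controls the first derivative.
\<close>

lemma disc_deriv1_bound:
  assumes fin: "bmoa < \<infinity>" and w: "norm (w - \<i>) \<le> 1 / 2"
  shows "norm (disc_deriv1 w) \<le> 13 * sqrt 6 * sqrt (enn2real bmoa)"
proof -
  define C where "C = sqrt 6 * sqrt (enn2real bmoa)"
  have C: "0 \<le> C" by (simp add: C_def)
  have im: "1 / 2 \<le> Im w" using w abs_Im_le_cmod[of "w - \<i>"] by simp
  have "1 / 2 * norm (deriv \<Phi> w) \<le> Im w * norm (deriv \<Phi> w)" using im by (intro mult_right_mono) auto
  also have "\<dots> \<le> C" unfolding C_def using im by (intro deriv_le_of_bmoa[OF fin]) simp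
  finally have d: "norm (deriv \<Phi> w) \<le> 2 * C" by simp
  have "norm (w + \<i>) \<le> 5 / 2"
    using norm_triangle_ineq[of "w - \<i>" "2 * \<i>"] w by (simp add: add.commute)
  then have "(norm (w + \<i>))\<^sup>2 \<le> (5 / 2)\<^sup>2" by (intro power_mono) auto
  then have "(norm (w + \<i>))\<^sup>2 * norm (deriv \<Phi> w) \<le> (5 / 2)\<^sup>2 * (2 * C)"
    using d by (intro mult_mono) auto
  then have "norm (disc_deriv1 w) \<le> 25 / 2 * C"
      by (simp add: disc_deriv1_def norm_mult norm_power power2_eq_square)
  also have "\<dots> \<le> 13 * C" using C by simp
  finally show ?thesis by (simp add: C_def)
qed

lemma norm_diff_ii_le:
  assumes "0 < Im z"
  shows "norm (z - \<i>) \<le> norm (z + \<i>)"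
proof -
  have "(norm (z - \<i>))\<^sup>2 \<le> (norm (z + \<i>))\<^sup>2" using norm_diff_add_ii[of z] assms by linarith
  then show ?thesis by (rule power2_le_imp_le) simp
qed

text \<open>
  Integrate \<open>((z + \<i>)\<^sup>2 \<Phi>')'\<close> along the segment from \<open>z\<close> towards \<open>\<i>\<close>, up to distance \<open>1/2\<close> from \<open>\<i>\<close>. On this
  part \<open>s |z - \<i>| \<ge> 1/2\<close>, so \<open>|T\<^sub>s z + \<i>| \<le> 5 s |z - \<i>|\<close>, and the factor \<open>|T\<^sub>s z + \<i>|\<^sup>2\<close> of the integrand is at
  most \<open>25 s\<^sup>2 |z + \<i>|\<^sup>2\<close>. The number \<open>B\<close> bounds the value at the end of the segment. Without stopping early,
  the factor \<open>s\<^sup>2\<close>, which the Hardy inequality requires, would be lost near \<open>\<i>\<close>.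
\<close>

lemma first_order_le_average:
  assumes fin: "bmoa < \<infinity>" and z: "0 < Im z"
    and B: "B = 13 * sqrt 6 * sqrt (enn2real bmoa)"
  shows "ennreal ((first_order z - B / norm (z + \<i>) ^ 3) / 25)
    \<le> (\<integral>\<^sup>+s\<in>{0<..1}. ennreal (s\<^sup>2 * norm (disc_deriv2 (\<i> + of_real s * (z - \<i>)))) \<partial>lborel)"
    (is "_ \<le> ?I")
proof -
  define R Z where "R = norm (z - \<i>)" and "Z = norm (z + \<i>)"
  have Z: "0 < Z" using add_ii_nonzero[OF z] by (simp add: Z_def)
  have RZ: "R \<le> Z" using norm_diff_ii_le[OF z] by (simp add: R_def Z_def)
  have eq: "(first_order z - B / Z ^ 3) / 25 = (norm (disc_deriv1 z) - B) / (25 * Z ^ 3)"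
  proof -
    have "first_order z = norm (disc_deriv1 z) / Z ^ 3" using first_order_eq[OF z] by (simp add: Z_def)
    then show ?thesis using Z by (simp add: field_simps)
  qed
  let ?T = "\<lambda>s. \<i> + of_real s * (z - \<i>)"
  show ?thesis
  proof (cases "R \<le> 1 / 2")
    case True
    then have "norm (disc_deriv1 z) \<le> B" unfolding B R_def by (intro disc_deriv1_bound[OF fin])
    then have "(first_order z - B / Z ^ 3) / 25 \<le> 0" unfolding eq using Z by (simp add: divide_nonpos_pos)
    then show ?thesis by (simp add: Z_def ennreal_neg)
  next
    case False
    then have R: "1 / 2 < R" by simp
    \<comment> \<open>at this parameter the segment reaches distance \<open>1/2\<close> from \<open>\<i>\<close>\<close>
    define a where "a = 1 / (2 * R)"
    have a: "0 < a" "a \<le> 1" using R by (auto simp: a_def field_simps)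
    have T: "0 < Im (?T s)" if "0 < s" "s \<le> 1" for s
      using that z by (intro Im_dilation_pos) auto
    have "norm (?T a - \<i>) = a * R" using a by (simp add: norm_mult R_def)
    then have Fa: "norm (disc_deriv1 (?T a)) \<le> B" unfolding B using R
        by (intro disc_deriv1_bound[OF fin]) (simp add: a_def)
    have T1: "?T 1 = z" by simp
    have "ennreal (norm (disc_deriv1 (?T 1) - disc_deriv1 (?T a)))
       \<le> (\<integral>\<^sup>+s\<in>{a..1}. ennreal (norm (deriv disc_deriv1 (?T s)) * norm (z - \<i>)) \<partial>lborel)"
      using T a by (intro norm_increment_le_segment[OF disc_deriv1_holomorphic open_upper_halfplane]) auto
    also have "\<dots> \<le> (\<integral>\<^sup>+s. ennreal (25 * Z ^ 3) *
        (ennreal (s\<^sup>2 * (norm (disc_deriv2 (?T s)) * indicator upper_halfplane (?T s)))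
        * indicator {0<..1} s) \<partial>lborel)"
    proof (rule nn_integral_mono)
      fix s :: real
      show "ennreal (norm (deriv disc_deriv1 (?T s)) * norm (z - \<i>)) * indicator {a..1} s
        \<le> ennreal (25 * Z ^ 3) * (ennreal (s\<^sup>2
            * (norm (disc_deriv2 (?T s)) * indicator upper_halfplane (?T s))) * indicator {0<..1} s)"
      proof (cases "s \<in> {a..1}")
        case True
        then have s: "0 < s" "s \<le> 1" "a \<le> s" using a by auto
        have sR: "1 / 2 \<le> s * R" using s(3) R by (simp add: a_def field_simps)
        have eq2: "?T s + \<i> = of_real s * (z - \<i>) + 2 * \<i>" by simp
        have "norm (of_real s * (z - \<i>)) = s * R" using s by (simp add: norm_mult R_def)
        then have "norm (?T s + \<i>) \<le> s * R + 2"
          unfolding eq2 using norm_triangle_ineq[of "of_real s * (z - \<i>)" "2 * \<i>"] by simp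
        also have "\<dots> \<le> 5 * (s * R)" using sR by linarith
        finally have "(norm (?T s + \<i>))\<^sup>2 \<le> (5 * (s * R))\<^sup>2" by (intro power_mono) auto
        then have "(norm (?T s + \<i>))\<^sup>2 * R \<le> (5 * (s * R))\<^sup>2 * R"
          using R by (intro mult_right_mono) auto
        also have "\<dots> = 25 * s\<^sup>2 * R ^ 3" by (simp add: power2_eq_square power3_eq_cube)
        also have "\<dots> \<le> 25 * s\<^sup>2 * Z ^ 3" using RZ R by (intro mult_left_mono power_mono) auto
        finally have "(norm (?T s + \<i>))\<^sup>2 * R * norm (disc_deriv2 (?T s))
            \<le> 25 * s\<^sup>2 * Z ^ 3 * norm (disc_deriv2 (?T s))"
          by (rule mult_right_mono) simp
        then have "norm (deriv disc_deriv1 (?T s)) * norm (z - \<i>)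
            \<le> 25 * Z ^ 3 * (s\<^sup>2 * norm (disc_deriv2 (?T s)))"
          using deriv_disc_deriv1[OF T[OF s(1,2)]] by (simp add: norm_mult norm_power R_def mult_ac)
        then show ?thesis
          using s True T[OF s(1,2)] Z by (simp add: ennreal_leI flip: ennreal_mult)
      qed simp
    qed
    also have "\<dots> = ennreal (25 * Z ^ 3) * (\<integral>\<^sup>+s. ennreal (s\<^sup>2
        * (norm (disc_deriv2 (?T s)) * indicator upper_halfplane (?T s))) * indicator {0<..1} s \<partial>lborel)"
    proof (rule nn_integral_cmult)
      have [measurable]: "(\<lambda>s::real. ?T s) \<in> borel_measurable borel"
        by (intro borel_measurable_continuous_onI continuous_intros)
      have "(\<lambda>s::real. norm (disc_deriv2 (?T s)) * indicator upper_halfplane (?T s)) \<in> borel_measurable borel"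
        by (rule measurable_compose[OF _ holomorphic_measurable[OF disc_deriv2_holomorphic]]) measurable
      then show "(\<lambda>s. ennreal (s\<^sup>2 * (norm (disc_deriv2 (?T s)) * indicator upper_halfplane (?T s)))
          * indicator {0<..1} s) \<in> borel_measurable lborel"
        by measurable
    qed
    also have "(\<integral>\<^sup>+s. ennreal (s\<^sup>2 * (norm (disc_deriv2 (?T s)) * indicator upper_halfplane (?T s)))
        * indicator {0<..1} s \<partial>lborel) = ?I"
      using T by (intro nn_integral_cong) (simp add: indicator_def)
    finally have I: "ennreal (norm (disc_deriv1 z - disc_deriv1 (?T a)))
        \<le> ennreal (25 * Z ^ 3) * ?I" unfolding T1 .
    have "norm (disc_deriv1 z) - B \<le> norm (disc_deriv1 z - disc_deriv1 (?T a))"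
      using norm_triangle_ineq2[of "disc_deriv1 z" "disc_deriv1 (?T a)"] Fa by linarith
    then have "ennreal (norm (disc_deriv1 z) - B) \<le> ennreal (25 * Z ^ 3) * ?I"
      using I by (meson ennreal_leI order_trans)
    moreover have "ennreal (norm (disc_deriv1 z) - B)
        = ennreal (25 * Z ^ 3) * ennreal ((first_order z - B / Z ^ 3) / 25)"
      unfolding eq using Z by (simp flip: ennreal_mult')
    ultimately show ?thesis
      using Z by (simp add: ennreal_mult_le_mult_iff Z_def)
  qed
qed

lemma power_integral_decay:
  assumes p: "1 \<le> p" and B: "0 \<le> B"
  shows "power_integral p (\<lambda>z. B / norm (z + \<i>) ^ 3) \<le> ennreal (8 * pi * B powr p)"
proof -
  have "power_integral p (\<lambda>z. B / norm (z + \<i>) ^ 3)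
    \<le> (\<integral>\<^sup>+z. ennreal (B powr p) * (ennreal (1 / norm (z + \<i>) ^ 3) * indicator upper_halfplane z) \<partial>lborel)"
    unfolding power_integral_def
  proof (rule nn_integral_mono)
    fix z
    show "ennreal (Im z powr (2 * p - 2) * (B / norm (z + \<i>) ^ 3) powr p) * indicator upper_halfplane z
      \<le> ennreal (B powr p) * (ennreal (1 / norm (z + \<i>) ^ 3) * indicator upper_halfplane z)"
    proof (cases "0 < Im z")
      case z: True
      define Z where "Z = norm (z + \<i>)"
      have im: "Im z \<le> Z" "1 \<le> Z" using abs_Im_le_cmod[of "z + \<i>"] z by (auto simp: Z_def)
      have "Im z powr (2 * p - 2) * (B / Z ^ 3) powr p \<le> Z powr (2 * p - 2) * (B / Z ^ 3) powr p"
        using im z p by (intro mult_right_mono powr_mono2) auto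
      also have "Z powr (2 * p - 2) * (B / Z ^ 3) powr p = B powr p * Z powr (- p - 2)"
      proof -
        have Z3: "Z ^ 3 = Z powr 3" using im by simp
        have "(B / Z ^ 3) powr p = B powr p / (Z powr 3) powr p" unfolding Z3 by (rule powr_divide)
        also have "(Z powr 3) powr p = Z powr (3 * p)" by (rule powr_powr)
        also have "B powr p / Z powr (3 * p) = B powr p * Z powr (- (3 * p))"
            by (simp add: powr_minus divide_inverse)
        finally show ?thesis by (simp add: mult.left_commute flip: powr_add)
      qed
      also have "\<dots> \<le> B powr p * Z powr (- 3)"
        using im p by (intro mult_left_mono powr_mono) auto
      also have "Z powr (- 3) = 1 / Z ^ 3"
        using im by (simp add: powr_minus divide_inverse flip: powr_numeral)
      finally show ?thesis
        using z by (simp add: Z_def ennreal_leI flip: ennreal_mult)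
    qed simp
  qed
  also have "\<dots> = ennreal (B powr p) * (\<integral>\<^sup>+z\<in>upper_halfplane. ennreal (1 / norm (z + \<i>) ^ 3) \<partial>lborel)"
    by (rule nn_integral_cmult) measurable
  also have "\<dots> \<le> ennreal (B powr p) * ennreal (8 * pi)"
    by (intro mult_left_mono nn_integral_halfplane_decay) simp
  also have "\<dots> = ennreal (8 * pi * B powr p)" by (simp add: mult.commute flip: ennreal_mult)
  finally show ?thesis .
qed

text \<open>
  The positive part \<open>v\<close> of what remains after removing the boundary term is bounded by an average of dilates
  about \<open>\<i>\<close> with ratios at most 1, which do not leave the half-plane; the boundary term itself has a finite
  power integral because it decays like \<open>|z + \<i>|\<^bsup>-3\<^esup>\<close>.
\<close>

lemma power_integral_first_order_le_disc:
  assumes fin: "bmoa < \<infinity>" and p: "1 \<le> p"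
    and B: "B = 13 * sqrt 6 * sqrt (enn2real bmoa)"
  shows "power_integral p first_order \<le> ennreal (50 powr p) *
      (ennreal (8 * pi * B powr p) + power_integral p (\<lambda>z. norm (disc_deriv2 z)))"
proof -
  define g where "g z = norm (disc_deriv2 z) * indicator upper_halfplane z" for z
  have g [measurable]: "g \<in> borel_measurable borel"
    unfolding g_def by (rule holomorphic_measurable[OF disc_deriv2_holomorphic])
  have B0: "0 \<le> B" by (simp add: B)
  \<comment> \<open>a negative remainder is replaced by 0, so that its power makes sense\<close>
  define v where "v z = max 0 ((first_order z - B / norm (z + \<i>) ^ 3) / 25)" for z
  have v: "(\<lambda>z. v z * indicator upper_halfplane z) \<in> borel_measurable borel"
  proof -
    note first_order_measurable[measurable]
    have "(\<lambda>z. max 0 ((first_order z * indicator upper_halfplane z - B / norm (z + \<i>) ^ 3) / 25))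
        \<in> borel_measurable borel"
      by measurable
    then show ?thesis by (rule borel_measurable_times_indicator) (simp_all add: v_def)
  qed
  let ?\<mu> = "Nonnegative_Lebesgue_Integration.density lborel (\<lambda>s::real. indicator {0<..1} s)"
  have "power_integral p v \<le> power_integral p g"
    unfolding power_integral_def
  proof (rule dilation_averages_contract[where \<mu> = ?\<mu> and c = \<i>])
    show "sets ?\<mu> = sets borel" "emeasure ?\<mu> (space ?\<mu>) = 1" by (rule uniform_measure)+
    show "AE s in ?\<mu>. 0 < s \<and> 0 \<le> (1 - s) * Im \<i>"
      using uniform_measure(3) by eventually_elim simp
    show "0 \<le> v z" for z by (simp add: v_def)
    show "0 \<le> g z" for z by (simp add: g_def)
    fix z assume z: "0 < Im z"
    let ?T = "\<lambda>s. \<i> + of_real s * (z - \<i>)"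
    have [measurable]: "(\<lambda>s::real. ?T s) \<in> borel_measurable borel"
      by (intro borel_measurable_continuous_onI continuous_intros)
    have T: "0 < Im (?T s)" if "0 < s" "s \<le> 1" for s
      using that z by (intro Im_dilation_pos) auto
    have "ennreal (v z) = ennreal ((first_order z - B / norm (z + \<i>) ^ 3) / 25)"
      by (simp add: v_def max_def ennreal_neg)
    also have "\<dots> \<le> (\<integral>\<^sup>+s\<in>{0<..1}. ennreal (s\<^sup>2 * norm (disc_deriv2 (?T s))) \<partial>lborel)"
      by (rule first_order_le_average[OF fin z B])
    also have "\<dots> = (\<integral>\<^sup>+s\<in>{0<..1}. ennreal (s\<^sup>2 * g (?T s)) \<partial>lborel)"
      using T by (intro nn_integral_cong) (simp add: g_def indicator_def)
    also have "\<dots> = (\<integral>\<^sup>+s. ennreal (s\<^sup>2 * g (?T s)) \<partial>?\<mu>)"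
      by (rule uniform_measure(4)[symmetric]) measurable
    finally show "ennreal (v z) \<le> (\<integral>\<^sup>+s. ennreal (s\<^sup>2 * g (?T s)) \<partial>?\<mu>)" .
  qed (use p g in auto)
  also have "\<dots> = power_integral p (\<lambda>z. norm (disc_deriv2 z))"
    unfolding power_integral_def by (intro nn_integral_cong) (auto simp: g_def indicator_def)
  finally have v_le: "power_integral p v \<le> power_integral p (\<lambda>z. norm (disc_deriv2 z))" .
  have "power_integral p first_order \<le> ennreal ((2 * 25) powr p)
      * (power_integral p (\<lambda>z. B / norm (z + \<i>) ^ 3) + power_integral p v)"
  proof (rule power_integral_add_le[OF _ v])
    show "(\<lambda>z. B / norm (z + \<i>) ^ 3 * indicator upper_halfplane z) \<in> borel_measurable borel" by measurable
    fix z
    have le: "x \<le> 25 * (b + max 0 ((x - b) / 25))" if "0 \<le> b" for x b :: real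
      using that by (auto simp: max_def field_simps)
    show "0 \<le> first_order z \<and> 0 \<le> B / norm (z + \<i>) ^ 3 \<and> 0 \<le> v z \<and> first_order z
        \<le> 25 * (B / norm (z + \<i>) ^ 3 + v z)"
      unfolding v_def using B0 by (intro conjI le) (simp_all add: first_order_def)
  qed (use p in auto)
  also have "\<dots> \<le> ennreal ((2 * 25) powr p) *
      (ennreal (8 * pi * B powr p) + power_integral p (\<lambda>z. norm (disc_deriv2 z)))"
    by (intro mult_left_mono add_mono power_integral_decay p B0 v_le) simp
  finally show ?thesis by simp
qed

lemma besov_halfplane_le:
  assumes fin: "bmoa < \<infinity>" and p: "1 \<le> p"
  shows "besov_integral (halfplane_domain upper_halfplane) p \<Phi>
    \<le> ennreal (4 powr p * (1 + 50 powr p * (1 + 8 * pi * (13 * sqrt 6) powr p)))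
      * (besov_integral disc_domain p \<Psi> + ennreal (sqrt (enn2real bmoa) powr p))"
proof -
  define m where "m = sqrt (enn2real bmoa)"
  define B where "B = 13 * sqrt 6 * m"
  let ?D = "power_integral p (\<lambda>z. norm (disc_deriv2 z))"
  define b where "b = 8 * pi * (13 * sqrt 6) powr p"
  have b: "0 \<le> b" "8 * pi * B powr p = b * m powr p"
    by (auto simp: b_def B_def powr_mult m_def)
  have "power_integral p (\<lambda>z. norm (deriv (deriv \<Phi>) z))
      \<le> ennreal (4 powr p) * (?D + power_integral p first_order)"
  proof (rule power_integral_up_to_first_order[OF disc_deriv2_holomorphic])
    show "norm (deriv (deriv \<Phi>) z) \<le> norm (disc_deriv2 z) + 2 * first_order z" for z
      using norm_triangle_ineq4[of "disc_deriv2 z" "2 * deriv \<Phi> z / (z + \<i>)"]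
      by (simp add: disc_deriv2_def first_order_def norm_mult norm_divide)
  qed (use p in simp)
  also have "\<dots> \<le> ennreal (4 powr p) * (?D + ennreal (50 powr p) * (ennreal (8 * pi * B powr p) + ?D))"
    by (intro mult_left_mono add_left_mono power_integral_first_order_le_disc fin p) (simp_all add: B_def m_def)
  also have "\<dots> \<le> ennreal (4 powr p) * (ennreal (1 + 50 powr p * (1 + b)) * (?D + ennreal (m powr p)))"
  proof -
    have "?D + ennreal (50 powr p) * (ennreal (8 * pi * B powr p) + ?D)
      = (1 + ennreal (50 powr p)) * ?D + ennreal (50 powr p * b) * ennreal (m powr p)"
      using b by (simp add: b(2) ennreal_mult algebra_simps)
    also have "1 + ennreal (50 powr p) = ennreal (1 + 50 powr p)" by simp
    also have "ennreal (1 + 50 powr p) * ?D + ennreal (50 powr p * b) * ennreal (m powr p)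
      \<le> ennreal (1 + 50 powr p * (1 + b)) * ?D + ennreal (1 + 50 powr p * (1 + b)) * ennreal (m powr p)"
      using b(1) by (intro add_mono mult_right_mono ennreal_leI) (auto simp: algebra_simps)
    finally have le: "?D + ennreal (50 powr p) * (ennreal (8 * pi * B powr p) + ?D)
      \<le> ennreal (1 + 50 powr p * (1 + b)) * (?D + ennreal (m powr p))"
      by (simp only: distrib_left)
    show ?thesis by (rule mult_left_mono[OF le]) simp
  qed
  also have "\<dots> = ennreal (4 powr p * (1 + 50 powr p * (1 + b))) * (?D + ennreal (m powr p))"
    using b(1) by (subst ennreal_mult) (auto simp: mult.assoc)
  finally show ?thesis by (simp add: besov_integral_disc besov_integral_halfplane b_def m_def)
qed

end

section \<open>The lower half-plane\<close>

lemma nn_integral_reflect: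
  fixes f :: "complex \<Rightarrow> ennreal"
  assumes "f \<in> borel_measurable borel"
  shows "(\<integral>\<^sup>+z. f (- z) \<partial>lborel) = (\<integral>\<^sup>+z. f z \<partial>lborel)"
  using assms
  by (subst (2) lborel_affine[of "- 1" 0]) (simp_all add: nn_integral_density nn_integral_distr)

lemma deriv_reflect:
  assumes "f holomorphic_on H" "open H" "- z \<in> H"
  shows "deriv (f \<circ> uminus) z = - deriv f (- z)"
proof -
  have "((\<lambda>z. f (- z)) has_field_derivative deriv f (- z) * (- 1)) (at z)"
    by (rule DERIV_chain2[where f = f and g = uminus])
      (auto intro!: derivative_eq_intros holomorphic_derivI[OF assms])
  then show ?thesis by (simp add: o_def DERIV_imp_deriv)
qed

lemma open_reflect: "open (uminus ` H)" if "open (H :: complex set)"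
  using open_negations[OF that] .

lemma holomorphic_reflect: "f \<circ> uminus holomorphic_on uminus ` H" if "f holomorphic_on H"
  by (rule holomorphic_on_compose_gen[OF _ that]) (auto intro!: holomorphic_intros)

lemma deriv_deriv_reflect:
  assumes f: "f holomorphic_on H" and H: "open H" and z: "- z \<in> H"
  shows "deriv (deriv (f \<circ> uminus)) z = deriv (deriv f) (- z)"
proof -
  have z': "z \<in> uminus ` H" using z by (metis image_eqI minus_minus)
  have df: "deriv f holomorphic_on H" by (rule holomorphic_deriv[OF f H])
  have "deriv (deriv (f \<circ> uminus)) z = deriv (\<lambda>z. - (deriv f \<circ> uminus) z) z"
  proof (rule complex_derivative_transform_within_open[OF _ _ open_reflect[OF H] z'])
    show "deriv (f \<circ> uminus) holomorphic_on uminus ` H"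
      by (intro holomorphic_deriv holomorphic_reflect f open_reflect H)
    show "(\<lambda>z. - (deriv f \<circ> uminus) z) holomorphic_on uminus ` H"
      by (intro holomorphic_on_minus holomorphic_reflect df)
    show "deriv (f \<circ> uminus) w = - (deriv f \<circ> uminus) w" if "w \<in> uminus ` H" for w
      using that deriv_reflect[OF f H, of w] by auto
  qed
  also have "\<dots> = - deriv (deriv f \<circ> uminus) z"
    using holomorphic_on_imp_differentiable_at[OF holomorphic_reflect[OF df] open_reflect[OF H] z']
    by (rule deriv_minus)
  also have "\<dots> = deriv (deriv f) (- z)"
    using deriv_reflect[OF df H z] by simp
  finally show ?thesis .
qed

lemma halfplane_box_borel:
  assumes "J \<in> bases (halfplane_domain H)" "open H"
  shows "hyp_domain.box (halfplane_domain H) J \<in> sets borel"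
proof -
  have J [measurable]: "J \<in> sets borel"
    using assms(1) by (intro real_interval_borel_measurable) (simp add: halfplane_domain_def)
  have [measurable]: "H \<in> sets borel" using assms(2) by simp
  have "{z \<in> H. Re z \<in> J \<and> \<bar>Im z\<bar> \<le> measure lborel J} \<in> sets borel" by measurable
  then show ?thesis by (simp add: halfplane_domain_def)
qed

lemma energy_measurable:
  assumes "\<Phi> holomorphic_on S" "open S" "hyp_domain.density X \<in> borel_measurable borel"
    "B \<in> sets borel" "B \<subseteq> S"
  shows "(\<lambda>z. energy X \<Phi> z * indicator B z) \<in> borel_measurable borel"
proof -
  note [measurable] = deriv_measurable_on[OF assms(1,2)] assms(3,4)
  have "(\<lambda>z. ennreal ((norm (deriv \<Phi> z) * indicator S z / hyp_domain.density X z)\<^sup>2 * hyp_domain.density X z))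
    \<in> borel_measurable borel" by measurable
  then show ?thesis
    by (rule borel_measurable_times_indicator) (use assms(4,5) in \<open>auto simp: energy_def\<close>)
qed

lemma halfplane_density_measurable: "hyp_domain.density (halfplane_domain H) \<in> borel_measurable borel"
  by (simp add: halfplane_domain_def)

text \<open>
  Reflection permutes the bases of the boxes. Applied twice, this gives equality.
\<close>

lemma bmoa_reflect_le:
  assumes \<Phi>: "\<Phi> holomorphic_on H" and H: "open H"
  shows "bmoa_sup (halfplane_domain (uminus ` H)) (\<Phi> \<circ> uminus) \<le> bmoa_sup (halfplane_domain H) \<Phi>"
proof (rule bmoa_sup_upperI)
  let ?X = "halfplane_domain H" and ?X' = "halfplane_domain (uminus ` H)"
  fix J assume J: "J \<in> bases ?X'"
  then have int: "is_interval J" "bounded J" "0 < measure lborel J" by (auto simp: halfplane_domain_def)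
  then show "0 < measure lborel J" by simp
  have meas: "measure lborel (uminus ` J) = measure lborel J"
  proof -
    have "J \<in> sets borel" using int(1) by (rule real_interval_borel_measurable)
    then have "measure (distr lborel borel uminus) J = measure lborel (uminus -` J)"
      by (simp add: measure_distr)
    moreover have "uminus -` J = uminus ` J" by (force simp: image_iff)
    ultimately show ?thesis by (simp add: lborel_distr_uminus)
  qed
  have J': "uminus ` J \<in> bases ?X"
    using int meas by (simp add: halfplane_domain_def bounded_uminus is_interval_uminus)
  let ?f = "\<lambda>z. energy ?X \<Phi> z * indicator (hyp_domain.box ?X (uminus ` J)) z"
  have "(\<integral>\<^sup>+z\<in>hyp_domain.box ?X' J. energy ?X' (\<Phi> \<circ> uminus) z \<partial>lborel) = (\<integral>\<^sup>+z. ?f (- z) \<partial>lborel)"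
  proof (rule nn_integral_cong)
    fix z
    have neg: "w \<in> uminus ` A \<longleftrightarrow> - w \<in> A" for w :: "'b :: group_add" and A by force
    have "- z \<in> hyp_domain.box ?X (uminus ` J) \<longleftrightarrow> z \<in> hyp_domain.box ?X' J"
      using meas by (simp add: halfplane_domain_def neg)
    moreover have "- z \<in> H" if "z \<in> hyp_domain.box ?X' J"
      using that by (auto simp: halfplane_domain_def)
    ultimately show "energy ?X' (\<Phi> \<circ> uminus) z * indicator (hyp_domain.box ?X' J) z = ?f (- z)"
      using deriv_reflect[OF \<Phi> H, of z] by (auto simp: indicator_def energy_def halfplane_domain_def)
  qed
  also have "\<dots> = (\<integral>\<^sup>+z. ?f z \<partial>lborel)"
    using energy_measurable[OF \<Phi> H halfplane_density_measurable halfplane_box_borel[OF J' H]]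
    by (intro nn_integral_reflect) (auto simp: halfplane_domain_def)
  also have "\<dots> \<le> ennreal (measure lborel J) * bmoa_sup ?X \<Phi>"
    using J' int meas by (intro box_energy_le[where J = "uminus ` J"]) auto
  finally show "(\<integral>\<^sup>+z\<in>hyp_domain.box ?X' J. energy ?X' (\<Phi> \<circ> uminus) z \<partial>lborel)
      \<le> ennreal (measure lborel J) * bmoa_sup ?X \<Phi>" .
qed

lemma reflect_lower: "uminus ` lower_halfplane = upper_halfplane" "uminus ` upper_halfplane = lower_halfplane"
proof -
  have neg: "w \<in> uminus ` A \<longleftrightarrow> - w \<in> A" for w :: complex and A by force
  show "uminus ` lower_halfplane = upper_halfplane" "uminus ` upper_halfplane = lower_halfplane"
    by (auto simp: set_eq_iff neg lower_halfplane_def)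
qed

lemma open_lower_halfplane: "open lower_halfplane"
  unfolding reflect_lower(2)[symmetric] by (rule open_reflect) simp

lemma bmoa_reflect:
  assumes "\<Phi> holomorphic_on lower_halfplane"
  shows "bmoa_sup (halfplane_domain upper_halfplane) (\<Phi> \<circ> uminus)
      = bmoa_sup (halfplane_domain lower_halfplane) \<Phi>"
proof (rule antisym)
  show "bmoa_sup (halfplane_domain upper_halfplane) (\<Phi> \<circ> uminus)
      \<le> bmoa_sup (halfplane_domain lower_halfplane) \<Phi>"
    using bmoa_reflect_le[OF assms open_lower_halfplane] by (simp add: reflect_lower)
  have "\<Phi> \<circ> uminus holomorphic_on upper_halfplane"
    using holomorphic_reflect[OF assms] by (simp add: reflect_lower)
  from bmoa_reflect_le[OF this open_upper_halfplane]
  show "bmoa_sup (halfplane_domain lower_halfplane) \<Phi>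
      \<le> bmoa_sup (halfplane_domain upper_halfplane) (\<Phi> \<circ> uminus)"
    by (simp add: reflect_lower comp_assoc)
qed

lemma besov_reflect:
  assumes \<Phi>: "\<Phi> holomorphic_on lower_halfplane"
  shows "besov_integral (halfplane_domain upper_halfplane) p (\<Phi> \<circ> uminus)
      = besov_integral (halfplane_domain lower_halfplane) p \<Phi>"
proof -
  let ?d = "\<lambda>z :: complex. 1 / \<bar>Im z\<bar>"
  let ?f = "\<lambda>z. ennreal ((norm (deriv (deriv \<Phi>) z) / (?d z)\<^sup>2) powr p * (?d z)\<^sup>2)
      * indicator lower_halfplane z"
  note [measurable] = deriv_measurable_on[OF holomorphic_deriv[OF \<Phi> open_lower_halfplane] open_lower_halfplane]
  have [measurable]: "lower_halfplane \<in> sets borel" using open_lower_halfplane by simp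
  have meas: "?f \<in> borel_measurable borel"
    by (rule borel_measurable_times_indicator[where h = "\<lambda>z. ennreal ((norm (deriv (deriv \<Phi>) z) *
        indicator lower_halfplane z / (?d z)\<^sup>2) powr p * (?d z)\<^sup>2)"]; (measurable | simp))
  have "besov_integral (halfplane_domain upper_halfplane) p (\<Phi> \<circ> uminus) = (\<integral>\<^sup>+z. ?f (- z) \<partial>lborel)"
    unfolding besov_integral_def halfplane_domain_def hyp_domain.simps
  proof (rule nn_integral_cong)
    fix z
    show "ennreal ((norm (deriv (deriv (\<Phi> \<circ> uminus)) z) / (?d z)\<^sup>2) powr p * (?d z)\<^sup>2)
        * indicator upper_halfplane z = ?f (- z)"
    proof (cases "0 < Im z")
      case True
      then have "- z \<in> lower_halfplane" by (simp add: lower_halfplane_def)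
      with deriv_deriv_reflect[OF \<Phi> open_lower_halfplane this] True show ?thesis by simp
    qed (simp add: lower_halfplane_def)
  qed
  also have "\<dots> = (\<integral>\<^sup>+z. ?f z \<partial>lborel)" by (rule nn_integral_reflect[OF meas])
  also have "\<dots> = besov_integral (halfplane_domain lower_halfplane) p \<Phi>"
    by (simp add: besov_integral_def halfplane_domain_def)
  finally show ?thesis .
qed

lemma cayley_reflect: "0 < Im z \<Longrightarrow> cayley (- z) = cayley z"
  by (simp add: cayley_def)

text \<open>
  Everything that is specific to the Cayley transformation, for both half-planes. On the lower half-plane
  \<open>K\<close> is the composition of the reflection with \<open>K\<close> on the upper one.
\<close>

lemma cayley_estimates:
  assumes H: "H = upper_halfplane \<or> H = lower_halfplane" and p: "1 \<le> p"
    and \<Phi>: "\<Phi> holomorphic_on H" and \<Psi>: "\<Psi> holomorphic_on ball 0 1" and eq: "\<forall>z\<in>H. \<Phi> z = \<Psi> (cayley z)"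
  shows "bmoa_sup disc_domain \<Psi> \<le> ennreal (8 * pi) * (8 * bmoa_sup (halfplane_domain H) \<Phi>)"
      (is ?bmoa_disc)
    and "bmoa_sup (halfplane_domain H) \<Phi> \<le> 5 * (ennreal (8 * pi) * bmoa_sup disc_domain \<Psi>)"
      (is ?bmoa_halfplane)
    and "bmoa_sup (halfplane_domain H) \<Phi> < \<infinity> \<Longrightarrow>
      besov_integral disc_domain p \<Psi> \<le> ennreal (2 * 4 powr p) * besov_integral (halfplane_domain H) p \<Phi>"
      (is "_ \<Longrightarrow> ?besov_disc")
    and "bmoa_sup (halfplane_domain H) \<Phi> < \<infinity> \<Longrightarrow>
      besov_integral (halfplane_domain H) p \<Phi>
      \<le> ennreal (4 powr p * (1 + 50 powr p * (1 + 8 * pi * (13 * sqrt 6) powr p)))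
      * (besov_integral disc_domain p \<Psi> + ennreal (sqrt (enn2real (bmoa_sup (halfplane_domain H) \<Phi>)) powr p))"
      (is "_ \<Longrightarrow> ?besov_halfplane")
proof -
  define \<Phi>' where "\<Phi>' = (if H = upper_halfplane then \<Phi> else \<Phi> \<circ> uminus)"
  have low: "\<Phi>' = \<Phi> \<circ> uminus" "H = lower_halfplane" "\<Phi> holomorphic_on lower_halfplane"
      if "H \<noteq> upper_halfplane"
    using that H \<Phi> by (auto simp: \<Phi>'_def)
  interpret cayley_pair \<Phi>' \<Psi>
  proof
    show "\<Phi>' holomorphic_on upper_halfplane"
      using \<Phi> low holomorphic_reflect[of \<Phi> lower_halfplane]
      by (cases "H = upper_halfplane") (auto simp: \<Phi>'_def reflect_lower)
    show "\<Psi> holomorphic_on ball 0 1" by fact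
    fix z assume z: "0 < Im z"
    show "\<Phi>' z = \<Psi> (cayley z)"
    proof (cases "H = upper_halfplane")
      case False
      then show ?thesis
        using z low bspec[OF eq, of "- z"] cayley_reflect[OF z] by (simp add: lower_halfplane_def)
    qed (use z eq in \<open>simp add: \<Phi>'_def\<close>)
  qed
  have 1: "bmoa_sup (halfplane_domain upper_halfplane) \<Phi>' = bmoa_sup (halfplane_domain H) \<Phi>"
    using low bmoa_reflect by (cases "H = upper_halfplane") (auto simp: \<Phi>'_def)
  have 2: "besov_integral (halfplane_domain upper_halfplane) p \<Phi>' = besov_integral (halfplane_domain H) p \<Phi>"
    using low besov_reflect by (cases "H = upper_halfplane") (auto simp: \<Phi>'_def)
  show ?bmoa_disc using bmoa_disc_le unfolding 1 .
  show ?bmoa_halfplane using bmoa_halfplane_le unfolding 1 .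
  assume fin: "bmoa_sup (halfplane_domain H) \<Phi> < \<infinity>"
  show ?besov_disc using besov_disc_le[OF _ p] fin unfolding 1 2 by blast
  show ?besov_halfplane using besov_halfplane_le[OF _ p] fin unfolding 1 2 by blast
qed

section \<open>Linear combinations and equivalence of the norms\<close>

text \<open>
  Closure under sums and scalar multiples is needed for the inverse of the push-forward to be linear:
  additivity of an inverse is only meaningful where sums have preimages.
\<close>

lemma besov_halfplane_lincomb:
  assumes H: "open H" and p: "0 \<le> p"
    and \<Phi>: "\<Phi> \<in> besov_functions (halfplane_domain H) p" and \<Psi>: "\<Psi> \<in> besov_functions (halfplane_domain H) p"
  shows "(\<lambda>z. a * \<Phi> z + b * \<Psi> z) \<in> besov_functions (halfplane_domain H) p"
proof -
  let ?X = "halfplane_domain H" and ?f = "\<lambda>z. a * \<Phi> z + b * \<Psi> z"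
  have pts: "pts ?X = H" by (simp add: halfplane_domain_def)
  have hol: "\<Phi> holomorphic_on H" "\<Psi> holomorphic_on H" using \<Phi> \<Psi> by (auto simp: besov_functions_def pts)
  note hol1 = holomorphic_deriv[OF hol(1) H] holomorphic_deriv[OF hol(2) H]
  have fhol: "?f holomorphic_on H" by (intro holomorphic_intros hol)
  define k where "k = norm a + norm b"
  have k: "0 \<le> k" "norm a \<le> k" "norm b \<le> k" by (auto simp: k_def)
  have norm_le: "norm (a * x + b * y) \<le> k * (norm x + norm y)" for x y
  proof -
    have "norm (a * x + b * y) \<le> norm a * norm x + norm b * norm y"
      using norm_triangle_ineq[of "a * x" "b * y"] by (simp add: norm_mult)
    also have "\<dots> \<le> k * norm x + k * norm y" using k by (intro add_mono mult_right_mono) auto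
    finally show ?thesis by (simp add: distrib_left)
  qed
  have lin: "deriv (\<lambda>z. a * f z + b * g z) z = a * deriv f z + b * deriv g z"
    if "f holomorphic_on H" "g holomorphic_on H" "z \<in> H" for f g z
    using holomorphic_derivI[OF that(1) H that(3)] holomorphic_derivI[OF that(2) H that(3)]
    by (intro DERIV_imp_deriv) (auto intro!: derivative_eq_intros)
  have d1: "deriv ?f z = a * deriv \<Phi> z + b * deriv \<Psi> z" if "z \<in> H" for z
    using lin[OF hol that] .
  have d2: "deriv (deriv ?f) z = a * deriv (deriv \<Phi>) z + b * deriv (deriv \<Psi>) z" if z: "z \<in> H" for z
  proof -
    have "deriv (deriv ?f) z = deriv (\<lambda>z. a * deriv \<Phi> z + b * deriv \<Psi> z) z"
      by (rule complex_derivative_transform_within_open[OF _ _ H z])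
        (use d1 in \<open>auto intro!: holomorphic_intros hol1 holomorphic_deriv[OF fhol H]\<close>)
    then show ?thesis using lin[OF hol1 z] by simp
  qed
  let ?d = "hyp_domain.density ?X"
  note [measurable] = halfplane_density_measurable[of H]
  have [measurable]: "H \<in> sets borel" using H by simp
  let ?W = "\<lambda>f z. ennreal ((norm (deriv (deriv f) z) / (?d z)\<^sup>2) powr p * (?d z)\<^sup>2) * indicator H z"
  have Wmeas: "?W f \<in> borel_measurable borel" if "f holomorphic_on H" for f
  proof -
    note [measurable] = deriv_measurable_on[OF holomorphic_deriv[OF that H] H]
    show ?thesis
      by (rule borel_measurable_times_indicator[where h = "\<lambda>z. ennreal
          ((norm (deriv (deriv f) z) * indicator H z / (?d z)\<^sup>2) powr p
          * (?d z)\<^sup>2)"]; (measurable | simp))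
  qed
  have "besov_integral ?X p ?f \<le> (\<integral>\<^sup>+z. ennreal ((2 * k) powr p) * (?W \<Phi> z + ?W \<Psi> z) \<partial>lborel)"
    unfolding besov_integral_def pts
  proof (rule nn_integral_mono)
    fix z
    show "?W ?f z \<le> ennreal ((2 * k) powr p) * (?W \<Phi> z + ?W \<Psi> z)"
    proof (cases "z \<in> H")
      case True
      define x y e where "x = norm (deriv (deriv \<Phi>) z) / (?d z)\<^sup>2" and "y
          = norm (deriv (deriv \<Psi>) z) / (?d z)\<^sup>2"
        and "e = (?d z)\<^sup>2"
      have xy: "0 \<le> x" "0 \<le> y" "0 \<le> e" by (auto simp: x_def y_def e_def)
      have "norm (deriv (deriv ?f) z) / (?d z)\<^sup>2 \<le> k * (x + y)"
        unfolding d2[OF True] x_def y_def add_divide_distrib[symmetric] times_divide_eq_right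
        by (intro divide_right_mono norm_le) simp
      then have "(norm (deriv (deriv ?f) z) / (?d z)\<^sup>2) powr p \<le> (k * (x + y)) powr p"
        using p by (intro powr_mono2) auto
      also have "\<dots> = k powr p * (x + y) powr p" by (rule powr_mult)
      also have "\<dots> \<le> k powr p * (2 powr p * (x powr p + y powr p))"
        using xy p by (intro mult_left_mono powr_add_le) auto
      also have "\<dots> = (2 * k) powr p * (x powr p + y powr p)" by (simp add: powr_mult)
      finally have "(norm (deriv (deriv ?f) z) / (?d z)\<^sup>2) powr p * e
          \<le> (2 * k) powr p * (x powr p + y powr p) * e"
        using xy by (intro mult_right_mono) auto
      also have "\<dots> = (2 * k) powr p * (x powr p * e + y powr p * e)" by (simp add: algebra_simps)
      finally have "(norm (deriv (deriv ?f) z) / (?d z)\<^sup>2) powr p * (?d z)\<^sup>2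
        \<le> (2 * k) powr p * (x powr p * (?d z)\<^sup>2 + y powr p * (?d z)\<^sup>2)" by (simp only: e_def)
      then show ?thesis
        unfolding x_def y_def using True by (simp add: ennreal_leI flip: ennreal_mult ennreal_plus)
    qed simp
  qed
  also have "\<dots> = ennreal ((2 * k) powr p) * (besov_integral ?X p \<Phi> + besov_integral ?X p \<Psi>)"
    unfolding besov_integral_def pts using Wmeas[OF hol(1)] Wmeas[OF hol(2)]
    by (subst nn_integral_cmult) (simp_all add: nn_integral_add)
  also have "\<dots> < \<infinity>"
    using \<Phi> \<Psi> by (auto simp: besov_functions_def ennreal_mult_less_top)
  finally have B: "besov_integral ?X p ?f < \<infinity>" .
  have "bmoa_sup ?X ?f \<le> ennreal (2 * k\<^sup>2) * (bmoa_sup ?X \<Phi> + bmoa_sup ?X \<Psi>)"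
  proof (rule bmoa_sup_upperI)
    fix J assume J: "J \<in> bases ?X"
    then show J0: "0 < measure lborel J" by (simp add: halfplane_domain_def)
    let ?B = "hyp_domain.box ?X J"
    have BH: "?B \<subseteq> H" by (auto simp: halfplane_domain_def)
    have meas: "(\<lambda>z. energy ?X f z * indicator ?B z) \<in> borel_measurable lborel" if "f holomorphic_on H" for f
      using energy_measurable[OF that H halfplane_density_measurable halfplane_box_borel[OF J H] BH] by simp
    have "(\<integral>\<^sup>+z\<in>?B. energy ?X ?f z \<partial>lborel)
      \<le> (\<integral>\<^sup>+z. ennreal (2 * k\<^sup>2) * (energy ?X \<Phi> z * indicator ?B z + energy ?X \<Psi> z * indicator ?B z) \<partial>lborel)"
    proof (rule nn_integral_mono)
      fix z
      show "energy ?X ?f z * indicator ?B z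
        \<le> ennreal (2 * k\<^sup>2) * (energy ?X \<Phi> z * indicator ?B z + energy ?X \<Psi> z * indicator ?B z)"
      proof (cases "z \<in> ?B")
        case True
        then have z: "z \<in> H" using BH by auto
        define x y e where "x = norm (deriv \<Phi> z)" and "y = norm (deriv \<Psi> z)" and "e = ?d z"
        have e: "0 \<le> e" by (simp add: e_def halfplane_domain_def)
        have "(norm (deriv ?f z))\<^sup>2 \<le> (k * (x + y))\<^sup>2"
          unfolding d1[OF z] x_def y_def by (intro power_mono norm_le) simp
        also have "\<dots> = k\<^sup>2 * (x + y)\<^sup>2" by (rule power_mult_distrib)
        also have "\<dots> \<le> k\<^sup>2 * (2 * (x\<^sup>2 + y\<^sup>2))"
          using sum_squares_bound[of x y] by (intro mult_left_mono) (auto simp: power2_sum)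
        finally have "(norm (deriv ?f z))\<^sup>2 / e\<^sup>2 * e \<le> k\<^sup>2 * (2 * (x\<^sup>2 + y\<^sup>2)) / e\<^sup>2 * e"
          using e by (intro mult_right_mono divide_right_mono) auto
        also have "\<dots> = 2 * k\<^sup>2 * (x\<^sup>2 / e\<^sup>2 * e + y\<^sup>2 / e\<^sup>2 * e)"
            by (simp add: add_divide_distrib algebra_simps)
        finally show ?thesis
          using True e by (simp add: energy_def ennreal_leI power_divide x_def[symmetric] y_def[symmetric]
              e_def[symmetric] flip: ennreal_mult ennreal_plus)
      qed simp
    qed
    also have "\<dots> = ennreal (2 * k\<^sup>2) * ((\<integral>\<^sup>+z\<in>?B. energy ?X \<Phi> z \<partial>lborel) + (\<integral>\<^sup>+z\<in>?B. energy ?X \<Psi> z \<partial>lborel))"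
      using meas[OF hol(1)] meas[OF hol(2)] by (subst nn_integral_cmult) (simp_all add: nn_integral_add)
    also have "\<dots> \<le> ennreal (2 * k\<^sup>2) * (ennreal (measure lborel J) * bmoa_sup ?X \<Phi>
        + ennreal (measure lborel J) * bmoa_sup ?X \<Psi>)"
      by (intro mult_left_mono add_mono box_energy_le[OF J J0]) auto
    also have "\<dots> = ennreal (measure lborel J) * (ennreal (2 * k\<^sup>2) * (bmoa_sup ?X \<Phi> + bmoa_sup ?X \<Psi>))"
      by (simp add: algebra_simps)
    finally show "(\<integral>\<^sup>+z\<in>?B. energy ?X ?f z \<partial>lborel)
        \<le> ennreal (measure lborel J) * (ennreal (2 * k\<^sup>2) * (bmoa_sup ?X \<Phi> + bmoa_sup ?X \<Psi>))" .
  qed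
  also have "\<dots> < \<infinity>"
    using \<Phi> \<Psi> by (auto simp: besov_functions_def ennreal_mult_less_top)
  finally show ?thesis
    using fhol B by (simp add: besov_functions_def pts)
qed

lemma root_le:
  fixes a b c p :: real
  assumes "1 \<le> p" "0 \<le> a" "0 \<le> b" "0 \<le> c" "a \<le> c * b"
  shows "a powr (1 / p) \<le> c powr (1 / p) * b powr (1 / p)"
proof -
  have "a powr (1 / p) \<le> (c * b) powr (1 / p)" using assms by (intro powr_mono2) auto
  then show ?thesis by (simp add: powr_mult)
qed

text \<open>
  The constant has to be the same for all functions. It comes from taking roots in the estimates for the
  \<open>p\<close>-th power and the square of the seminorms.
\<close>

lemma besov_norm_equivalence:
  assumes H: "H = upper_halfplane \<or> H = lower_halfplane" and p: "1 \<le> p"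
  obtains C where "\<And>\<Phi> \<Psi>. \<lbrakk>\<Phi> holomorphic_on H; \<Psi> holomorphic_on ball 0 1; \<And>z. z \<in> H \<Longrightarrow> \<Phi> z = \<Psi> (cayley z)\<rbrakk> \<Longrightarrow>
      (\<Phi> \<in> besov_functions (halfplane_domain H) p \<longleftrightarrow> \<Psi> \<in> besov_functions disc_domain p) \<and>
      (\<Phi> \<in> besov_functions (halfplane_domain H) p \<longrightarrow>
        besov_norm disc_domain p \<Psi> \<le> C * besov_norm (halfplane_domain H) p \<Phi> \<and>
        besov_norm (halfplane_domain H) p \<Phi> \<le> C * besov_norm disc_domain p \<Psi>)"
proof -
  let ?X = "halfplane_domain H"
  define c A where "c = 2 * 4 powr p" and "A
      = 4 powr p * (1 + 50 powr p * (1 + 8 * pi * (13 * sqrt 6) powr p))"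
  define C1 where "C1 = c powr (1 / p) + sqrt (64 * pi)"
  define C2 where "C2 = (A * 2) powr (1 / p) * (1 + sqrt (40 * pi)) + sqrt (40 * pi)"
  have c: "0 \<le> c" "0 \<le> A" by (auto simp: c_def A_def)
  show thesis
  proof (rule that[of "max C1 C2"])
    fix \<Phi> \<Psi>
    assume \<Phi>: "\<Phi> holomorphic_on H" and \<Psi>: "\<Psi> holomorphic_on ball 0 1" and eq: "\<And>z. z \<in> H \<Longrightarrow> \<Phi> z = \<Psi> (cayley z)"
    have eq': "\<forall>z\<in>H. \<Phi> z = \<Psi> (cayley z)" using eq by blast
    note est = cayley_estimates[OF H p \<Phi> \<Psi> eq']
    let ?bounds = "besov_norm disc_domain p \<Psi> \<le> max C1 C2 * besov_norm ?X p \<Phi> \<and>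
        besov_norm ?X p \<Phi> \<le> max C1 C2 * besov_norm disc_domain p \<Psi>"
    let ?a = "besov_integral ?X p \<Phi>" and ?m = "bmoa_sup ?X \<Phi>"
    let ?b = "besov_integral disc_domain p \<Psi>" and ?n = "bmoa_sup disc_domain \<Psi>"
    have mem: "\<Phi> \<in> besov_functions ?X p \<longleftrightarrow> ?a < \<infinity> \<and> ?m < \<infinity>"
      "\<Psi> \<in> besov_functions disc_domain p \<longleftrightarrow> ?b < \<infinity> \<and> ?n < \<infinity>"
      using \<Phi> \<Psi> by (auto simp: besov_functions_def halfplane_domain_def disc_domain_def)
    have fin1: "?n < \<infinity>" if "?m < \<infinity>"
      using est(1) that by (auto simp: ennreal_mult_less_top elim!: le_less_trans)
    have fin2: "?m < \<infinity>" if "?n < \<infinity>"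
      using est(2) that by (auto simp: ennreal_mult_less_top elim!: le_less_trans)
    have fin3: "?b < \<infinity>" if "?a < \<infinity>" "?m < \<infinity>"
      using est(3) that by (auto simp: ennreal_mult_less_top elim!: le_less_trans)
    have fin4: "?a < \<infinity>" if "?b < \<infinity>" "?m < \<infinity>"
      using est(4) that by (auto simp: ennreal_mult_less_top elim!: le_less_trans)
    have iff: "\<Phi> \<in> besov_functions ?X p \<longleftrightarrow> \<Psi> \<in> besov_functions disc_domain p"
      using mem fin1 fin2 fin3 fin4 by blast
    have "?bounds" if "\<Phi> \<in> besov_functions ?X p"
    proof -
      have fin: "?a < \<infinity>" "?m < \<infinity>" "?b < \<infinity>" "?n < \<infinity>"
        using that iff mem by auto
      obtain a m b n where r: "?a = ennreal a" "?m = ennreal m" "?b = ennreal b" "?n = ennreal n"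
        "0 \<le> a" "0 \<le> m" "0 \<le> b" "0 \<le> n"
        using fin by (metis ennreal_cases infinity_ennreal_def order_less_irrefl)
      have "ennreal n \<le> ennreal (64 * pi * m)"
        using est(1) r by (simp add: mult_ac flip: ennreal_mult ennreal_numeral)
      then have n: "sqrt n \<le> sqrt (64 * pi) * sqrt m"
        using r by (simp flip: real_sqrt_mult)
      have "ennreal m \<le> ennreal (40 * pi * n)"
        using est(2) r by (simp add: mult_ac flip: ennreal_mult ennreal_numeral)
      then have m: "sqrt m \<le> sqrt (40 * pi) * sqrt n"
        using r by (simp flip: real_sqrt_mult)
      have "ennreal b \<le> ennreal (c * a)"
        using est(3)[OF fin(2)] r c by (simp add: c_def flip: ennreal_mult)
      then have b: "b powr (1 / p) \<le> c powr (1 / p) * a powr (1 / p)"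
        using r c p by (intro root_le) auto
      have "ennreal a \<le> ennreal (A * (b + sqrt m powr p))"
        using est(4)[OF fin(2)] r c unfolding A_def[symmetric]
        by (simp flip: ennreal_mult ennreal_plus)
      then have "a \<le> A * (b + sqrt m powr p)"
        using r c by (subst (asm) ennreal_le_iff) auto
      also have "\<dots> \<le> (A * 2) * max b (sqrt m powr p)"
        using c by (simp add: mult.assoc) (intro mult_left_mono, auto)
      finally have "a powr (1 / p) \<le> (A * 2) powr (1 / p) * max b (sqrt m powr p) powr (1 / p)"
        using r c p by (intro root_le) auto
      also have "max b (sqrt m powr p) powr (1 / p) \<le> b powr (1 / p) + sqrt m"
        using p r by (auto simp: max_def powr_powr)
      finally have a: "a powr (1 / p) \<le> (A * 2) powr (1 / p) * (b powr (1 / p) + sqrt m)"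
        by (simp add: mult_left_mono)
      have N1: "besov_norm ?X p \<Phi> = a powr (1 / p) + sqrt m" "besov_norm disc_domain p \<Psi>
          = b powr (1 / p) + sqrt n"
        using r by (simp_all add: besov_norm_def)
      have s: "0 \<le> a powr (1 / p)" "0 \<le> b powr (1 / p)" "0 \<le> sqrt m" "0 \<le> sqrt n" using r by auto
      have "b powr (1 / p) + sqrt n \<le> C1 * (a powr (1 / p) + sqrt m)"
      proof -
        define E S x y where "E = c powr (1 / p)" and "S = sqrt (64 * pi)" and "x = a powr (1 / p)" and "y
            = sqrt m"
        have "0 \<le> E * y" "0 \<le> S * x" using r by (auto simp: E_def S_def x_def y_def)
        then have "E * x + S * y \<le> (E + S) * (x + y)" by (simp add: algebra_simps)
        then show ?thesis using b n by (simp add: C1_def E_def S_def x_def y_def)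
      qed
      also have "\<dots> \<le> max C1 C2 * (a powr (1 / p) + sqrt m)"
        using s by (intro mult_right_mono) auto
      finally have 1: "b powr (1 / p) + sqrt n \<le> max C1 C2 * (a powr (1 / p) + sqrt m)" .
      have "a powr (1 / p) + sqrt m \<le> C2 * (b powr (1 / p) + sqrt n)"
      proof -
        define E S x y where "E = (A * 2) powr (1 / p)" and "S = sqrt (40 * pi)" and "x
            = b powr (1 / p)" and "y = sqrt n"
        have pos: "0 \<le> E" "0 \<le> S" "0 \<le> x" "0 \<le> y" using r by (auto simp: E_def S_def x_def y_def)
        have "a powr (1 / p) + sqrt m \<le> E * (x + S * y) + S * y"
          using a m pos unfolding E_def S_def x_def y_def
          by (intro add_mono order_trans[OF a] mult_left_mono) auto
        also have "\<dots> \<le> (E * (1 + S) + S) * (x + y)"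
          using pos by (simp add: algebra_simps)
        finally show ?thesis by (simp add: C2_def E_def S_def x_def y_def)
      qed
      also have "\<dots> \<le> max C1 C2 * (b powr (1 / p) + sqrt n)"
        using s by (intro mult_right_mono) auto
      finally have 2: "a powr (1 / p) + sqrt m \<le> max C1 C2 * (b powr (1 / p) + sqrt n)" .
      show ?thesis unfolding N1 using 1 2 by simp
    qed
    with iff show "(\<Phi> \<in> besov_functions ?X p \<longleftrightarrow> \<Psi> \<in> besov_functions disc_domain p) \<and>
      (\<Phi> \<in> besov_functions ?X p \<longrightarrow> ?bounds)" by blast
  qed
qed

section \<open>Functions modulo constants\<close>

lemma equiv_diff_const: "equiv UNIV (diff_const X)"
proof (rule equivI)
  show "refl (diff_const X)" by (auto simp: refl_on_def diff_const_def)
  show "sym (diff_const X)"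
  proof (rule symI)
    fix f g assume "(f, g) \<in> diff_const X"
    then obtain c where "\<forall>z\<in>pts X. f z - g z = c" by (auto simp: diff_const_def)
    then have "\<forall>z\<in>pts X. g z - f z = - c" by (metis minus_diff_eq)
    then show "(g, f) \<in> diff_const X" by (auto simp: diff_const_def)
  qed
  show "trans (diff_const X)"
  proof (rule transI)
    fix f g h assume "(f, g) \<in> diff_const X" "(g, h) \<in> diff_const X"
    then obtain c d where "\<forall>z\<in>pts X. f z - g z = c" "\<forall>z\<in>pts X. g z - h z = d" by (auto simp: diff_const_def)
    then have "\<forall>z\<in>pts X. f z - h z = c + d" by (metis add_diff_eq diff_add_cancel)
    then show "(f, h) \<in> diff_const X" by (auto simp: diff_const_def)
  qed
qed simp

abbreviation "cls X f \<equiv> diff_const X `` {f}"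

lemma cls_eq_iff: "cls X f = cls X g \<longleftrightarrow> (f, g) \<in> diff_const X"
  using eq_equiv_class_iff[OF equiv_diff_const] by auto

lemma diff_constI: "(\<And>z. z \<in> pts X \<Longrightarrow> f z - g z = c) \<Longrightarrow> (f, g) \<in> diff_const X"
  by (auto simp: diff_const_def)

text \<open>
  An operation on classes that is defined as the union over all representatives can be computed on any one
  of them, provided that it respects the equivalence.
\<close>

lemma UN_cls: "(\<Union>f\<in>cls X \<Phi>. cls Y (F f)) = cls Y (F \<Phi>)"
  if "\<And>f. (\<Phi>, f) \<in> diff_const X \<Longrightarrow> (F f, F \<Phi>) \<in> diff_const Y"
proof -
  have "cls Y (F f) = cls Y (F \<Phi>)" if "f \<in> cls X \<Phi>" for f
    using that \<open>\<And>f. (\<Phi>, f) \<in> diff_const X \<Longrightarrow> (F f, F \<Phi>) \<in> diff_const Y\<close>[of f] cls_eq_iff by blast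
  moreover have "\<Phi> \<in> cls X \<Phi>" using equiv_diff_const by (auto simp: equiv_def refl_on_def)
  ultimately show ?thesis by blast
qed

lemma diff_const_derivs:
  assumes fg: "(f, g) \<in> diff_const X" and X: "open (pts X)" and z: "z \<in> pts X"
  shows "deriv f z = deriv g z" "deriv (deriv f) z = deriv (deriv g) z"
proof -
  obtain c where c: "\<forall>z\<in>pts X. f z - g z = c" using fg by (auto simp: diff_const_def)
  have 1: "deriv f w = deriv g w" if w: "w \<in> pts X" for w
  proof -
    have "eventually (\<lambda>z. f z = g z + c) (nhds w)"
      using eventually_nhds_in_open[OF X w] by eventually_elim (use c in \<open>auto simp: algebra_simps\<close>)
    then have "deriv f w = deriv (\<lambda>z. g z + c) w" by (rule deriv_cong_ev) simp
    also have "\<dots> = deriv g w"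
    proof -
      have "((\<lambda>z. g z + c) has_field_derivative D) (at w) \<longleftrightarrow> (g has_field_derivative D) (at w)" for D
        using DERIV_add[of "\<lambda>z. g z + c" D w UNIV "\<lambda>_. - c" 0] DERIV_add[of g D w UNIV "\<lambda>_. c" 0] by auto
      then show ?thesis unfolding deriv_def by simp
    qed
    finally show ?thesis .
  qed
  show "deriv f z = deriv g z" by (rule 1[OF z])
  have "eventually (\<lambda>z. deriv f z = deriv g z) (nhds z)"
    using eventually_nhds_in_open[OF X z] by eventually_elim (rule 1)
  then show "deriv (deriv f) z = deriv (deriv g) z" by (rule deriv_cong_ev) simp
qed

text \<open>
  What makes the seminorms depend only on the class of a function: derivatives at points of the domain are
  determined there, and the boxes stay inside.
\<close>

definition admissible :: "hyp_domain \<Rightarrow> bool" where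
  "admissible X \<longleftrightarrow> open (pts X) \<and> (\<forall>J\<in>bases X. hyp_domain.box X J \<subseteq> pts X)"

lemma diff_const_besov:
  assumes X: "admissible X" and fg: "(f, g) \<in> diff_const X"
  shows "besov_integral X p f = besov_integral X p g" "bmoa_sup X f = bmoa_sup X g"
    "besov_norm X p f = besov_norm X p g" "f \<in> besov_functions X p \<longleftrightarrow> g \<in> besov_functions X p"
proof -
  have op: "open (pts X)" using X by (simp add: admissible_def)
  show 1: "besov_integral X p f = besov_integral X p g"
    unfolding besov_integral_def
    using diff_const_derivs[OF fg op] by (intro nn_integral_cong) (auto simp: indicator_def)
  show 2: "bmoa_sup X f = bmoa_sup X g"
    unfolding bmoa_sup_def energy_def[symmetric]
  proof (rule SUP_cong[OF refl])
    fix J assume "J \<in> bases X"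
    then have "hyp_domain.box X J \<subseteq> pts X" using X by (simp add: admissible_def)
    then have "(\<integral>\<^sup>+z\<in>hyp_domain.box X J. energy X f z \<partial>lborel)
        = (\<integral>\<^sup>+z\<in>hyp_domain.box X J. energy X g z \<partial>lborel)"
      using diff_const_derivs(1)[OF fg op] by (intro nn_integral_cong) (auto simp: indicator_def energy_def)
    then show "ennreal (1 / measure lborel J) * (\<integral>\<^sup>+z\<in>hyp_domain.box X J. energy X f z \<partial>lborel)
      = ennreal (1 / measure lborel J) * (\<integral>\<^sup>+z\<in>hyp_domain.box X J. energy X g z \<partial>lborel)"
      by simp
  qed
  show "besov_norm X p f = besov_norm X p g" by (simp add: besov_norm_def 1 2)
  obtain c where c: "\<forall>z\<in>pts X. f z - g z = c" using fg by (auto simp: diff_const_def)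
  have "f holomorphic_on pts X \<longleftrightarrow> (\<lambda>z. g z + c) holomorphic_on pts X"
    using c by (intro holomorphic_cong) (auto simp: algebra_simps)
  also have "\<dots> \<longleftrightarrow> g holomorphic_on pts X"
    using holomorphic_on_diff[of "\<lambda>z. g z + c" "pts X" "\<lambda>_. c"] by (auto intro: holomorphic_intros)
  finally show "f \<in> besov_functions X p \<longleftrightarrow> g \<in> besov_functions X p"
    by (simp add: besov_functions_def 1 2)
qed

lemma besov_space_vectors: "vectors (besov_space X p) = cls X ` besov_functions X p"
  by (auto simp: besov_space_def quotient_def)

lemma besov_space_vnorm:
  assumes "admissible X"
  shows "vnorm (besov_space X p) (cls X \<Phi>) = besov_norm X p \<Phi>"
proof -
  have "\<Phi> \<in> cls X \<Phi>" using equiv_diff_const by (auto simp: equiv_def refl_on_def)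
  moreover have "besov_norm X p ` cls X \<Phi> = (\<lambda>_. besov_norm X p \<Phi>) ` cls X \<Phi>"
  proof (rule image_cong[OF refl])
    fix f assume "f \<in> cls X \<Phi>"
    then show "besov_norm X p f = besov_norm X p \<Phi>"
      using diff_const_besov(3)[OF assms, of \<Phi> f p] by simp
  qed
  ultimately have "besov_norm X p ` cls X \<Phi> = {besov_norm X p \<Phi>}"
    by (simp only: image_constant)
  then show ?thesis by (simp add: besov_space_def)
qed

lemma diff_const_add:
  assumes "(\<Phi>, f) \<in> diff_const X" "(\<Psi>, g) \<in> diff_const X"
  shows "((\<lambda>z. f z + g z), (\<lambda>z. \<Phi> z + \<Psi> z)) \<in> diff_const X"
proof -
  obtain c d where "\<forall>z\<in>pts X. \<Phi> z - f z = c" "\<forall>z\<in>pts X. \<Psi> z - g z = d"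
    using assms by (auto simp: diff_const_def)
  then show ?thesis by (intro diff_constI[where c = "- c - d"]) (auto simp: algebra_simps)
qed

lemma besov_space_vadd: "vadd (besov_space X p) (cls X \<Phi>) (cls X \<Psi>) = cls X (\<lambda>z. \<Phi> z + \<Psi> z)"
proof -
  have refl: "(h, h) \<in> diff_const X" for h by (auto simp: diff_const_def)
  have "(\<Union>g\<in>cls X \<Psi>. cls X (\<lambda>z. f z + g z)) = cls X (\<lambda>z. f z + \<Psi> z)" for f
    by (rule UN_cls) (rule diff_const_add[OF refl])
  moreover have "(\<Union>f\<in>cls X \<Phi>. cls X (\<lambda>z. f z + \<Psi> z)) = cls X (\<lambda>z. \<Phi> z + \<Psi> z)"
    by (rule UN_cls) (rule diff_const_add[OF _ refl])
  ultimately show ?thesis by (simp add: besov_space_def)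
qed

lemma besov_space_vscale: "vscale (besov_space X p) c (cls X \<Phi>) = cls X (\<lambda>z. c * \<Phi> z)"
proof -
  have "(\<Union>f\<in>cls X \<Phi>. cls X (\<lambda>z. c * f z)) = cls X (\<lambda>z. c * \<Phi> z)"
  proof (rule UN_cls)
    fix f assume "(\<Phi>, f) \<in> diff_const X"
    then obtain d where "\<forall>z\<in>pts X. \<Phi> z - f z = d" by (auto simp: diff_const_def)
    then show "((\<lambda>z. c * f z), (\<lambda>z. c * \<Phi> z)) \<in> diff_const X"
      by (intro diff_constI[where c = "- c * d"]) (auto simp: algebra_simps)
  qed
  then show ?thesis by (simp add: besov_space_def)
qed

text \<open>
  The inverse of a linear bijection is linear as soon as the source is closed under the operations, and it
  is bounded if the original map is bounded below.
\<close>

lemma normed_space_isoI: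
  assumes T: "bounded_linear_map V W T" and bij: "bij_betw T (vectors V) (vectors W)"
    and add: "\<And>x y. x \<in> vectors V \<Longrightarrow> y \<in> vectors V \<Longrightarrow> vadd V x y \<in> vectors V"
    and scale: "\<And>c x. x \<in> vectors V \<Longrightarrow> vscale V c x \<in> vectors V"
    and C: "\<And>x. x \<in> vectors V \<Longrightarrow> vnorm V x \<le> C * vnorm W (T x)"
  shows "normed_space_iso V W T"
proof -
  let ?S = "inv_into (vectors V) T"
  have S: "?S y \<in> vectors V" "T (?S y) = y" if "y \<in> vectors W" for y
    using bij that by (auto simp: bij_betw_def inv_into_into f_inv_into_f)
  have ST: "?S (T x) = x" if "x \<in> vectors V" for x
    using bij that by (simp add: bij_betw_def)
  have "bounded_linear_map W V ?S"
    unfolding bounded_linear_map_def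
  proof (intro conjI allI ballI)
    show "?S ` vectors W \<subseteq> vectors V" using S by auto
    fix x assume x: "x \<in> vectors W"
    show "?S (vadd W x y) = vadd V (?S x) (?S y)" if y: "y \<in> vectors W" for y
    proof -
      have "T (vadd V (?S x) (?S y)) = vadd W x y"
        using T S[OF x] S[OF y] by (simp add: bounded_linear_map_def)
      then show ?thesis using ST[OF add[OF S(1)[OF x] S(1)[OF y]]] by simp
    qed
    show "?S (vscale W c x) = vscale V c (?S x)" for c
    proof -
      have "T (vscale V c (?S x)) = vscale W c x"
        using T S[OF x] by (simp add: bounded_linear_map_def)
      then show ?thesis using ST[OF scale[OF S(1)[OF x], of c]] by simp
    qed
  next
    show "\<exists>C. \<forall>x\<in>vectors W. vnorm V (?S x) \<le> C * vnorm W x"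
      using C[OF S(1)] S(2) by (metis)
  qed
  then show ?thesis using T bij by (simp add: normed_space_iso_def)
qed

section \<open>The isomorphism\<close>

lemma cayley_conformal:
  assumes "H = upper_halfplane \<or> H = lower_halfplane"
  shows "open H" "cayley holomorphic_on H" "bij_betw cayley H (ball 0 1)"
    "inv_into H cayley holomorphic_on ball 0 1"
proof -
  show op: "open H" using assms open_lower_halfplane by auto
  have low: "cayley z = (cayley \<circ> uminus) z" if "z \<in> lower_halfplane" for z
    using that cayley_reflect[of "- z"] by (simp add: lower_halfplane_def)
  have "cayley \<circ> uminus holomorphic_on lower_halfplane"
    using holomorphic_reflect[OF cayley_holomorphic] by (simp add: reflect_lower)
  then have "cayley holomorphic_on lower_halfplane"
    using low holomorphic_cong by metis
  then show hol: "cayley holomorphic_on H" using assms cayley_holomorphic by auto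
  have "bij_betw uminus lower_halfplane upper_halfplane"
    by (auto simp: bij_betw_def reflect_lower)
  then have "bij_betw (cayley \<circ> uminus) lower_halfplane (ball 0 1)"
    using bij_betw_cayley by (rule bij_betw_trans)
  then have "bij_betw cayley lower_halfplane (ball 0 1)"
    using low by (metis bij_betw_cong)
  then show bij: "bij_betw cayley H (ball 0 1)" using assms bij_betw_cayley by auto
  obtain g where g: "g holomorphic_on cayley ` H" "\<And>z. z \<in> H \<Longrightarrow> deriv cayley z * deriv g (cayley z) = 1"
    "\<And>z. z \<in> H \<Longrightarrow> g (cayley z) = z"
    using holomorphic_has_inverse[OF hol op bij_betw_imp_inj_on[OF bij]] by blast
  have "inv_into H cayley w = g w" if "w \<in> ball 0 1" for w
    using that bij g(3) by (metis bij_betw_def inv_into_f_f imageE)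
  then show "inv_into H cayley holomorphic_on ball 0 1"
    using g(1) bij holomorphic_cong[of "ball 0 1" "ball 0 1" "inv_into H cayley" g]
        by (simp add: bij_betw_def)
qed

lemma admissible_domains:
  shows "open H \<Longrightarrow> admissible (halfplane_domain H)" "admissible disc_domain"
proof -
  show "open H \<Longrightarrow> admissible (halfplane_domain H)" by (auto simp: admissible_def halfplane_domain_def)
  show "admissible disc_domain"
    unfolding admissible_def
  proof (intro conjI ballI subsetI)
    fix J w assume J: "J \<in> bases disc_domain" and w: "w \<in> hyp_domain.box disc_domain J"
    have "measure lborel J / (2 * pi) \<le> 1" using J by (simp add: disc_domain_def)
    moreover obtain r \<theta> where r: "w = of_real r * cis \<theta>" "1 - measure lborel J / (2 * pi) \<le> r" "r < 1"
      using w by (auto simp: disc_domain_def)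
    ultimately have "0 \<le> r" by linarith
    then show "w \<in> pts disc_domain" using r by (simp add: disc_domain_def norm_mult)
  qed (simp add: disc_domain_def)
qed

theorem theorem2p5:
  fixes p :: real and H :: "complex set"
  assumes "p \<ge> 1" and "H = upper_halfplane \<or> H = lower_halfplane"
  shows "normed_space_iso (besov_space (halfplane_domain H) p) (besov_space disc_domain p)
           (push_forward H)"
proof -
  let ?X = "halfplane_domain H" and ?Y = disc_domain
  let ?V = "besov_space ?X p" and ?W = "besov_space ?Y p"
  let ?L = "inv_into H cayley" and ?T = "push_forward H"
  note conf = cayley_conformal[OF assms(2)]
  note adm = admissible_domains(1)[OF conf(1)] admissible_domains(2)
  have ptsX: "pts ?X = H" by (simp add: halfplane_domain_def)
  have ptsY: "pts ?Y = ball 0 1" by (simp add: disc_domain_def)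
  have L: "?L w \<in> H" "cayley (?L w) = w" if "w \<in> ball 0 1" for w
    using conf(3) that by (auto simp: bij_betw_def inv_into_into f_inv_into_f)
  have K: "cayley z \<in> ball 0 1" "?L (cayley z) = z" if "z \<in> H" for z
    using conf(3) that by (auto simp: bij_betw_def)
  have T: "?T (cls ?X \<Phi>) = cls ?Y (\<Phi> \<circ> ?L)" for \<Phi>
    unfolding push_forward_def
  proof (rule UN_cls)
    fix f assume "(\<Phi>, f) \<in> diff_const ?X"
    then obtain c where "\<forall>z\<in>H. \<Phi> z - f z = c" by (auto simp: diff_const_def ptsX)
    then show "(f \<circ> ?L, \<Phi> \<circ> ?L) \<in> diff_const ?Y"
      using L by (intro diff_constI[where c = "- c"]) (auto simp: ptsY algebra_simps)
  qed
  obtain C where C: "\<And>\<Phi> \<Psi>. \<lbrakk>\<Phi> holomorphic_on H; \<Psi> holomorphic_on ball 0 1; \<And>z. z \<in> H \<Longrightarrow> \<Phi> z = \<Psi> (cayley z)\<rbrakk> \<Longrightarrow>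
      (\<Phi> \<in> besov_functions ?X p \<longleftrightarrow> \<Psi> \<in> besov_functions ?Y p) \<and>
      (\<Phi> \<in> besov_functions ?X p \<longrightarrow> besov_norm ?Y p \<Psi> \<le> C * besov_norm ?X p \<Phi> \<and>
        besov_norm ?X p \<Phi> \<le> C * besov_norm ?Y p \<Psi>)"
    using besov_norm_equivalence[OF assms(2,1)] by metis
  have push: "\<Phi> \<circ> ?L \<in> besov_functions ?Y p" "besov_norm ?Y p (\<Phi> \<circ> ?L) \<le> C * besov_norm ?X p \<Phi>"
    "besov_norm ?X p \<Phi> \<le> C * besov_norm ?Y p (\<Phi> \<circ> ?L)"
    if \<Phi>: "\<Phi> \<in> besov_functions ?X p" for \<Phi>
  proof -
    have hol: "\<Phi> holomorphic_on H" using \<Phi> by (simp add: besov_functions_def ptsX)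
    have "\<Phi> \<circ> ?L holomorphic_on ball 0 1"
      using L by (intro holomorphic_on_compose_gen[OF conf(4) hol]) auto
    from C[OF hol this] K \<Phi> show "\<Phi> \<circ> ?L \<in> besov_functions ?Y p"
      "besov_norm ?Y p (\<Phi> \<circ> ?L) \<le> C * besov_norm ?X p \<Phi>"
      "besov_norm ?X p \<Phi> \<le> C * besov_norm ?Y p (\<Phi> \<circ> ?L)" by auto
  qed
  have pull: "\<Psi> \<circ> cayley \<in> besov_functions ?X p" if \<Psi>: "\<Psi> \<in> besov_functions ?Y p" for \<Psi>
  proof -
    have hol: "\<Psi> holomorphic_on ball 0 1" using \<Psi> by (simp add: besov_functions_def ptsY)
    have "\<Psi> \<circ> cayley holomorphic_on H"
      using K by (intro holomorphic_on_compose_gen[OF conf(2) hol]) auto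
    from C[OF this hol] \<Psi> show ?thesis by simp
  qed
  show ?thesis
  proof (rule normed_space_isoI)
    show "bounded_linear_map ?V ?W ?T"
      unfolding bounded_linear_map_def besov_space_vectors
    proof (intro conjI allI ballI)
      show "?T ` cls ?X ` besov_functions ?X p \<subseteq> cls ?Y ` besov_functions ?Y p"
        using push(1) by (auto simp: T)
      show "\<exists>C. \<forall>x\<in>cls ?X ` besov_functions ?X p. vnorm ?W (?T x) \<le> C * vnorm ?V x"
        using push(2) by (intro exI[of _ C]) (auto simp: T besov_space_vnorm adm)
    qed (auto simp: T besov_space_vadd besov_space_vscale comp_def)
    have "inj_on ?T (cls ?X ` besov_functions ?X p)"
    proof (rule inj_onI)
      fix A B assume "A \<in> cls ?X ` besov_functions ?X p" "B \<in> cls ?X ` besov_functions ?X p" "?T A = ?T B"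
      then obtain f g where fg: "A = cls ?X f" "B = cls ?X g" and "?T (cls ?X f) = ?T (cls ?X g)"
        by blast
      then have "(f \<circ> ?L, g \<circ> ?L) \<in> diff_const ?Y" by (simp only: T cls_eq_iff)
      then obtain c where c: "\<forall>w\<in>ball 0 1. f (?L w) - g (?L w) = c" by (auto simp: diff_const_def ptsY)
      have "f z - g z = c" if "z \<in> H" for z
        using bspec[OF c K(1)[OF that]] unfolding K(2)[OF that] .
      then show "A = B" unfolding fg cls_eq_iff by (intro diff_constI[where c = c]) (simp add: ptsX)
    qed
    moreover have "?T ` cls ?X ` besov_functions ?X p = cls ?Y ` besov_functions ?Y p"
    proof (intro equalityI subsetI)
      fix B assume "B \<in> ?T ` cls ?X ` besov_functions ?X p"
      then show "B \<in> cls ?Y ` besov_functions ?Y p" using push(1) by (auto simp: T)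
    next
      fix B assume "B \<in> cls ?Y ` besov_functions ?Y p"
      then obtain \<Psi> where \<Psi>: "B = cls ?Y \<Psi>" "\<Psi> \<in> besov_functions ?Y p" by auto
      have "(\<Psi> \<circ> cayley \<circ> ?L, \<Psi>) \<in> diff_const ?Y"
        using L by (intro diff_constI[where c = 0]) (auto simp: ptsY)
      then have "?T (cls ?X (\<Psi> \<circ> cayley)) = B" unfolding T \<Psi>(1) cls_eq_iff .
      then show "B \<in> ?T ` cls ?X ` besov_functions ?X p" using pull[OF \<Psi>(2)] by blast
    qed
    ultimately show "bij_betw ?T (vectors ?V) (vectors ?W)"
      unfolding bij_betw_def besov_space_vectors ..
    fix x assume x: "x \<in> vectors ?V"
    show "vadd ?V x y \<in> vectors ?V" if "y \<in> vectors ?V" for y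
      using x that besov_halfplane_lincomb[OF conf(1), of p _ _ 1 1] assms(1)
      by (auto simp: besov_space_vectors besov_space_vadd)
    show "vscale ?V c x \<in> vectors ?V" for c
      using x besov_halfplane_lincomb[OF conf(1), of p _ _ c 0] assms(1)
      by (auto simp: besov_space_vectors besov_space_vscale)
    show "vnorm ?V x \<le> C * vnorm ?W (?T x)"
      using x push(3) by (auto simp: besov_space_vectors T besov_space_vnorm adm)
  qed
qed

end
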